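(* Let $d\geq 4$, $d\neq 6,7$, and let $O$ be an equipment of the alternating group $\mathbb A_d$. Then $a_{(\mathbb A_d,O)}=2$ if and only if $O$ consists of conjugacy classes of permutations whose decompositions into disjoint cycles have no cycles of even length and conjugacy classes of permutations which can be expressed as a product of disjoint cycles with at least one cycle of even length and with no two cycles of the same length (including length $1$). Otherwise, $a_{(\mathbb A_d,O)}=1$.
   Context: An equipment of a finite group $G$ is a subset $O\subset G$ that is a union of conjugacy classes of $G$ and generates $G$. Ambiguity index: let $\widetilde G$ be the group generated by the letters $y_g$, $g\in O$, subject to the relations $y_{g_1}y_{g_2}=y_{g_2}y_{g_2^{-1}g_1g_2}=y_{g_1g_2g_1^{-1}}y_{g_1}$ for all $g_1,g_2\in O$, and let $\beta:\widetilde G\to G$ be the homomorphism with $\beta(y_g)=g$. The commutator subgroup $[\widetilde G,\widetilde G]$ is known to be finite, and $a_{(G,O)}$ is the order of $\ker\beta\cap[\widetilde G,\widetilde G]$. "Including length $1$" means that fixed points are counted as cycles of length $1$, so at most one fixed point is allowed in that case. *)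

theory Defs
  imports "HOL-Algebra.Sym_Groups"
begin

text \<open>
  Groups given by generators and relations. A word over \<open>S\<close> is a list of signed letters:
  \<open>(True, a)\<close> stands for the generator \<open>y\<^sub>a\<close> and \<open>(False, a)\<close> for its inverse. The group is the
  quotient of the free monoid of words by the least congruence that contains the relations
  and makes \<open>(True, a)\<close> and \<open>(False, a)\<close> mutually inverse.
\<close>

type_synonym 'a word = "(bool \<times> 'a) list"

definition words :: "'a set \<Rightarrow> 'a word set"
  where "words S = lists (UNIV \<times> S)"

inductive pres_eq :: "'a set \<Rightarrow> ('a word \<times> 'a word) set \<Rightarrow> 'a word \<Rightarrow> 'a word \<Rightarrow> bool"
  for S R where
  refl: "u \<in> words S \<Longrightarrow> pres_eq S R u u"
| sym: "pres_eq S R u v \<Longrightarrow> pres_eq S R v u"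
| trans: "pres_eq S R u v \<Longrightarrow> pres_eq S R v w \<Longrightarrow> pres_eq S R u w"
| append: "pres_eq S R u u' \<Longrightarrow> pres_eq S R v v' \<Longrightarrow> pres_eq S R (u @ v) (u' @ v')"
| cancel: "a \<in> S \<Longrightarrow> pres_eq S R [(b, a), (\<not> b, a)] []"
| rel: "(u, v) \<in> R \<Longrightarrow> u \<in> words S \<Longrightarrow> v \<in> words S \<Longrightarrow> pres_eq S R u v"

definition pres_rel :: "'a set \<Rightarrow> ('a word \<times> 'a word) set \<Rightarrow> ('a word \<times> 'a word) set"
  where "pres_rel S R = {(u, v). pres_eq S R u v}"

definition presented_group :: "'a set \<Rightarrow> ('a word \<times> 'a word) set \<Rightarrow> 'a word set monoid"
  where "presented_group S R =
    \<lparr> carrier = words S // pres_rel S R,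
      mult = (\<lambda>X Y. \<Union>u\<in>X. \<Union>v\<in>Y. pres_rel S R `` {u @ v}),
      one = pres_rel S R `` {[]} \<rparr>"

definition word_value :: "('a, 'b) monoid_scheme \<Rightarrow> 'a word \<Rightarrow> 'a"
  where "word_value G w =
    foldr (\<lambda>(b, g) x. (if b then g else inv\<^bsub>G\<^esub> g) \<otimes>\<^bsub>G\<^esub> x) w \<one>\<^bsub>G\<^esub>"

definition conj_class :: "('a, 'b) monoid_scheme \<Rightarrow> 'a \<Rightarrow> 'a set"
  where "conj_class G x = {g \<otimes>\<^bsub>G\<^esub> x \<otimes>\<^bsub>G\<^esub> inv\<^bsub>G\<^esub> g | g. g \<in> carrier G}"

definition equipment :: "('a, 'b) monoid_scheme \<Rightarrow> 'a set \<Rightarrow> bool"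
  where "equipment G E \<longleftrightarrow>
    (\<exists>\<C> \<subseteq> conj_class G ` carrier G. E = \<Union>\<C>) \<and> generate G E = carrier G"

definition equipment_relations :: "('a, 'b) monoid_scheme \<Rightarrow> 'a set \<Rightarrow> ('a word \<times> 'a word) set"
  where "equipment_relations G E =
    {([(True, g1), (True, g2)],
      [(True, g2), (True, inv\<^bsub>G\<^esub> g2 \<otimes>\<^bsub>G\<^esub> g1 \<otimes>\<^bsub>G\<^esub> g2)]) | g1 g2. g1 \<in> E \<and> g2 \<in> E} \<union>
    {([(True, g1), (True, g2)],
      [(True, g1 \<otimes>\<^bsub>G\<^esub> g2 \<otimes>\<^bsub>G\<^esub> inv\<^bsub>G\<^esub> g1), (True, g1)]) | g1 g2. g1 \<in> E \<and> g2 \<in> E}"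

definition tilde_group :: "('a, 'b) monoid_scheme \<Rightarrow> 'a set \<Rightarrow> 'a word set monoid"
  where "tilde_group G E = presented_group E (equipment_relations G E)"

definition tilde_gen :: "('a, 'b) monoid_scheme \<Rightarrow> 'a set \<Rightarrow> 'a \<Rightarrow> 'a word set"
  where "tilde_gen G E g = pres_rel E (equipment_relations G E) `` {[(True, g)]}"

text \<open>The value in \<open>G\<close> is the same for all words of a class; see \<open>tilde_map_hom\<close> and
  \<open>tilde_map_gen\<close> below.\<close>

definition tilde_map :: "('a, 'b) monoid_scheme \<Rightarrow> 'a word set \<Rightarrow> 'a"
  where "tilde_map G X = the_elem (word_value G ` X)"

definition ambiguity_index :: "('a, 'b) monoid_scheme \<Rightarrow> 'a set \<Rightarrow> nat"
  where "ambiguity_index G E =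
    card (kernel (tilde_group G E) G (tilde_map G) \<inter>
          derived (tilde_group G E) (carrier (tilde_group G E)))"

text \<open>
  A factorization of a permutation of \<open>{1..n}\<close> into disjoint cycles, in which every fixed point
  appears as a cycle of length 1.
\<close>

definition cycle_factorization :: "nat \<Rightarrow> (nat \<Rightarrow> nat) \<Rightarrow> nat list list \<Rightarrow> bool"
  where "cycle_factorization n p css \<longleftrightarrow>
    [] \<notin> set css \<and> distinct (concat css) \<and> set (concat css) = {1..n} \<and>
    p = foldr (\<circ>) (map cycle_of_list css) id"

definition no_even_cycles :: "nat \<Rightarrow> (nat \<Rightarrow> nat) \<Rightarrow> bool"
  where "no_even_cycles n p \<longleftrightarrow>
    (\<exists>css. cycle_factorization n p css \<and> (\<forall>cs\<in>set css. odd (length cs)))"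

definition even_cycle_distinct_lengths :: "nat \<Rightarrow> (nat \<Rightarrow> nat) \<Rightarrow> bool"
  where "even_cycle_distinct_lengths n p \<longleftrightarrow>
    (\<exists>css. cycle_factorization n p css \<and> (\<exists>cs\<in>set css. even (length cs)) \<and>
           distinct (map length css))"


lemma words_append: "u @ v \<in> words S \<longleftrightarrow> u \<in> words S \<and> v \<in> words S"
  by (auto simp: words_def)

lemma pres_eq_words: "pres_eq S R u v \<Longrightarrow> u \<in> words S \<and> v \<in> words S"
  by (induction rule: pres_eq.induct) (auto simp: words_append, auto simp: words_def)

lemma equiv_pres_rel: "equiv (words S) (pres_rel S R)"
proof (rule equivI)
  show "pres_rel S R \<subseteq> words S \<times> words S"
    by (auto simp: pres_rel_def dest: pres_eq_words)
  show "refl_on (words S) (pres_rel S R)"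
    by (auto simp: refl_on_def pres_rel_def intro: pres_eq.refl)
  show "sym (pres_rel S R)"
    by (auto simp: sym_def pres_rel_def intro: pres_eq.sym)
  show "trans (pres_rel S R)"
    by (auto simp: trans_def pres_rel_def intro: pres_eq.trans)
qed

lemma pres_class_eq_iff:
  assumes "u \<in> words S" "v \<in> words S"
  shows "pres_rel S R `` {u} = pres_rel S R `` {v} \<longleftrightarrow> pres_eq S R u v"
  using eq_equiv_class_iff[OF equiv_pres_rel assms] by (simp add: pres_rel_def)

lemma presented_group_mult:
  assumes "u \<in> words S" "v \<in> words S"
  shows "pres_rel S R `` {u} \<otimes>\<^bsub>presented_group S R\<^esub> pres_rel S R `` {v} =
    pres_rel S R `` {u @ v}"
proof -
  have "pres_rel S R `` {u' @ v'} = pres_rel S R `` {u @ v}"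
    if "u' \<in> pres_rel S R `` {u}" "v' \<in> pres_rel S R `` {v}" for u' v'
  proof -
    have "pres_eq S R (u @ v) (u' @ v')"
      using that by (auto simp: pres_rel_def intro: pres_eq.append)
    then show ?thesis
      using pres_class_eq_iff pres_eq_words by metis
  qed
  moreover have "u \<in> pres_rel S R `` {u}" "v \<in> pres_rel S R `` {v}"
    using assms by (auto simp: pres_rel_def intro: pres_eq.refl)
  ultimately have "(\<Union>u'\<in>pres_rel S R `` {u}. \<Union>v'\<in>pres_rel S R `` {v}. pres_rel S R `` {u' @ v'}) =
      pres_rel S R `` {u @ v}"
    by blast
  then show ?thesis
    by (simp add: presented_group_def)
qed

lemma presented_group_carrierE:
  assumes "X \<in> carrier (presented_group S R)"
  obtains u where "u \<in> words S" "X = pres_rel S R `` {u}"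
  using assms by (auto simp: presented_group_def elim: quotientE)

lemma presented_group_carrierI:
  "u \<in> words S \<Longrightarrow> pres_rel S R `` {u} \<in> carrier (presented_group S R)"
  by (auto simp: presented_group_def intro: quotientI)

lemma pres_eq_inverse_word:
  "u \<in> words S \<Longrightarrow> pres_eq S R (rev (map (\<lambda>(b, a). (\<not> b, a)) u) @ u) []"
proof (induction u)
  case Nil
  then show ?case by (simp add: pres_eq.refl)
next
  case (Cons x u)
  obtain b a where x: "x = (b, a)" by force
  let ?i = "rev (map (\<lambda>(b, a). (\<not> b, a)) u)"
  have u: "u \<in> words S" and a: "a \<in> S"
    using Cons.prems by (auto simp: words_def x)
  have IH: "pres_eq S R (?i @ u) []" using Cons.IH u .
  have i: "?i \<in> words S" using pres_eq_words[OF IH] by (simp add: words_append)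
  have "pres_eq S R [(\<not> b, a), (\<not> \<not> b, a)] []" using a by (rule pres_eq.cancel)
  then have "pres_eq S R (?i @ ([(\<not> b, a), (b, a)] @ u)) (?i @ ([] @ u))"
    by (intro pres_eq.append pres_eq.refl u i) simp
  then have "pres_eq S R (rev (map (\<lambda>(b, a). (\<not> b, a)) (x # u)) @ x # u) (?i @ u)"
    by (simp add: x)
  then show ?case using IH by (rule pres_eq.trans)
qed

lemma group_presented_group: "group (presented_group S R)"
proof (rule groupI)
  let ?P = "presented_group S R"
  have nil: "[] \<in> words S" by (simp add: words_def)
  have one: "\<one>\<^bsub>?P\<^esub> = pres_rel S R `` {[]}" by (simp add: presented_group_def)
  show "\<one>\<^bsub>?P\<^esub> \<in> carrier ?P"
    unfolding one using nil by (rule presented_group_carrierI)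
  fix X assume X: "X \<in> carrier ?P"
  then obtain u where u: "u \<in> words S" "X = pres_rel S R `` {u}"
    by (rule presented_group_carrierE)
  show "\<one>\<^bsub>?P\<^esub> \<otimes>\<^bsub>?P\<^esub> X = X"
    unfolding one u(2) by (simp add: presented_group_mult nil u(1))
  let ?i = "rev (map (\<lambda>(b, a). (\<not> b, a)) u)"
  have eq: "pres_eq S R (?i @ u) []" using u(1) by (rule pres_eq_inverse_word)
  then have i: "?i \<in> words S" using pres_eq_words words_append by metis
  have "pres_rel S R `` {?i @ u} = pres_rel S R `` {[]}"
    using eq pres_class_eq_iff pres_eq_words by metis
  then have "pres_rel S R `` {?i} \<otimes>\<^bsub>?P\<^esub> X = \<one>\<^bsub>?P\<^esub>"
    unfolding one u(2) by (simp only: presented_group_mult[OF i u(1)])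
  then show "\<exists>Y\<in>carrier ?P. Y \<otimes>\<^bsub>?P\<^esub> X = \<one>\<^bsub>?P\<^esub>"
    using presented_group_carrierI[OF i] by blast
  fix Y assume Y: "Y \<in> carrier ?P"
  then obtain v where v: "v \<in> words S" "Y = pres_rel S R `` {v}"
    by (rule presented_group_carrierE)
  show "X \<otimes>\<^bsub>?P\<^esub> Y \<in> carrier ?P"
    unfolding u(2) v(2)
    by (simp add: presented_group_mult u v presented_group_carrierI words_append)
  fix Z assume Z: "Z \<in> carrier ?P"
  then obtain w where w: "w \<in> words S" "Z = pres_rel S R `` {w}"
    by (rule presented_group_carrierE)
  show "X \<otimes>\<^bsub>?P\<^esub> Y \<otimes>\<^bsub>?P\<^esub> Z = X \<otimes>\<^bsub>?P\<^esub> (Y \<otimes>\<^bsub>?P\<^esub> Z)"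
    unfolding u(2) v(2) w(2)
    by (simp add: presented_group_mult u v w words_append)
qed

lemma (in group) equipment_subset: "equipment G E \<Longrightarrow> E \<subseteq> carrier G"
  unfolding equipment_def by (metis generate.incl subsetI)

lemma (in group) word_value_closed:
  "E \<subseteq> carrier G \<Longrightarrow> u \<in> words E \<Longrightarrow> word_value G u \<in> carrier G"
  by (induction u) (auto simp: word_value_def words_def subset_iff)

lemma (in group) word_value_append:
  assumes "E \<subseteq> carrier G" "v \<in> words E"
  shows "u \<in> words E \<Longrightarrow> word_value G (u @ v) = word_value G u \<otimes> word_value G v"
proof (induction u)
  case Nil
  then show ?case using word_value_closed[OF assms] by (simp add: word_value_def)
next
  case (Cons x u)
  obtain b a where x: "x = (b, a)" by force
  have "u \<in> words E" and a: "a \<in> carrier G"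
    using Cons.prems assms(1) by (auto simp: words_def x)
  with Cons.IH have "word_value G (u @ v) = word_value G u \<otimes> word_value G v"
    "word_value G u \<in> carrier G" "word_value G v \<in> carrier G"
    using word_value_closed assms by auto
  then show ?case using a by (auto simp: word_value_def x m_assoc)
qed

lemma (in group) word_value_pres_eq:
  assumes "E \<subseteq> carrier G" "pres_eq E (equipment_relations G E) u v"
  shows "word_value G u = word_value G v"
  using assms(2)
proof (induction rule: pres_eq.induct)
  case (append u u' v v')
  then show ?case
    using word_value_append[OF assms(1)] pres_eq_words by metis
next
  case (cancel a b)
  then show ?case using assms(1) by (auto simp: word_value_def)
next
  case (rel u v)
  have "g2 \<otimes> (inv g2 \<otimes> (g1 \<otimes> g2)) = g1 \<otimes> g2" if "g1 \<in> E" "g2 \<in> E" for g1 g2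
  proof -
    have "g1 \<in> carrier G" "g2 \<in> carrier G" using that assms(1) by auto
    then show ?thesis by (simp add: m_assoc[symmetric])
  qed
  then show ?case
    using rel(1) assms(1) by (auto simp: equipment_relations_def word_value_def m_assoc subset_iff)
qed auto

lemma (in group) tilde_map_class:
  assumes "E \<subseteq> carrier G" "u \<in> words E"
  shows "tilde_map G (pres_rel E (equipment_relations G E) `` {u}) = word_value G u"
proof -
  have "word_value G ` (pres_rel E (equipment_relations G E) `` {u}) = {word_value G u}"
  proof (intro equalityI subsetI)
    fix x assume "x \<in> word_value G ` (pres_rel E (equipment_relations G E) `` {u})"
    then show "x \<in> {word_value G u}"
      using word_value_pres_eq[OF assms(1)] by (auto simp: pres_rel_def)
  next
    fix x assume "x \<in> {word_value G u}"
    then show "x \<in> word_value G ` (pres_rel E (equipment_relations G E) `` {u})"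
      using pres_eq.refl[OF assms(2)] by (auto simp: pres_rel_def)
  qed
  then show ?thesis by (simp add: tilde_map_def)
qed

lemma (in group) tilde_map_hom:
  assumes "equipment G E"
  shows "tilde_map G \<in> hom (tilde_group G E) G"
proof (rule homI)
  note E = equipment_subset[OF assms]
  fix X assume "X \<in> carrier (tilde_group G E)"
  then obtain u where u: "u \<in> words E" "X = pres_rel E (equipment_relations G E) `` {u}"
    unfolding tilde_group_def by (rule presented_group_carrierE)
  show "tilde_map G X \<in> carrier G"
    unfolding u(2) using E u(1) by (simp add: tilde_map_class word_value_closed)
  fix Y assume "Y \<in> carrier (tilde_group G E)"
  then obtain v where v: "v \<in> words E" "Y = pres_rel E (equipment_relations G E) `` {v}"
    unfolding tilde_group_def by (rule presented_group_carrierE)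
  show "tilde_map G (X \<otimes>\<^bsub>tilde_group G E\<^esub> Y) = tilde_map G X \<otimes> tilde_map G Y"
    unfolding u(2) v(2) tilde_group_def
    by (simp add: presented_group_mult u(1) v(1) tilde_map_class E words_append
        word_value_append[OF E v(1) u(1)])
qed

lemma (in group) tilde_map_gen:
  assumes "equipment G E" "g \<in> E"
  shows "tilde_map G (tilde_gen G E g) = g"
proof -
  have "[(True, g)] \<in> words E" using assms(2) by (simp add: words_def)
  then show ?thesis
    using equipment_subset[OF assms(1)] assms(2)
    by (auto simp: tilde_gen_def tilde_map_class word_value_def)
qed

end

theory Submission
  imports Defs Complex_Main
begin

text \<open>
  In the group of an equipment \<open>E\<close>, an element \<open>X\<close> above \<open>h\<close> satisfies
  \<open>X y\<^sub>g = y\<^sub>k X\<close> with \<open>k = h g h\<^sup>-\<^sup>1\<close>. Hence \<open>\<beta>\<close> has a central kernel, and elements above \<open>h\<close> commute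
  with \<open>y\<^sub>g\<close> as soon as \<open>h\<close> commutes with \<open>g\<close>. The ambiguity index therefore measures how much of the
  double cover of the alternating group survives when the lift of every \<open>g \<in> E\<close> is forced to commute
  with the lifts of its centralizer. Three facts decide this.

  First, in every central extension of the alternating group of degree \<open>d \<ge> 4\<close>, \<open>d \<noteq> 6, 7\<close>, the kernel
  meets the derived subgroup in at most two elements (\<open>derived_kernel_le_two\<close>). For \<open>d \<ge> 5\<close> the even
  permutations that fix three points form a trivial or a perfect group. So conjugation carries one
  well-chosen lift of a three-cycle to a lift of every three-cycle, compatibly with the action of the
  alternating group. These lifts satisfy the relations of three-cycles up to one central element
  \<open>\<kappa>\<close> with \<open>\<kappa>\<^sup>2 = 1\<close>, and coset rewriting along the chain of alternating groups shows that a product of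
  them above the identity is \<open>1\<close> or \<open>\<kappa>\<close>. For \<open>d = 4\<close> the derived subgroup is contained in a set of at most eight
  elements that multiply like the quaternion units.

  Second, the double cover is realised by operators on spinors, where \<open>(e\<^sub>i - e\<^sub>j) / \<surd>2\<close> lies above the
  transposition of \<open>i\<close> and \<open>j\<close>. Lifts of odd permutations with disjoint supports anticommute. For an
  even \<open>g\<close> and \<open>h\<close> in its centralizer, consider the commutator of their lifts multiplied by the sign
  of \<open>h\<close>. It is multiplicative in \<open>h\<close>, equals \<open>1\<close> on the cycles of \<open>g\<close> and \<open>-1\<close> on an exchange of two
  cycles of equal length. If the cycles have distinct lengths, their powers generate the centralizer,
  so even \<open>h\<close> have commuting lifts. If all lengths are odd, then \<open>g\<close> has odd order and the commutator,
  a sign, is \<open>1\<close>. In the remaining case an exchange, multiplied by a cycle of even length if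
  the exchange is odd, is an even \<open>h\<close> with commutator \<open>-1\<close>.

  Third, both answers follow. If all classes of \<open>E\<close> split, they lift equivariantly to the spin cover, and the
  universal property gives a homomorphism to it under which a commutator above two
  commuting elements of the four-group becomes \<open>-1\<close>: the index is two. Otherwise the fibre product
  with the spin cover has \<open>(1, -1)\<close> in its derived subgroup, because the left components
  commute and the right components anticommute. By the first fact nothing else nontrivial lies there
  above the identity, and projecting to the left component leaves only \<open>1\<close>: the index is one.
\<close>

section \<open>Permutations with prescribed values\<close>

lemma exists_permutation_mapping:
  assumes "finite S" "distinct xs" "distinct ys" "length xs = length ys"
    "set xs \<subseteq> S" "set ys \<subseteq> S"
  shows "\<exists>p. p permutes S \<and> map p xs = ys"
proof -
  have "card (S - set xs) = card (S - set ys)"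
    using assms by (simp add: card_Diff_subset distinct_card)
  then obtain h where h: "bij_betw h (S - set xs) (S - set ys)"
    using assms(1) by (metis finite_Diff finite_same_card_bij)
  define f where "f x = (case map_of (zip xs ys) x of None \<Rightarrow> h x | Some y \<Rightarrow> y)" for x
  have f_in: "f (xs ! i) = ys ! i" if "i < length xs" for i
    using that assms(2,4) unfolding f_def by (simp add: map_of_zip_nth)
  have f_out: "f x = h x" if "x \<notin> set xs" for x
    using that map_of_zip_is_None[OF assms(4), of x] unfolding f_def by (metis option.simps(4))
  have map_f: "map f xs = ys"
    using f_in assms(4) by (auto intro: nth_equalityI)
  then have "f ` set xs = set ys" by (metis set_map)
  moreover have "inj_on f (set xs)"
    using map_f assms(2,3) by (metis distinct_map)
  ultimately have b1: "bij_betw f (set xs) (set ys)" by (simp add: bij_betw_def)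
  have b2: "bij_betw f (S - set xs) (S - set ys)"
    using h f_out by (subst bij_betw_cong[of _ _ h]) auto
  have "bij_betw f (set xs \<union> (S - set xs)) (set ys \<union> (S - set ys))"
    using b1 b2 by (rule bij_betw_combine) auto
  then have "bij_betw f S S" using assms(5,6) by (simp add: Un_absorb1)
  then have "restrict_id f S permutes S" by (rule permutes_restrict_id)
  moreover have "map (restrict_id f S) xs = ys"
    using map_f assms(5) by (smt (verit) map_eq_conv restrict_id_simps(1) subsetD)
  ultimately show ?thesis by blast
qed

text \<open>With two points outside the prescribed values, composing with their transposition corrects the
  parity.\<close>

lemma exists_even_permutation_mapping:
  assumes "finite S" "distinct xs" "distinct ys" "length xs = length ys"
    "set xs \<subseteq> S" "set ys \<subseteq> S" "length ys + 2 \<le> card S"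
  shows "\<exists>p. p permutes S \<and> evenperm p \<and> map p xs = ys"
proof -
  obtain p where p: "p permutes S" "map p xs = ys"
    using exists_permutation_mapping[OF assms(1-6)] by blast
  have "card (S - set ys) \<ge> 2"
    using assms by (simp add: card_Diff_subset distinct_card)
  then obtain a b where ab: "a \<in> S - set ys" "b \<in> S - set ys" "a \<noteq> b"
    by (auto simp: numeral_2_eq_2 card_le_Suc_iff)
  let ?q = "transpose a b \<circ> p"
  have q: "?q permutes S"
    using ab p(1) by (intro permutes_compose permutes_swap_id) auto
  have "map ?q xs = map (transpose a b) ys" using p(2) by (metis map_map)
  also have "\<dots> = ys"
    using ab by (intro map_idI) (metis DiffD2 transpose_apply_other)
  finally have mq: "map ?q xs = ys" .
  have "permutation p" using p(1) assms(1) permutation_permutes by blast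
  then have "evenperm ?q \<longleftrightarrow> \<not> evenperm p"
    using ab(3) by (simp add: evenperm_comp permutation_swap_id evenperm_swap)
  then show ?thesis using p q mq by blast
qed

section \<open>Central extensions of alternating groups\<close>

abbreviation three_cycle :: "'a \<Rightarrow> 'a \<Rightarrow> 'a \<Rightarrow> 'a \<Rightarrow> 'a" where
  "three_cycle a b c \<equiv> cycle_of_list [a, b, c]"

lemma alt_comp: "p \<in> carrier (alt_group d) \<Longrightarrow> q \<in> carrier (alt_group d) \<Longrightarrow> p \<circ> q \<in> carrier (alt_group d)"
  using group.is_monoid[OF alt_group_is_group, THEN monoid.m_closed] by (simp add: alt_group_mult)

lemma alt_id: "id \<in> carrier (alt_group d)"
  by (simp add: alt_group_carrier)

lemma alt_bij: "p \<in> carrier (alt_group d) \<Longrightarrow> bij p"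
  by (auto simp: alt_group_carrier permutes_bij)

lemma alt_inv_comp: "p \<in> carrier (alt_group d) \<Longrightarrow> inv' p \<circ> p = id" "p \<in> carrier (alt_group d) \<Longrightarrow> p \<circ> inv' p = id"
  by (auto simp: alt_group_carrier permutes_inv_o)

lemma three_cycle_alt:
  "distinct [a, b, c] \<Longrightarrow> {a, b, c} \<subseteq> {1..d} \<Longrightarrow> three_cycle a b c \<in> carrier (alt_group d)"
  by (rule subsetD[OF three_cycles_incl], rule CollectI, rule exI[of _ "[a, b, c]"]) auto

lemma three_cycle_conj:
  "distinct [a, b, c] \<Longrightarrow> bij p \<Longrightarrow> p \<circ> three_cycle a b c \<circ> inv' p = three_cycle (p a) (p b) (p c)"
  using conjugation_of_cycle[of "[a, b, c]" p] by (simp only: list.map)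

context group
begin

definition conj_by :: "'a \<Rightarrow> 'a \<Rightarrow> 'a" where
  "conj_by x y = x \<otimes> y \<otimes> inv x"

lemma inv_cancel [simp]:
  "x \<in> carrier G \<Longrightarrow> y \<in> carrier G \<Longrightarrow> x \<otimes> (inv x \<otimes> y) = y"
  "x \<in> carrier G \<Longrightarrow> y \<in> carrier G \<Longrightarrow> inv x \<otimes> (x \<otimes> y) = y"
  by (simp_all add: m_assoc[symmetric])

lemma conj_by_closed [simp]: "x \<in> carrier G \<Longrightarrow> y \<in> carrier G \<Longrightarrow> conj_by x y \<in> carrier G"
  by (simp add: conj_by_def)

lemma conj_by_mult:
  "x \<in> carrier G \<Longrightarrow> y \<in> carrier G \<Longrightarrow> z \<in> carrier G \<Longrightarrow> conj_by x (y \<otimes> z) = conj_by x y \<otimes> conj_by x z"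
  by (simp add: conj_by_def m_assoc)

lemma conj_by_inv: "x \<in> carrier G \<Longrightarrow> y \<in> carrier G \<Longrightarrow> conj_by x (inv y) = inv (conj_by x y)"
  by (simp add: conj_by_def m_assoc inv_mult_group)

lemma conj_by_conj_by:
  "x \<in> carrier G \<Longrightarrow> y \<in> carrier G \<Longrightarrow> z \<in> carrier G \<Longrightarrow> conj_by x (conj_by y z) = conj_by (x \<otimes> y) z"
  by (simp add: conj_by_def m_assoc inv_mult_group)

lemma conj_by_commuting:
  assumes "x \<in> carrier G" "y \<in> carrier G" "x \<otimes> y = y \<otimes> x"
  shows "conj_by x y = y"
  using assms by (simp add: conj_by_def m_assoc)

lemma conj_by_one: "y \<in> carrier G \<Longrightarrow> conj_by \<one> y = y"
  by (simp add: conj_by_def)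

lemma conj_by_eq: "x \<in> carrier G \<Longrightarrow> y \<in> carrier G \<Longrightarrow> conj_by x y \<otimes> x = x \<otimes> y"
  by (simp add: conj_by_def m_assoc)

end

locale alt_central_extension = group F for F (structure) +
  fixes d :: nat and \<pi> :: "'a \<Rightarrow> nat \<Rightarrow> nat"
  assumes \<pi>_mult: "x \<in> carrier F \<Longrightarrow> y \<in> carrier F \<Longrightarrow> \<pi> (x \<otimes> y) = \<pi> x \<circ> \<pi> y"
    and \<pi>_alt: "x \<in> carrier F \<Longrightarrow> \<pi> x \<in> carrier (alt_group d)"
    and \<pi>_surj: "p \<in> carrier (alt_group d) \<Longrightarrow> \<exists>x\<in>carrier F. \<pi> x = p"
    and central: "k \<in> carrier F \<Longrightarrow> \<pi> k = id \<Longrightarrow> x \<in> carrier F \<Longrightarrow> k \<otimes> x = x \<otimes> k"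
begin

lemma \<pi>_one: "\<pi> \<one> = id"
proof -
  have "\<pi> \<one> = \<pi> \<one> \<circ> \<pi> \<one>" using \<pi>_mult[of \<one> \<one>] by simp
  moreover have "inv' (\<pi> \<one>) \<circ> \<pi> \<one> = id" using \<pi>_alt[of \<one>] by (simp add: alt_inv_comp)
  ultimately show ?thesis by (metis comp_assoc id_comp)
qed

lemma \<pi>_inv: "x \<in> carrier F \<Longrightarrow> \<pi> (inv x) = inv' (\<pi> x)"
  by (metis \<pi>_alt \<pi>_mult \<pi>_one alt_inv_comp(1) comp_assoc comp_id id_comp inv_closed r_inv)

lemma \<pi>_conj: "x \<in> carrier F \<Longrightarrow> y \<in> carrier F \<Longrightarrow> \<pi> (conj_by x y) = \<pi> x \<circ> \<pi> y \<circ> inv' (\<pi> x)"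
  by (simp add: conj_by_def \<pi>_mult \<pi>_inv)

lemma conj_by_central: "k \<in> carrier F \<Longrightarrow> \<pi> k = id \<Longrightarrow> x \<in> carrier F \<Longrightarrow> conj_by x k = k"
  using central[of k x] conj_by_commuting[of x k] by simp

lemma conj_by_cong:
  assumes "x \<in> carrier F" "y \<in> carrier F" "z \<in> carrier F" "\<pi> x = \<pi> y"
  shows "conj_by x z = conj_by y z"
proof -
  have "\<pi> (inv y \<otimes> x) = id"
    using assms by (simp add: \<pi>_mult \<pi>_inv alt_inv_comp[OF \<pi>_alt])
  then have "conj_by (inv y \<otimes> x) z = z"
    using central assms by (intro conj_by_commuting) auto
  then have "conj_by y (conj_by (inv y \<otimes> x) z) = conj_by y z" by simp
  then show ?thesis using assms by (simp add: conj_by_conj_by)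
qed

text \<open>Conjugation in the extension factors through the quotient because the kernel is central. It makes
  the extension a group on which the alternating group acts.\<close>

definition act :: "(nat \<Rightarrow> nat) \<Rightarrow> 'a \<Rightarrow> 'a" where
  "act p = conj_by (SOME x. x \<in> carrier F \<and> \<pi> x = p)"

lemma act_\<pi>:
  assumes "x \<in> carrier F" "z \<in> carrier F"
  shows "act (\<pi> x) z = conj_by x z"
proof -
  have "(SOME y. y \<in> carrier F \<and> \<pi> y = \<pi> x) \<in> carrier F \<and> \<pi> (SOME y. y \<in> carrier F \<and> \<pi> y = \<pi> x) = \<pi> x"
    by (rule someI[of _ x]) (use assms in auto)
  then show ?thesis unfolding act_def using assms by (intro conj_by_cong) auto
qed

lemma liftE:
  assumes "p \<in> carrier (alt_group d)"
  obtains x where "x \<in> carrier F" "\<pi> x = p"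
  using \<pi>_surj[OF assms] by blast

lemma act_closed [simp]:
  assumes "p \<in> carrier (alt_group d)" "z \<in> carrier F"
  shows "act p z \<in> carrier F"
proof -
  obtain x where "x \<in> carrier F" "\<pi> x = p" using assms(1) by (rule liftE)
  then show ?thesis using act_\<pi>[of x z] assms by simp
qed

lemma act_mult:
  assumes "p \<in> carrier (alt_group d)" "y \<in> carrier F" "z \<in> carrier F"
  shows "act p (y \<otimes> z) = act p y \<otimes> act p z"
proof -
  obtain x where "x \<in> carrier F" "\<pi> x = p" using assms(1) by (rule liftE)
  then show ?thesis using act_\<pi>[of x] assms by (simp add: conj_by_mult)
qed

lemma act_inv:
  assumes "p \<in> carrier (alt_group d)" "y \<in> carrier F"
  shows "act p (inv y) = inv (act p y)"
proof -
  obtain x where "x \<in> carrier F" "\<pi> x = p" using assms(1) by (rule liftE)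
  then show ?thesis using act_\<pi>[of x] assms by (simp add: conj_by_inv)
qed

lemma act_comp:
  assumes "p \<in> carrier (alt_group d)" "q \<in> carrier (alt_group d)" "z \<in> carrier F"
  shows "act p (act q z) = act (p \<circ> q) z"
proof -
  obtain x where x: "x \<in> carrier F" "\<pi> x = p" using assms(1) by (rule liftE)
  obtain y where y: "y \<in> carrier F" "\<pi> y = q" using assms(2) by (rule liftE)
  show ?thesis using act_\<pi>[of x] act_\<pi>[of y] act_\<pi>[of "x \<otimes> y"] assms x y
    by (simp add: conj_by_conj_by \<pi>_mult)
qed

lemma act_id: "z \<in> carrier F \<Longrightarrow> act id z = z"
  using act_\<pi>[of \<one> z] by (simp add: \<pi>_one conj_by_one)

lemma \<pi>_act:
  assumes "p \<in> carrier (alt_group d)" "z \<in> carrier F"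
  shows "\<pi> (act p z) = p \<circ> \<pi> z \<circ> inv' p"
proof -
  obtain x where "x \<in> carrier F" "\<pi> x = p" using assms(1) by (rule liftE)
  then show ?thesis using act_\<pi>[of x] assms by (simp add: \<pi>_conj)
qed

lemma act_central:
  assumes "p \<in> carrier (alt_group d)" "k \<in> carrier F" "\<pi> k = id"
  shows "act p k = k"
proof -
  obtain x where "x \<in> carrier F" "\<pi> x = p" using assms(1) by (rule liftE)
  then show ?thesis using act_\<pi>[of x] assms by (simp add: conj_by_central)
qed

lemma act_\<pi>_eq: "x \<in> carrier F \<Longrightarrow> z \<in> carrier F \<Longrightarrow> act (\<pi> x) z \<otimes> x = x \<otimes> z"
  by (simp add: act_\<pi> conj_by_eq)

lemma act_self: "x \<in> carrier F \<Longrightarrow> act (\<pi> x) x = x"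
  by (simp add: act_\<pi> conj_by_commuting)

text \<open>Changing an argument by a central element does not change the commutator. So the derived subgroup
  is already produced by any set of elements that covers the alternating group.\<close>

lemma commutator_cong:
  assumes c: "x \<in> carrier F" "y \<in> carrier F" "x' \<in> carrier F" "y' \<in> carrier F"
    and eq: "\<pi> x' = \<pi> x" "\<pi> y' = \<pi> y"
  shows "x \<otimes> y \<otimes> inv x \<otimes> inv y = x' \<otimes> y' \<otimes> inv x' \<otimes> inv y'"
proof -
  have "x \<otimes> y \<otimes> inv x \<otimes> inv y = conj_by x y \<otimes> inv y" by (simp add: conj_by_def)
  also have "conj_by x y = conj_by x' y" using c eq by (intro conj_by_cong) auto
  also have "conj_by x' y \<otimes> inv y = x' \<otimes> conj_by y (inv x')" using c by (simp add: conj_by_def m_assoc)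
  also have "conj_by y (inv x') = conj_by y' (inv x')" using c eq by (intro conj_by_cong) auto
  also have "x' \<otimes> conj_by y' (inv x') = x' \<otimes> y' \<otimes> inv x' \<otimes> inv y'"
    using c by (simp add: conj_by_def m_assoc)
  finally show ?thesis .
qed

end

section \<open>Lifts of three-cycles in degree five and in degrees at least eight\<close>

lemma permutes_three_cycle_values:
  assumes "distinct [a, b, c]"
  shows "three_cycle a b c a = b" "three_cycle a b c b = c" "three_cycle a b c c = a"
  using assms by (auto simp: transpose_def)

locale large_alt_central_extension = alt_central_extension +
  assumes ge5: "d \<ge> 5" and not6: "d \<noteq> 6" and not7: "d \<noteq> 7"
begin

definition reversal :: "nat \<Rightarrow> nat" where
  "reversal = transpose (d - 2) (d - 1) \<circ> transpose 1 2"

lemma reversal_alt: "reversal \<in> carrier (alt_group d)"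
proof -
  have "reversal permutes {1..d}"
    unfolding reversal_def using ge5 by (intro permutes_compose permutes_swap_id) auto
  moreover have "evenperm reversal"
    unfolding reversal_def using ge5 by (simp add: evenperm_comp permutation_swap_id evenperm_swap)
  ultimately show ?thesis by (simp add: alt_group_carrier)
qed

lemma reversal_values:
  "reversal (d - 2) = d - 1" "reversal (d - 1) = d - 2" "reversal d = d"
  unfolding reversal_def using ge5 by (auto simp: transpose_def)

text \<open>Let \<open>r\<close> be an involution that inverts the three-cycle, \<open>s\<close> a lift of the latter and \<open>s'\<close> its
  image under \<open>r\<close>. Then \<open>s' s\<^sup>-\<^sup>1\<close> is again a lift of the three-cycle, and \<open>r\<close> inverts it by
  exchanging \<open>s\<close> and \<open>s'\<close>. These two commute and have the same cube, since a cube of a lift is central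
  and fixed by \<open>r\<close>; so the cube of \<open>s' s\<^sup>-\<^sup>1\<close> is trivial.\<close>

lemma exists_balanced_lift:
  "\<exists>t\<in>carrier F. \<pi> t = three_cycle (d - 2) (d - 1) d \<and> t \<otimes> t \<otimes> t = \<one> \<and>
     act reversal t = inv t"
proof -
  define x where "x = three_cycle (d - 2) (d - 1) d"
  define r where "r = reversal"
  have x: "x \<in> carrier (alt_group d)"
    unfolding x_def using ge5 by (intro three_cycle_alt) auto
  have r: "r \<in> carrier (alt_group d)" unfolding r_def by (rule reversal_alt)
  have rr: "r \<circ> r = id"
    unfolding r_def reversal_def using ge5 by (auto simp: fun_eq_iff transpose_def)
  have "r \<circ> x \<circ> inv' r = three_cycle (r (d - 2)) (r (d - 1)) (r d)"
    unfolding x_def using ge5 alt_bij[OF r] by (intro three_cycle_conj) auto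
  then have rx: "r \<circ> x \<circ> inv' r = three_cycle (d - 1) (d - 2) d"
    by (simp only: r_def reversal_values)
  have xx: "three_cycle (d - 1) (d - 2) d \<circ> x = id"
    unfolding x_def using ge5 by (auto simp: fun_eq_iff transpose_def)
  have xx'': "x \<circ> three_cycle (d - 1) (d - 2) d = id"
    unfolding x_def using ge5 by (auto simp: fun_eq_iff transpose_def)
  have xx': "three_cycle (d - 1) (d - 2) d \<circ> three_cycle (d - 1) (d - 2) d = x"
    unfolding x_def using ge5 by (auto simp: fun_eq_iff transpose_def)
  obtain s where s: "s \<in> carrier F" "\<pi> s = x" using x by (rule liftE)
  define s' where "s' = act r s"
  have s': "s' \<in> carrier F" "\<pi> s' = three_cycle (d - 1) (d - 2) d"
    unfolding s'_def using r s rx by (simp_all add: \<pi>_act del: cycle_of_list.simps)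
  have rs': "act r s' = s"
    unfolding s'_def using r s by (simp add: act_comp rr act_id)
  have "\<pi> (s' \<otimes> s) = id" using s s' xx by (simp add: \<pi>_mult del: cycle_of_list.simps)
  then have "(s' \<otimes> s) \<otimes> s = s \<otimes> (s' \<otimes> s)" using s s' by (intro central) auto
  then have comm: "s' \<otimes> s = s \<otimes> s'"
    using s s' by (simp add: m_assoc[symmetric])
  have three_comm: "s' \<otimes> inv s = inv s \<otimes> s'"
  proof -
    have "inv s \<otimes> (s' \<otimes> s) \<otimes> inv s = inv s \<otimes> (s \<otimes> s') \<otimes> inv s" using comm by simp
    then show ?thesis using s s' by (simp add: m_assoc)
  qed
  define t where "t = s' \<otimes> inv s"
  have t: "t \<in> carrier F" using s s' by (simp add: t_def)
  have inv_x: "inv' x = three_cycle (d - 1) (d - 2) d"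
    by (rule inv_unique_comp[OF xx'' xx])
  have \<pi>t: "\<pi> t = x"
    unfolding t_def using s s' xx' by (simp add: \<pi>_mult \<pi>_inv inv_x del: cycle_of_list.simps)
  have rt: "act r t = inv t"
    unfolding t_def using r s s' rs' s'_def[symmetric] by (simp add: act_mult act_inv inv_mult_group)
  let ?y = "three_cycle (d - 1) (d - 2) d"
  have "x \<circ> x \<circ> x = ?y \<circ> (?y \<circ> x) \<circ> x" by (subst (1) xx'[symmetric]) (simp only: comp_assoc)
  also have "\<dots> = id" by (simp only: xx comp_id)
  finally have "\<pi> (s \<otimes> s \<otimes> s) = id" using s by (simp add: \<pi>_mult)
  then have "act r (s \<otimes> s \<otimes> s) = s \<otimes> s \<otimes> s" using r s by (intro act_central) auto
  then have cube: "s' \<otimes> s' \<otimes> s' = s \<otimes> s \<otimes> s" using r s by (simp add: act_mult s'_def)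
  have "t \<otimes> t \<otimes> t = (s' \<otimes> s' \<otimes> s') \<otimes> inv (s \<otimes> s \<otimes> s)"
  proof -
    have sw: "inv s \<otimes> (s' \<otimes> y) = s' \<otimes> (inv s \<otimes> y)" if "y \<in> carrier F" for y
      using three_comm s s' that by (simp add: m_assoc[symmetric])
    show ?thesis
      unfolding t_def using s s' by (simp add: m_assoc inv_mult_group sw)
  qed
  then have "t \<otimes> t \<otimes> t = \<one>" using cube s by simp
  then show ?thesis using t \<pi>t rt unfolding x_def r_def by blast
qed

definition base_lift :: 'a where
  "base_lift = (SOME t. t \<in> carrier F \<and> \<pi> t = three_cycle (d - 2) (d - 1) d \<and> t \<otimes> t \<otimes> t = \<one> \<and>
     act reversal t = inv t)"

lemma base_lift:
  "base_lift \<in> carrier F" "\<pi> base_lift = three_cycle (d - 2) (d - 1) d"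
  "base_lift \<otimes> base_lift \<otimes> base_lift = \<one>"
  "act reversal base_lift = inv base_lift"
  using someI_ex[OF exists_balanced_lift[unfolded Bex_def]] unfolding base_lift_def by blast+

text \<open>A permutation commuting with the image of \<open>z\<close> changes \<open>z\<close> by a central factor. These factors
  multiply, so they cancel in a commutator.\<close>

lemma act_commutator_fixes:
  assumes h: "h1 \<in> carrier (alt_group d)" "h2 \<in> carrier (alt_group d)" "c \<in> carrier (alt_group d)"
    and c: "c \<circ> (h2 \<circ> h1) = h1 \<circ> h2"
    and z: "z \<in> carrier F" "h1 \<circ> \<pi> z \<circ> inv' h1 = \<pi> z" "h2 \<circ> \<pi> z \<circ> inv' h2 = \<pi> z"
  shows "act c z = z"
proof -
  have *: "\<exists>k\<in>carrier F. \<pi> k = id \<and> act h z = k \<otimes> z"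
    if "h \<in> carrier (alt_group d)" "h \<circ> \<pi> z \<circ> inv' h = \<pi> z" for h
  proof (intro bexI conjI)
    show "\<pi> (act h z \<otimes> inv z) = id"
      using that z(1) by (simp add: \<pi>_mult \<pi>_inv \<pi>_act alt_inv_comp[OF \<pi>_alt])
  qed (use that z(1) in \<open>simp_all add: m_assoc\<close>)
  obtain k1 where k1: "k1 \<in> carrier F" "\<pi> k1 = id" "act h1 z = k1 \<otimes> z" using * h z by blast
  obtain k2 where k2: "k2 \<in> carrier F" "\<pi> k2 = id" "act h2 z = k2 \<otimes> z" using * h z by blast
  have k12: "\<pi> (k1 \<otimes> k2) = id" "k1 \<otimes> k2 = k2 \<otimes> k1" using k1 k2 central by (simp_all add: \<pi>_mult)
  have a: "act (h2 \<circ> h1) z = (k1 \<otimes> k2) \<otimes> z"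
    using h z k1 k2 by (simp add: act_comp[symmetric] act_mult act_central m_assoc)
  have b: "act (h1 \<circ> h2) z = (k1 \<otimes> k2) \<otimes> z"
    using h z k1 k2 k12 by (simp add: act_comp[symmetric] act_mult act_central m_assoc[symmetric])
  have "act c (act (h2 \<circ> h1) z) = act (h1 \<circ> h2) z"
    using h z by (simp add: act_comp alt_comp c)
  then have "(k1 \<otimes> k2) \<otimes> act c z = (k1 \<otimes> k2) \<otimes> z"
    using h z k1 k2 k12 by (simp add: a b act_mult act_central del: m_assoc)
  then show ?thesis using h z k1 k2 by simp
qed

text \<open>For \<open>d = 5\<close> the stabilizer of three points in the alternating group is trivial. For \<open>d \<ge> 8\<close> it is
  an alternating group of degree at least five, hence perfect, and commutators fix the lift. In the
  degrees 6 and 7 it has a quotient of order three, which can act on the lift.\<close>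

lemma act_stabilizer_base_lift:
  assumes g: "g \<in> carrier (alt_group d)" "g (d - 2) = d - 2" "g (d - 1) = d - 1" "g d = d"
  shows "act g base_lift = base_lift"
proof -
  let ?A = "alt_group (d - 3)"
  have "g permutes {1..d - 3}"
  proof (rule permutes_superset[of g "{1..d}"])
    fix x assume "x \<in> {1..d} - {1..d - 3}"
    then have "x = d - 2 \<or> x = d - 1 \<or> x = d" by auto
    then show "g x = x" using g by auto
  qed (use g in \<open>simp add: alt_group_carrier\<close>)
  then have gA: "g \<in> carrier ?A" using g by (simp add: alt_group_carrier)
  have sub: "h \<in> carrier (alt_group d)" if "h \<in> carrier ?A" for h
    using that permutes_subset[of h "{1..d - 3}" "{1..d}"] by (auto simp: alt_group_carrier)
  have cent: "h \<circ> \<pi> base_lift \<circ> inv' h = \<pi> base_lift" if "h \<in> carrier ?A" for h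
  proof -
    have "h (d - 2) = d - 2" "h (d - 1) = d - 1" "h d = d"
      using that ge5 by (auto simp: alt_group_carrier intro!: permutes_not_in)
    moreover have "h \<circ> \<pi> base_lift \<circ> inv' h = three_cycle (h (d - 2)) (h (d - 1)) (h d)"
      unfolding base_lift using ge5 alt_bij[OF sub[OF that]] by (intro three_cycle_conj) auto
    ultimately show ?thesis unfolding base_lift by simp
  qed
  show ?thesis
  proof (cases "d = 5")
    case True
    have "{1..2} = {1, 2::nat}" by auto
    then have "g permutes {1, 2}" using gA True by (simp add: alt_group_carrier)
    then have "g = id \<or> g = transpose 1 2" by (simp add: permutes_doubleton_iff)
    then have "g = id" using g(1) by (auto simp: alt_group_carrier evenperm_swap)
    then show ?thesis by (simp add: act_id base_lift)
  next
    case False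
    then have "d - 3 \<ge> 5" using ge5 not6 not7 by simp
    then have "g \<in> generate ?A (derived_set ?A (carrier ?A))"
      using gA derived_alt_group_const unfolding derived_def by blast
    then have "g \<in> carrier ?A \<and> act g base_lift = base_lift"
    proof (induction rule: generate.induct)
      case one
      then show ?case by (simp only: alt_group_one alt_id act_id base_lift)
    next
      case (incl c)
      then obtain h1 h2 where h: "h1 \<in> carrier ?A" "h2 \<in> carrier ?A" "c = h1 \<circ> h2 \<circ> inv' h1 \<circ> inv' h2"
        by (auto simp: alt_group_mult alt_group_inv_equality)
      have cA: "c \<in> carrier ?A" unfolding h(3) using h by (intro alt_comp alt_group_inv_closed)
      have "c \<circ> (h2 \<circ> h1) = h1 \<circ> h2 \<circ> inv' h1 \<circ> (inv' h2 \<circ> h2) \<circ> h1"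
        by (simp add: h(3) comp_assoc)
      also have "\<dots> = h1 \<circ> h2 \<circ> (inv' h1 \<circ> h1)" using h by (simp only: alt_inv_comp comp_id comp_assoc)
      also have "\<dots> = h1 \<circ> h2" using h by (simp only: alt_inv_comp comp_id)
      finally show ?case
        using act_commutator_fixes[OF sub[OF h(1)] sub[OF h(2)] sub[OF cA] _ base_lift(1) cent[OF h(1)] cent[OF h(2)]] cA
        by blast
    next
      case (inv c)
      then obtain h1 h2 where h: "h1 \<in> carrier ?A" "h2 \<in> carrier ?A" "c = h1 \<circ> h2 \<circ> inv' h1 \<circ> inv' h2"
        by (auto simp: alt_group_mult alt_group_inv_equality)
      have cA: "c \<in> carrier ?A" unfolding h(3) using h by (intro alt_comp alt_group_inv_closed)
      have ic: "inv\<^bsub>?A\<^esub> c \<in> carrier ?A"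
        using group.inv_closed[OF alt_group_is_group cA] .
      have hc: "inv\<^bsub>?A\<^esub> c = h2 \<circ> h1 \<circ> inv' h2 \<circ> inv' h1"
        unfolding alt_group_inv_equality[OF cA] unfolding h(3)
        using h alt_bij by (simp add: o_inv_distrib bij_comp bij_imp_bij_inv inv_inv_eq comp_assoc)
      have "inv\<^bsub>?A\<^esub> c \<circ> (h1 \<circ> h2) = h2 \<circ> h1 \<circ> inv' h2 \<circ> (inv' h1 \<circ> h1) \<circ> h2"
        by (simp add: hc comp_assoc)
      also have "\<dots> = h2 \<circ> h1 \<circ> (inv' h2 \<circ> h2)" using h by (simp only: alt_inv_comp comp_id comp_assoc)
      also have "\<dots> = h2 \<circ> h1" using h by (simp only: alt_inv_comp comp_id)
      finally show ?case
        using act_commutator_fixes[OF sub[OF h(2)] sub[OF h(1)] sub[OF ic] _ base_lift(1) cent[OF h(2)] cent[OF h(1)]] ic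
        by blast
    next
      case (eng h1 h2)
      then have "act (h1 \<circ> h2) base_lift = base_lift"
        using act_comp[of h1 h2 base_lift] sub base_lift(1) by simp
      then show ?case using eng alt_comp[of h1 _ h2] by (simp only: alt_group_mult)
    qed
    then show ?thesis by simp
  qed
qed

text \<open>The lift of the three-cycle that sends \<open>a\<close> to \<open>b\<close> and \<open>b\<close> to \<open>c\<close>, transported from
  the base lift. The choice of the transporting permutation does not matter because the stabilizer of the
  base triple fixes the base lift.\<close>

definition lift3 :: "nat \<Rightarrow> nat \<Rightarrow> nat \<Rightarrow> 'a" where
  "lift3 a b c = act (SOME g. g \<in> carrier (alt_group d) \<and> g (d - 2) = a \<and> g (d - 1) = b \<and> g d = c) base_lift"

lemma lift3_eq:
  assumes g: "g \<in> carrier (alt_group d)"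
  shows "lift3 (g (d - 2)) (g (d - 1)) (g d) = act g base_lift"
proof -
  let ?P = "\<lambda>h. h \<in> carrier (alt_group d) \<and> h (d - 2) = g (d - 2) \<and> h (d - 1) = g (d - 1) \<and> h d = g d"
  define h where "h = (SOME h. ?P h)"
  have h: "?P h" unfolding h_def by (rule someI[of _ g]) (use g in auto)
  have g': "inv' g \<in> carrier (alt_group d)" using g by (rule alt_group_inv_closed)
  have fg: "inv' g (g x) = x" for x using alt_inv_comp(1)[OF g] by (metis comp_apply id_apply)
  have "act (inv' g \<circ> h) base_lift = base_lift"
    using h g' by (intro act_stabilizer_base_lift alt_comp) (auto simp: fg)
  then have "act g (act (inv' g \<circ> h) base_lift) = act g base_lift" by simp
  moreover have "g \<circ> (inv' g \<circ> h) = h" using alt_inv_comp(2)[OF g] by (metis comp_assoc id_comp)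
  ultimately have "act h base_lift = act g base_lift"
    using g g' h base_lift(1) by (simp add: act_comp alt_comp)
  then show ?thesis unfolding lift3_def h_def .
qed

lemma lift3E:
  assumes "distinct [a, b, c]" "{a, b, c} \<subseteq> {1..d}"
  obtains g where "g \<in> carrier (alt_group d)" "g (d - 2) = a" "g (d - 1) = b" "g d = c"
    "lift3 a b c = act g base_lift"
proof -
  have "\<exists>g. g permutes {1..d} \<and> evenperm g \<and> map g [d - 2, d - 1, d] = [a, b, c]"
    using assms ge5 by (intro exists_even_permutation_mapping) auto
  then obtain g where g: "g permutes {1..d} \<and> evenperm g \<and> map g [d - 2, d - 1, d] = [a, b, c]" ..
  then have "g \<in> carrier (alt_group d)" "g (d - 2) = a" "g (d - 1) = b" "g d = c"
    by (simp_all add: alt_group_carrier)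
  then show ?thesis using that[of g] lift3_eq[of g] by simp
qed

lemma lift3_closed: "distinct [a, b, c] \<Longrightarrow> {a, b, c} \<subseteq> {1..d} \<Longrightarrow> lift3 a b c \<in> carrier F"
  by (erule (1) lift3E) (simp add: base_lift(1))

lemma \<pi>_lift3:
  assumes "distinct [a, b, c]" "{a, b, c} \<subseteq> {1..d}"
  shows "\<pi> (lift3 a b c) = three_cycle a b c"
proof -
  obtain g where g: "g \<in> carrier (alt_group d)" "g (d - 2) = a" "g (d - 1) = b" "g d = c"
    "lift3 a b c = act g base_lift" using lift3E[OF assms] .
  then have "\<pi> (lift3 a b c) = g \<circ> three_cycle (d - 2) (d - 1) d \<circ> inv' g"
    by (simp only: \<pi>_act base_lift)
  also have "\<dots> = three_cycle (g (d - 2)) (g (d - 1)) (g d)"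
    using ge5 alt_bij[OF g(1)] by (intro three_cycle_conj) auto
  finally show ?thesis using g by simp
qed

lemma act_lift3:
  assumes "distinct [a, b, c]" "{a, b, c} \<subseteq> {1..d}" "h \<in> carrier (alt_group d)"
  shows "act h (lift3 a b c) = lift3 (h a) (h b) (h c)"
proof -
  obtain g where g: "g \<in> carrier (alt_group d)" "g (d - 2) = a" "g (d - 1) = b" "g d = c"
    "lift3 a b c = act g base_lift" using lift3E[OF assms(1,2)] .
  then show ?thesis using lift3_eq[of "h \<circ> g"] assms(3) by (simp add: act_comp alt_comp base_lift)
qed

lemma lift3_rotate:
  assumes "distinct [a, b, c]" "{a, b, c} \<subseteq> {1..d}"
  shows "lift3 b c a = lift3 a b c"
proof -
  have "act (three_cycle a b c) (lift3 a b c) = lift3 a b c"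
    using act_self[OF lift3_closed[OF assms]] by (simp only: \<pi>_lift3[OF assms])
  then show ?thesis
    by (simp only: act_lift3[OF assms three_cycle_alt[OF assms]] permutes_three_cycle_values[OF assms(1)])
qed

lemma lift3_inverse:
  assumes "distinct [a, b, c]" "{a, b, c} \<subseteq> {1..d}"
  shows "lift3 b a c = inv (lift3 a b c)"
proof -
  obtain g where g: "g \<in> carrier (alt_group d)" "g (d - 2) = a" "g (d - 1) = b" "g d = c"
    "lift3 a b c = act g base_lift" using lift3E[OF assms] .
  have "lift3 b a c = act (g \<circ> reversal) base_lift"
    using lift3_eq[OF alt_comp[OF g(1) reversal_alt]] by (simp only: comp_apply reversal_values g)
  also have "\<dots> = inv (lift3 a b c)"
    using g reversal_alt base_lift by (simp add: act_comp[symmetric] act_inv)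
  finally show ?thesis .
qed

lemma lift3_cube:
  assumes "distinct [a, b, c]" "{a, b, c} \<subseteq> {1..d}"
  shows "lift3 a b c \<otimes> lift3 a b c \<otimes> lift3 a b c = \<one>"
proof -
  obtain g where g: "g \<in> carrier (alt_group d)" "lift3 a b c = act g base_lift" using lift3E[OF assms] .
  have "lift3 a b c \<otimes> lift3 a b c \<otimes> lift3 a b c = act g (base_lift \<otimes> base_lift \<otimes> base_lift)"
    using g base_lift(1) by (simp add: act_mult)
  then show ?thesis using g(1) act_central[of g \<one>] by (simp add: base_lift(3) \<pi>_one)
qed


definition quadruple :: "nat \<Rightarrow> nat \<Rightarrow> nat \<Rightarrow> nat \<Rightarrow> bool" where
  "quadruple i j u v \<longleftrightarrow> distinct [i, j, u, v] \<and> {i, j, u, v} \<subseteq> {1..d}"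

text \<open>The product of the two three-cycles is a product of two disjoint transpositions, so this square lies
  above the identity. It is the obstruction to lifting the relation that
  this product is an involution.\<close>

definition prod_square :: "nat \<Rightarrow> nat \<Rightarrow> nat \<Rightarrow> nat \<Rightarrow> 'a" where
  "prod_square i j u v = lift3 i u v \<otimes> lift3 j u v \<otimes> (lift3 i u v \<otimes> lift3 j u v)"

lemma quadruple_lift3:
  assumes "quadruple i j u v"
  shows "lift3 i u v \<in> carrier F" "lift3 j u v \<in> carrier F" "lift3 i v u = inv (lift3 i u v)" "lift3 j v u = inv (lift3 j u v)"
proof -
  show "lift3 i u v \<in> carrier F" "lift3 j u v \<in> carrier F"
    using assms by (auto simp: quadruple_def intro!: lift3_closed)
  have "lift3 i v u = lift3 v u i" using assms lift3_rotate[of i v u] by (auto simp: quadruple_def)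
  also have "\<dots> = inv (lift3 u v i)" using assms by (intro lift3_inverse) (auto simp: quadruple_def)
  also have "lift3 u v i = lift3 i u v" using assms lift3_rotate[of i u v] by (auto simp: quadruple_def)
  finally show "lift3 i v u = inv (lift3 i u v)" .
  have "lift3 j v u = lift3 v u j" using assms lift3_rotate[of j v u] by (auto simp: quadruple_def)
  also have "\<dots> = inv (lift3 u v j)" using assms by (intro lift3_inverse) (auto simp: quadruple_def)
  also have "lift3 u v j = lift3 j u v" using assms lift3_rotate[of j u v] by (auto simp: quadruple_def)
  finally show "lift3 j v u = inv (lift3 j u v)" .
qed

lemma prod_square_closed: "quadruple i j u v \<Longrightarrow> prod_square i j u v \<in> carrier F"
  using quadruple_lift3 by (simp add: prod_square_def)

lemma three_cycle_product_involution:
  assumes "distinct [i, j, u, v]"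
  shows "three_cycle i u v \<circ> three_cycle j u v = transpose i u \<circ> transpose j v"
proof
  fix x
  show "(three_cycle i u v \<circ> three_cycle j u v) x = (transpose i u \<circ> transpose j v) x"
  proof (cases "x \<in> {i, j, u, v}")
    case True
    then show ?thesis using assms by (elim insertE) (auto simp: transpose_def)
  next
    case False
    then show ?thesis using id_outside_supp[of x "[i, u, v]"] id_outside_supp[of x "[j, u, v]"]
      by (simp del: cycle_of_list.simps)
  qed
qed

lemma \<pi>_prod_square:
  assumes "quadruple i j u v"
  shows "\<pi> (prod_square i j u v) = id"
proof -
  have d: "distinct [i, j, u, v]" and s: "{i, j, u, v} \<subseteq> {1..d}" using assms by (auto simp: quadruple_def)
  have "\<pi> (lift3 i u v \<otimes> lift3 j u v) = transpose i u \<circ> transpose j v"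
    unfolding three_cycle_product_involution[OF d, symmetric]
    using d s quadruple_lift3[OF assms] \<pi>_lift3[of i u v] \<pi>_lift3[of j u v]
    by (simp add: \<pi>_mult del: cycle_of_list.simps)
  moreover have "transpose i u \<circ> transpose j v = transpose j v \<circ> transpose i u"
    using d by (intro swap_id_independent) auto
  then have "(transpose i u \<circ> transpose j v) \<circ> (transpose i u \<circ> transpose j v) =
      (transpose i u \<circ> transpose j v) \<circ> (transpose j v \<circ> transpose i u)" by simp
  moreover have "\<dots> = id"
    by (simp add: fun_eq_iff)
  ultimately show ?thesis unfolding prod_square_def using quadruple_lift3[OF assms] by (simp add: \<pi>_mult)
qed

lemma act_prod_square:
  assumes "quadruple i j u v" "g \<in> carrier (alt_group d)"
  shows "prod_square (g i) (g j) (g u) (g v) = prod_square i j u v"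
proof -
  have "act g (prod_square i j u v) = prod_square (g i) (g j) (g u) (g v)"
    using assms quadruple_lift3[OF assms(1)] act_lift3[of i u v g] act_lift3[of j u v g]
    by (simp add: prod_square_def act_mult quadruple_def)
  then show ?thesis using act_central[OF assms(2) prod_square_closed \<pi>_prod_square] assms(1) by simp
qed

lemma quadruple_swaps: "quadruple i j u v \<Longrightarrow> quadruple j i u v" "quadruple i j u v \<Longrightarrow> quadruple j i v u"
  by (auto simp: quadruple_def)

text \<open>The two squares are conjugate, and both are central.\<close>

lemma prod_square_swap:
  assumes "quadruple i j u v"
  shows "prod_square j i u v = prod_square i j u v"
proof -
  let ?X = "lift3 i u v" and ?Y = "lift3 j u v"
  have c: "?X \<in> carrier F" "?Y \<in> carrier F" using quadruple_lift3[OF assms] by auto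
  have "?X \<otimes> prod_square j i u v = prod_square i j u v \<otimes> ?X"
    unfolding prod_square_def using c by (simp add: m_assoc)
  also have "\<dots> = ?X \<otimes> prod_square i j u v"
    using central[OF prod_square_closed \<pi>_prod_square c(1)] assms by simp
  finally show ?thesis
    using c prod_square_closed[OF assms] prod_square_closed[OF quadruple_swaps(1)[OF assms]] by simp
qed

text \<open>The even permutation that exchanges \<open>i\<close> with \<open>j\<close> and \<open>u\<close> with \<open>v\<close> fixes the central square, but it
  also turns it into its inverse.\<close>

lemma prod_square_square:
  assumes "quadruple i j u v"
  shows "prod_square i j u v \<otimes> prod_square i j u v = \<one>"
proof -
  let ?X = "lift3 i u v" and ?Y = "lift3 j u v"
  have c: "?X \<in> carrier F" "?Y \<in> carrier F" using quadruple_lift3[OF assms] by auto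
  define g where "g = transpose i j \<circ> transpose u v"
  have g: "g \<in> carrier (alt_group d)"
    unfolding g_def alt_group_carrier using assms
    by (auto simp: quadruple_def evenperm_comp permutation_swap_id evenperm_swap
        intro!: permutes_compose permutes_swap_id)
  have gv: "g i = j" "g j = i" "g u = v" "g v = u"
    using assms unfolding g_def quadruple_def by (auto simp: transpose_def)
  have "prod_square j i v u = prod_square i j u v"
    using act_prod_square[OF assms g] by (simp only: gv)
  moreover have "prod_square j i v u = inv (prod_square i j u v)"
    unfolding prod_square_def using quadruple_lift3[OF assms] by (simp add: inv_mult_group m_assoc)
  ultimately have "inv (prod_square i j u v) = prod_square i j u v" by simp
  then show ?thesis using prod_square_closed[OF assms] by (metis r_inv)
qed

text \<open>Even permutations do not change a central element, and an odd permutation becomes even after \<open>i\<close> and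
  \<open>j\<close> are exchanged.\<close>

lemma prod_square_constant:
  assumes q: "quadruple i j u v" "quadruple i' j' u' v'"
  shows "prod_square i' j' u' v' = prod_square i j u v"
proof -
  have "\<exists>p. p permutes {1..d} \<and> map p [i, j, u, v] = [i', j', u', v']"
    using q by (intro exists_permutation_mapping) (auto simp: quadruple_def)
  then obtain p where p: "p permutes {1..d}" "p i = i'" "p j = j'" "p u = u'" "p v = v'" by auto
  show ?thesis
  proof (cases "evenperm p")
    case True
    then show ?thesis using act_prod_square[OF q(1), of p] p by (simp add: alt_group_carrier)
  next
    case False
    define g where "g = p \<circ> transpose i j"
    have "permutation p" using p(1) permutation_permutes by blast
    then have "evenperm g"
      unfolding g_def using False q(1) by (simp add: evenperm_comp permutation_swap_id evenperm_swap quadruple_def)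
    moreover have "g permutes {1..d}"
      unfolding g_def using p q(1) by (intro permutes_compose permutes_swap_id) (auto simp: quadruple_def)
    ultimately have g: "g \<in> carrier (alt_group d)" by (simp add: alt_group_carrier)
    have gv: "g j = i'" "g i = j'" "g u = u'" "g v = v'"
      unfolding g_def using p q(1) by (auto simp: quadruple_def transpose_def)
    have "prod_square i' j' u' v' = prod_square j i u v"
      using act_prod_square[OF quadruple_swaps(1)[OF q(1)] g] by (simp only: gv)
    then show ?thesis using prod_square_swap[OF q(1)] by simp
  qed
qed

definition \<kappa> :: 'a where "\<kappa> = prod_square 1 2 3 4"

lemma quadruple_1234: "quadruple 1 2 3 4"
  using ge5 by (auto simp: quadruple_def)

lemma \<kappa>: "\<kappa> \<in> carrier F" "\<pi> \<kappa> = id" "\<kappa> \<otimes> \<kappa> = \<one>" "inv \<kappa> = \<kappa>"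
proof -
  show "\<kappa> \<in> carrier F" "\<pi> \<kappa> = id" "\<kappa> \<otimes> \<kappa> = \<one>"
    unfolding \<kappa>_def using prod_square_closed \<pi>_prod_square prod_square_square quadruple_1234 by auto
  then show "inv \<kappa> = \<kappa>" by (simp add: inv_equality)
qed

lemma prod_square_eq_\<kappa>: "quadruple i j u v \<Longrightarrow> prod_square i j u v = \<kappa>"
  unfolding \<kappa>_def using prod_square_constant quadruple_1234 by blast

lemma \<kappa>_comm: "x \<in> carrier F \<Longrightarrow> x \<otimes> \<kappa> = \<kappa> \<otimes> x"
  using central \<kappa> by metis

text \<open>With \<open>X\<close> and \<open>Y\<close> the lifts for \<open>(i u v)\<close> and \<open>(j u v)\<close>, the relations \<open>(X Y)\<^sup>2 = \<kappa>\<close> and \<open>Y\<^sup>3 = 1\<close> give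
  \<open>X Y\<^sup>-\<^sup>1 = \<kappa> Y\<^sup>-\<^sup>1 X\<^sup>-\<^sup>1 Y\<close>, a conjugate of the inverse of \<open>X\<close>. The coset rewriting uses no other relation
  than this one, up to conjugation and rotation.\<close>

lemma lift3_mult_opposite:
  assumes "quadruple i j u v"
  shows "lift3 i u v \<otimes> lift3 j v u = \<kappa> \<otimes> lift3 i u j"
proof -
  let ?X = "lift3 i u v" and ?Y = "lift3 j u v"
  have d: "distinct [i, j, u, v]" and s: "{i, j, u, v} \<subseteq> {1..d}" using assms by (auto simp: quadruple_def)
  have c: "?X \<in> carrier F" "?Y \<in> carrier F" using quadruple_lift3[OF assms] by auto
  have Yinv: "inv ?Y = ?Y \<otimes> ?Y"
    using lift3_cube[of j u v] c d s by (intro inv_equality) auto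
  have "(?X \<otimes> ?Y) \<otimes> (?X \<otimes> ?Y) = \<kappa>" using prod_square_eq_\<kappa>[OF assms] by (simp add: prod_square_def)
  then have XY: "?X \<otimes> ?Y = \<kappa> \<otimes> inv (?X \<otimes> ?Y)" using c \<kappa>(1)
    by (metis inv_solve_right m_closed)
  have "inv (?X \<otimes> ?Y) \<otimes> ?Y = conj_by (inv ?Y) (inv ?X)"
    using c by (simp add: conj_by_def inv_mult_group m_assoc)
  also have "\<dots> = act (\<pi> (inv ?Y)) (lift3 i v u)"
    using c quadruple_lift3[OF assms] by (simp add: act_\<pi>)
  also have "\<dots> = lift3 (\<pi> (inv ?Y) i) (\<pi> (inv ?Y) v) (\<pi> (inv ?Y) u)"
    using d s c \<pi>_alt by (intro act_lift3) auto
  also have "\<pi> (inv ?Y) = three_cycle j v u"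
    using \<pi>_lift3[of j v u] quadruple_lift3[OF assms] d s by simp
  also have "lift3 (three_cycle j v u i) (three_cycle j v u v) (three_cycle j v u u) = lift3 i u j"
    using d by (simp add: transpose_def)
  finally have *: "inv (?X \<otimes> ?Y) \<otimes> ?Y = lift3 i u j" .
  have "?X \<otimes> lift3 j v u = ?X \<otimes> ?Y \<otimes> ?Y"
    using c quadruple_lift3[OF assms] Yinv by (simp add: m_assoc)
  also have "\<dots> = \<kappa> \<otimes> (inv (?X \<otimes> ?Y) \<otimes> ?Y)"
    using c \<kappa>(1) XY by (metis inv_closed m_assoc m_closed)
  finally show ?thesis using * by simp
qed


lemma lift3_mult_pivot_chain:
  assumes "quadruple p i u j"
  shows "lift3 p i u \<otimes> lift3 p u j = \<kappa> \<otimes> lift3 i u j"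
proof -
  have "lift3 i u p \<otimes> lift3 j p u = \<kappa> \<otimes> lift3 i u j"
    using assms by (intro lift3_mult_opposite) (auto simp: quadruple_def)
  moreover have "lift3 i u p = lift3 p i u" "lift3 p u j = lift3 j p u"
    using assms lift3_rotate[of p i u] lift3_rotate[of j p u] by (auto simp: quadruple_def)
  ultimately show ?thesis by simp
qed

lemma lift3_mult_pivot_merge:
  assumes "quadruple p v i j"
  shows "lift3 p v i \<otimes> lift3 p j v = \<kappa> \<otimes> lift3 p j i"
proof -
  have "lift3 i p v \<otimes> lift3 j v p = \<kappa> \<otimes> lift3 i p j"
    using assms by (intro lift3_mult_opposite) (auto simp: quadruple_def)
  moreover have "lift3 i p v = lift3 p v i" "lift3 j v p = lift3 p j v" "lift3 i p j = lift3 p j i"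
    using assms lift3_rotate[of i p v] lift3_rotate[of p j v] lift3_rotate[of i p j]
      lift3_rotate[of v p j] lift3_rotate[of j v p] by (auto simp: quadruple_def)
  ultimately show ?thesis by simp
qed

text \<open>The part of the extension that lies above the alternating group on the first \<open>k\<close> points.\<close>

definition level :: "nat \<Rightarrow> 'a set" where
  "level k = generate F (insert \<kappa> {lift3 a b c | a b c. distinct [a, b, c] \<and> {a, b, c} \<subseteq> {1..k}})"

lemma level_gens:
  assumes "k \<le> d"
  shows "insert \<kappa> {lift3 a b c | a b c. distinct [a, b, c] \<and> {a, b, c} \<subseteq> {1..k}} \<subseteq> carrier F"
proof
  fix x assume "x \<in> insert \<kappa> {lift3 a b c | a b c. distinct [a, b, c] \<and> {a, b, c} \<subseteq> {1..k}}"
  then consider "x = \<kappa>" | a b c where "x = lift3 a b c" "distinct [a, b, c]" "{a, b, c} \<subseteq> {1..k}" by blast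
  then show "x \<in> carrier F"
  proof cases
    case 2
    then show ?thesis using assms lift3_closed[of a b c] by auto
  qed (simp add: \<kappa>)
qed

lemma level_subgroup: "k \<le> d \<Longrightarrow> subgroup (level k) F"
  unfolding level_def using level_gens by (intro generate_is_subgroup)

lemma level_carrier: "k \<le> d \<Longrightarrow> x \<in> level k \<Longrightarrow> x \<in> carrier F"
  by (rule subgroup.mem_carrier[OF level_subgroup])

lemma level_mult: "x \<in> level k \<Longrightarrow> y \<in> level k \<Longrightarrow> x \<otimes> y \<in> level k"
  unfolding level_def by (rule generate.eng)

lemma level_one: "\<one> \<in> level k"
  unfolding level_def by (rule generate.one)

lemma \<kappa>_level: "\<kappa> \<in> level k"
  unfolding level_def by (rule generate.incl) simp

lemma lift3_level: "distinct [a, b, c] \<Longrightarrow> {a, b, c} \<subseteq> {1..k} \<Longrightarrow> lift3 a b c \<in> level k"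
  unfolding level_def by (rule generate.incl) blast

lemma \<pi>_level:
  assumes "k \<le> d" "x \<in> level k"
  shows "\<pi> x permutes {1..k}"
proof -
  have three: "\<pi> (lift3 a b c) permutes {1..k}" if "distinct [a, b, c]" "{a, b, c} \<subseteq> {1..k}" for a b c
  proof -
    have "\<pi> (lift3 a b c) = three_cycle a b c" using that assms(1) by (intro \<pi>_lift3) auto
    then show ?thesis using permutes_subset[OF cycle_permutes[of "[a, b, c]"]] that by simp
  qed
  from assms(2) have "x \<in> carrier F \<and> \<pi> x permutes {1..k}"
    unfolding level_def
  proof (induction rule: generate.induct)
    case one
    then show ?case by (simp only: \<pi>_one permutes_id one_closed)
  next
    case (incl h)
    then have "h \<in> carrier F" using level_gens[OF assms(1)] by blast
    moreover have "\<pi> h permutes {1..k}" using incl three by (auto simp only: \<kappa> permutes_id insert_iff mem_Collect_eq)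
    ultimately show ?case ..
  next
    case (inv h)
    then have "h \<in> carrier F" using level_gens[OF assms(1)] by blast
    moreover have "\<pi> h permutes {1..k}" using inv three by (auto simp only: \<kappa> permutes_id insert_iff mem_Collect_eq)
    ultimately show ?case by (simp add: \<pi>_inv permutes_inv)
  next
    case (eng h1 h2)
    then show ?case by (simp only: \<pi>_mult permutes_compose m_closed)
  qed
  then show ?thesis ..
qed

text \<open>Two of the double cosets of the subgroup \<open>level k\<close>: the subgroup itself and the one in which
  \<open>Suc k\<close> is moved. They turn out to exhaust the next level.\<close>

definition two_cosets :: "nat \<Rightarrow> 'a set" where
  "two_cosets k = level k \<union>
     {h \<otimes> lift3 (Suc k) a b | h a b. h \<in> level k \<and> a \<noteq> b \<and> a \<in> {1..k} \<and> b \<in> {1..k}}"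

lemma two_cosetsI:
  "h \<in> level k \<Longrightarrow> h \<in> two_cosets k"
  "h \<in> level k \<Longrightarrow> a \<noteq> b \<Longrightarrow> a \<in> {1..k} \<Longrightarrow> b \<in> {1..k} \<Longrightarrow> h \<otimes> lift3 (Suc k) a b \<in> two_cosets k"
  unfolding two_cosets_def by blast+

lemma level_mult_two_cosets:
  assumes "Suc k \<le> d" "h \<in> level k" "u \<in> two_cosets k"
  shows "h \<otimes> u \<in> two_cosets k"
proof (cases "u \<in> level k")
  case True
  then show ?thesis using assms by (intro two_cosetsI level_mult)
next
  case False
  then obtain h' a b where u: "u = h' \<otimes> lift3 (Suc k) a b" "h' \<in> level k" "a \<noteq> b" "a \<in> {1..k}" "b \<in> {1..k}"
    using assms(3) unfolding two_cosets_def by blast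
  have "lift3 (Suc k) a b \<in> carrier F" using u assms(1) by (intro lift3_closed) auto
  then have "h \<otimes> u = (h \<otimes> h') \<otimes> lift3 (Suc k) a b"
    using u assms level_carrier[of k] by (simp add: m_assoc)
  moreover have "\<dots> \<in> two_cosets k"
    using u assms(2) by (intro two_cosetsI(2) level_mult)
  ultimately show ?thesis by simp
qed

lemma lift3_mult_level:
  assumes "Suc k \<le> d" "h \<in> level k" "a \<noteq> b" "a \<in> {1..k}" "b \<in> {1..k}"
  shows "\<exists>a'\<in>{1..k}. \<exists>b'\<in>{1..k}. a' \<noteq> b' \<and> lift3 (Suc k) a b \<otimes> h = h \<otimes> lift3 (Suc k) a' b'"
proof -
  have h: "h \<in> carrier F" using level_carrier[of k h] assms by simp
  have p: "inv' (\<pi> h) permutes {1..k}" using \<pi>_level assms by (intro permutes_inv) simp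
  have Tc: "lift3 (Suc k) a b \<in> carrier F" using assms by (intro lift3_closed) auto
  have "lift3 (Suc k) a b \<otimes> h = h \<otimes> conj_by (inv h) (lift3 (Suc k) a b)"
    using h Tc by (simp add: conj_by_def m_assoc)
  also have "conj_by (inv h) (lift3 (Suc k) a b) = act (inv' (\<pi> h)) (lift3 (Suc k) a b)"
    using h Tc by (simp add: act_\<pi>[symmetric] \<pi>_inv)
  also have "\<dots> = lift3 (inv' (\<pi> h) (Suc k)) (inv' (\<pi> h) a) (inv' (\<pi> h) b)"
    using assms h by (intro act_lift3 alt_group_inv_closed \<pi>_alt) auto
  also have "inv' (\<pi> h) (Suc k) = Suc k" using p by (rule permutes_not_in) simp
  finally have "lift3 (Suc k) a b \<otimes> h = h \<otimes> lift3 (Suc k) (inv' (\<pi> h) a) (inv' (\<pi> h) b)" .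
  moreover have "inv' (\<pi> h) a \<noteq> inv' (\<pi> h) b" using p assms(3) by (metis permutes_inj injD)
  ultimately show ?thesis using assms p permutes_in_image by metis
qed

text \<open>The product of two lifts that move the new point is rewritten with at most one factor that moves it.
  If the three-cycles share a point in the right position, one of the two pivot relations applies at
  once. Otherwise one factor is first replaced by the square of its inverse or, if no further point is shared, split
  by a pivot relation.\<close>

lemma lift3_pivot_mult:
  assumes k: "Suc k \<le> d" and ab: "a \<noteq> b" "a \<in> {1..k}" "b \<in> {1..k}"
    and ef: "e \<noteq> f" "e \<in> {1..k}" "f \<in> {1..k}"
  shows "lift3 (Suc k) a b \<otimes> lift3 (Suc k) e f \<in> two_cosets k"
proof -
  let ?p = "Suc k"
  have Tp: "lift3 ?p x y \<in> carrier F" if "x \<noteq> y" "x \<in> {1..k}" "y \<in> {1..k}" for x y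
    using that k by (intro lift3_closed) auto
  have inv3: "lift3 ?p x y \<otimes> lift3 ?p x y = lift3 ?p y x" if xy: "x \<noteq> y" "x \<in> {1..k}" "y \<in> {1..k}" for x y
  proof -
    have "lift3 ?p y x = lift3 y x ?p" using lift3_rotate[of ?p y x] xy k by auto
    also have "\<dots> = inv (lift3 x y ?p)" using xy k by (intro lift3_inverse) auto
    also have "lift3 x y ?p = lift3 ?p x y" using lift3_rotate[of ?p x y] xy k by auto
    also have "inv (lift3 ?p x y) = lift3 ?p x y \<otimes> lift3 ?p x y"
      using lift3_cube[of ?p x y] xy k Tp[OF xy] by (intro inv_equality) auto
    finally show ?thesis by simp
  qed
  have Tl: "lift3 x y z \<in> level k" if "distinct [x, y, z]" "{x, y, z} \<subseteq> {1..k}" for x y z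
    using that by (rule lift3_level)
  consider "b = e" "a = f" | "b = e" "a \<noteq> f" | "b \<noteq> e" "a = f" | "b = f" "a = e" | "b = f" "a \<noteq> e"
    | "a = e" "b \<noteq> f" | "distinct [a, b, e, f]" using ab ef by auto
  then show ?thesis
  proof cases
    case 1
    then have "lift3 ?p e f = lift3 ?p a b \<otimes> lift3 ?p a b" using inv3[OF ab] by simp
    then have "lift3 ?p a b \<otimes> lift3 ?p e f = lift3 ?p a b \<otimes> lift3 ?p a b \<otimes> lift3 ?p a b"
      using Tp[OF ab] by (simp only: m_assoc)
    also have "\<dots> = \<one>" using ab k by (intro lift3_cube) auto
    finally show ?thesis by (simp add: two_cosetsI level_one)
  next
    case 2
    then have "lift3 ?p a b \<otimes> lift3 ?p e f = \<kappa> \<otimes> lift3 a b f"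
      using lift3_mult_pivot_chain[of ?p a b f] ab ef k by (auto simp: quadruple_def)
    then show ?thesis using 2 ab ef by (simp add: two_cosetsI level_mult \<kappa>_level Tl)
  next
    case 3
    then have "lift3 ?p a b \<otimes> lift3 ?p e f = \<kappa> \<otimes> lift3 ?p e b"
      using lift3_mult_pivot_merge[of ?p a b e] ab ef k by (auto simp: quadruple_def)
    then show ?thesis using 3 ab ef by (simp add: two_cosetsI \<kappa>_level)
  next
    case 4
    then have "lift3 ?p a b \<otimes> lift3 ?p e f = \<one> \<otimes> lift3 ?p b a"
      using inv3[OF ab] Tp ab by simp
    then show ?thesis using ab two_cosetsI(2)[OF level_one] by simp
  next
    case 5
    have "lift3 ?p a b \<otimes> lift3 ?p e f = (lift3 ?p a b \<otimes> lift3 ?p b e) \<otimes> lift3 ?p b e"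
      using inv3[of b e] Tp 5 ab ef by (simp add: m_assoc)
    also have "lift3 ?p a b \<otimes> lift3 ?p b e = \<kappa> \<otimes> lift3 a b e"
      using 5 ab ef k by (intro lift3_mult_pivot_chain) (auto simp: quadruple_def)
    finally show ?thesis using 5 ab ef by (simp add: two_cosetsI level_mult \<kappa>_level Tl)
  next
    case 6
    have lev: "\<kappa> \<otimes> lift3 b a f \<in> level k" using 6 ab ef by (intro level_mult \<kappa>_level Tl) auto
    have "lift3 ?p a b \<otimes> lift3 ?p e f = lift3 ?p b a \<otimes> (lift3 ?p b a \<otimes> lift3 ?p a f)"
      using inv3[of b a] Tp 6 ab ef by (simp add: m_assoc[symmetric])
    also have "lift3 ?p b a \<otimes> lift3 ?p a f = \<kappa> \<otimes> lift3 b a f"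
      using 6 ab ef k by (intro lift3_mult_pivot_chain) (auto simp: quadruple_def)
    finally show ?thesis
      using lift3_mult_level[OF k lev, of b a] ab lev by (auto simp: two_cosetsI)
  next
    case 7
    have m: "lift3 ?p b f \<otimes> lift3 ?p e b = \<kappa> \<otimes> lift3 ?p e f"
      using 7 ab ef k by (intro lift3_mult_pivot_merge) (auto simp: quadruple_def)
    have c: "lift3 ?p a b \<otimes> lift3 ?p b f = \<kappa> \<otimes> lift3 a b f"
      using 7 ab ef k by (intro lift3_mult_pivot_chain) (auto simp: quadruple_def)
    have cl: "lift3 ?p b f \<in> carrier F" "lift3 ?p e b \<in> carrier F" "lift3 ?p e f \<in> carrier F" "lift3 ?p a b \<in> carrier F"
      using 7 ab ef by (auto intro!: Tp)
    have "lift3 ?p a b \<otimes> (\<kappa> \<otimes> lift3 ?p e f) = \<kappa> \<otimes> lift3 a b f \<otimes> lift3 ?p e b"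
      unfolding m[symmetric] c[symmetric] using cl by (simp add: m_assoc)
    then have "\<kappa> \<otimes> (lift3 ?p a b \<otimes> (\<kappa> \<otimes> lift3 ?p e f)) = \<kappa> \<otimes> (\<kappa> \<otimes> lift3 a b f \<otimes> lift3 ?p e b)" by simp
    moreover have "\<kappa> \<otimes> (lift3 ?p a b \<otimes> (\<kappa> \<otimes> lift3 ?p e f)) = lift3 ?p a b \<otimes> lift3 ?p e f"
    proof -
      have "\<kappa> \<otimes> (lift3 ?p a b \<otimes> (\<kappa> \<otimes> lift3 ?p e f)) = (\<kappa> \<otimes> lift3 ?p a b) \<otimes> \<kappa> \<otimes> lift3 ?p e f"
        using cl \<kappa>(1) by (simp add: m_assoc)
      also have "\<dots> = (\<kappa> \<otimes> \<kappa>) \<otimes> lift3 ?p a b \<otimes> lift3 ?p e f"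
        using cl \<kappa>(1) \<kappa>_comm[OF cl(4)] by (simp add: m_assoc)
      finally show ?thesis using cl \<kappa>(3) by simp
    qed
    moreover have "\<kappa> \<otimes> (\<kappa> \<otimes> lift3 a b f \<otimes> lift3 ?p e b) \<in> two_cosets k"
      using 7 ab ef k by (intro level_mult_two_cosets two_cosetsI level_mult \<kappa>_level Tl) auto
    ultimately show ?thesis by simp
  qed
qed


lemma two_cosets_mult:
  assumes k: "Suc k \<le> d" and u: "u \<in> two_cosets k" and w: "w \<in> two_cosets k"
  shows "u \<otimes> w \<in> two_cosets k"
proof (cases "u \<in> level k")
  case True
  then show ?thesis using k w by (intro level_mult_two_cosets)
next
  case False
  then obtain h a b where h: "u = h \<otimes> lift3 (Suc k) a b" "h \<in> level k" "a \<noteq> b" "a \<in> {1..k}" "b \<in> {1..k}"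
    using u unfolding two_cosets_def by blast
  have hc: "h \<in> carrier F" using level_carrier[OF _ h(2)] k by simp
  have Tc: "lift3 (Suc k) x y \<in> carrier F" if "x \<noteq> y" "x \<in> {1..k}" "y \<in> {1..k}" for x y
    using that k by (intro lift3_closed) auto
  have through: "\<exists>a' b'. a' \<noteq> b' \<and> a' \<in> {1..k} \<and> b' \<in> {1..k} \<and> u \<otimes> g = h \<otimes> g \<otimes> lift3 (Suc k) a' b'"
    if g: "g \<in> level k" for g
  proof -
    have gc: "g \<in> carrier F" using level_carrier[OF _ g] k by simp
    obtain a' b' where ab': "a' \<noteq> b'" "a' \<in> {1..k}" "b' \<in> {1..k}" "lift3 (Suc k) a b \<otimes> g = g \<otimes> lift3 (Suc k) a' b'"
      using lift3_mult_level[OF k g h(3-5)] by blast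
    have "u \<otimes> g = h \<otimes> (lift3 (Suc k) a b \<otimes> g)" using h hc gc Tc[OF h(3-5)] by (simp add: m_assoc)
    also have "\<dots> = h \<otimes> g \<otimes> lift3 (Suc k) a' b'" using ab' hc gc Tc[OF ab'(1-3)] by (simp add: m_assoc)
    finally show ?thesis using ab' by blast
  qed
  show ?thesis
  proof (cases "w \<in> level k")
    case True
    then obtain a' b' where "a' \<noteq> b'" "a' \<in> {1..k}" "b' \<in> {1..k}" "u \<otimes> w = h \<otimes> w \<otimes> lift3 (Suc k) a' b'"
      using through by blast
    then show ?thesis using two_cosetsI(2)[OF level_mult[OF h(2) True]] by metis
  next
    case False
    then obtain g e f where g: "w = g \<otimes> lift3 (Suc k) e f" "g \<in> level k" "e \<noteq> f" "e \<in> {1..k}" "f \<in> {1..k}"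
      using w unfolding two_cosets_def by blast
    have gc: "g \<in> carrier F" using level_carrier[OF _ g(2)] k by simp
    obtain a' b' where ab': "a' \<noteq> b'" "a' \<in> {1..k}" "b' \<in> {1..k}" "u \<otimes> g = h \<otimes> g \<otimes> lift3 (Suc k) a' b'"
      using through[OF g(2)] by blast
    have "u \<otimes> w = (u \<otimes> g) \<otimes> lift3 (Suc k) e f"
      using g h hc gc Tc[OF g(3-5)] Tc[OF h(3-5)] by (simp add: m_assoc)
    also have "\<dots> = (h \<otimes> g) \<otimes> (lift3 (Suc k) a' b' \<otimes> lift3 (Suc k) e f)"
      using ab' hc gc Tc[OF g(3-5)] Tc[OF ab'(1-3)] by (simp add: m_assoc)
    finally show ?thesis
      using level_mult_two_cosets[OF k level_mult[OF h(2) g(2)] lift3_pivot_mult[OF k ab'(1-3) g(3-5)]] by simp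
  qed
qed

lemma lift3_two_cosets:
  assumes k: "Suc k \<le> d" and abc: "distinct [a, b, c]" "{a, b, c} \<subseteq> {1..Suc k}"
  shows "lift3 a b c \<in> two_cosets k"
proof -
  have pivot: "lift3 (Suc k) x y \<in> two_cosets k" if "distinct [Suc k, x, y]" "{x, y} \<subseteq> {1..Suc k}" for x y
  proof -
    have xy: "x \<noteq> y" "x \<in> {1..k}" "y \<in> {1..k}" using that by auto
    have "\<one> \<otimes> lift3 (Suc k) x y \<in> two_cosets k" using xy by (rule two_cosetsI(2)[OF level_one])
    moreover have "lift3 (Suc k) x y \<in> carrier F" using that k by (intro lift3_closed) auto
    ultimately show ?thesis by simp
  qed
  have abcd: "{a, b, c} \<subseteq> {1..d}" using abc k by auto
  have rot: "lift3 b c a = lift3 a b c" "lift3 c a b = lift3 a b c"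
    using lift3_rotate[OF abc(1) abcd] lift3_rotate[of b c a] abc abcd by auto
  consider "a = Suc k" | "b = Suc k" | "c = Suc k" | "{a, b, c} \<subseteq> {1..k}"
    using abc(2) by (auto simp: le_Suc_eq)
  then show ?thesis
  proof cases
    case 1
    then show ?thesis using pivot[of b c] abc by auto
  next
    case 2
    then show ?thesis using pivot[of c a] abc rot by auto
  next
    case 3
    then show ?thesis using pivot[of a b] abc rot by auto
  next
    case 4
    then show ?thesis using abc(1) by (intro two_cosetsI(1) lift3_level)
  qed
qed

lemma level_Suc_subset:
  assumes k: "Suc k \<le> d"
  shows "level (Suc k) \<subseteq> two_cosets k"
proof
  fix x assume "x \<in> level (Suc k)"
  then show "x \<in> two_cosets k"
    unfolding level_def
  proof (induction rule: generate.induct)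
    case one
    then show ?case by (intro two_cosetsI(1) level_one)
  next
    case (incl h)
    then show ?case using lift3_two_cosets[OF k] two_cosetsI(1)[OF \<kappa>_level] by blast
  next
    case (inv h)
    then consider "h = \<kappa>" | a b c where "h = lift3 a b c" "distinct [a, b, c]" "{a, b, c} \<subseteq> {1..Suc k}" by blast
    then show ?case
    proof cases
      case 1
      then show ?thesis using two_cosetsI(1)[OF \<kappa>_level] by (simp add: \<kappa>)
    next
      case 2
      then have "inv h = lift3 b a c" using lift3_inverse[of a b c] k by auto
      then show ?thesis using lift3_two_cosets[OF k, of b a c] 2 by auto
    qed
  next
    case (eng h1 h2)
    then show ?case using two_cosets_mult[OF k] by blast
  qed
qed

text \<open>An element of the second coset does not fix the new point. So an element above the identity descends
  through all levels, down to the subgroup generated by \<open>\<kappa>\<close>.\<close>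

lemma level_kernel:
  assumes "k \<le> d" "x \<in> level k" "\<pi> x = id"
  shows "x \<in> {\<one>, \<kappa>}"
  using assms
proof (induction k)
  case 0
  from 0(2) show ?case
    unfolding level_def
  proof (induction rule: generate.induct)
    case (eng h1 h2)
    then show ?case using \<kappa> by auto
  qed (use \<kappa> in auto)
next
  case (Suc k)
  have "x \<in> level k"
  proof (rule ccontr)
    assume "x \<notin> level k"
    then obtain h a b where h: "x = h \<otimes> lift3 (Suc k) a b" "h \<in> level k" "a \<noteq> b" "a \<in> {1..k}" "b \<in> {1..k}"
      using level_Suc_subset[OF Suc.prems(1)] Suc.prems(2) unfolding two_cosets_def by blast
    have ab: "distinct [Suc k, a, b]" "{Suc k, a, b} \<subseteq> {1..d}" using h Suc.prems(1) by auto
    have "h \<in> carrier F" using level_carrier[OF _ h(2)] Suc.prems(1) by simp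
    then have "\<pi> x b = \<pi> h (three_cycle (Suc k) a b b)"
      using h(1) lift3_closed[OF ab] \<pi>_lift3[OF ab] by (simp only: \<pi>_mult comp_apply)
    also have "\<dots> = \<pi> h (Suc k)" using permutes_three_cycle_values(3)[OF ab(1)] by simp
    also have "\<dots> = Suc k"
      using \<pi>_level[OF _ h(2)] Suc.prems(1) by (intro permutes_not_in) auto
    finally show False using Suc.prems(3) ab by simp
  qed
  then show ?case using Suc by simp
qed

lemma level_surj:
  assumes "p \<in> carrier (alt_group d)"
  shows "\<exists>x\<in>level d. \<pi> x = p"
proof -
  have three: "\<exists>x\<in>level d. \<pi> x = p" if "p \<in> three_cycles d" for p
  proof -
    obtain cs where cs: "p = cycle_of_list cs" "cycle cs" "length cs = 3" "set cs \<subseteq> {1..d}" using \<open>p \<in> three_cycles d\<close> by blast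
    obtain a b c where abc: "cs = [a, b, c]" using stupid_lemma[OF cs(3)] by blast
    then show ?thesis using cs lift3_level[of a b c d] \<pi>_lift3[of a b c] by (metis list.set(1) list.simps(15))
  qed
  have inv_closed: "inv x \<in> level d" if "x \<in> level d" for x
    using that by (rule subgroup.m_inv_closed[OF level_subgroup[OF order_refl]])
  have "p \<in> generate (alt_group d) (three_cycles d)"
    using assms alt_group_carrier_as_three_cycles by blast
  then show ?thesis
  proof (induction rule: generate.induct)
    case one
    then show ?case using level_one \<pi>_one alt_group_one by metis
  next
    case (incl h)
    then show ?case by (rule three)
  next
    case (inv h)
    then obtain x where x: "x \<in> level d" "\<pi> x = h" using three by blast
    have "inv\<^bsub>alt_group d\<^esub> h = inv' h"
      using inv three_cycles_incl by (intro alt_group_inv_equality) blast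
    then show ?case using x inv_closed \<pi>_inv[OF level_carrier[OF order_refl x(1)]] by metis
  next
    case (eng h1 h2)
    then obtain x y where xy: "x \<in> level d" "\<pi> x = h1" "y \<in> level d" "\<pi> y = h2" by blast
    then have "\<pi> (x \<otimes> y) = h1 \<circ> h2" using level_carrier[OF order_refl] by (simp add: \<pi>_mult)
    then show ?case using level_mult[OF xy(1,3)] unfolding alt_group_mult by blast
  qed
qed

text \<open>The top level covers the alternating group and hence contains all commutators.\<close>

lemma derived_kernel: "derived F (carrier F) \<inter> {x. \<pi> x = id} \<subseteq> {\<one>, \<kappa>}"
proof -
  interpret L: subgroup "level d" F by (rule level_subgroup) simp
  have "derived_set F (carrier F) \<subseteq> level d"
  proof
    fix g assume "g \<in> derived_set F (carrier F)"
    then obtain x y where xy: "x \<in> carrier F" "y \<in> carrier F" "g = x \<otimes> y \<otimes> inv x \<otimes> inv y" by blast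
    obtain x' where x': "x' \<in> level d" "\<pi> x' = \<pi> x" using level_surj[OF \<pi>_alt[OF xy(1)]] by blast
    obtain y' where y': "y' \<in> level d" "\<pi> y' = \<pi> y" using level_surj[OF \<pi>_alt[OF xy(2)]] by blast
    have "g = x' \<otimes> y' \<otimes> inv x' \<otimes> inv y'"
      using xy x' y' by (simp only: commutator_cong[of x y x' y'] L.mem_carrier)
    then show "g \<in> level d" using x' y' by (simp only: L.m_closed L.m_inv_closed)
  qed
  then have "derived F (carrier F) \<subseteq> level d"
    unfolding derived_def using L.subgroup_axioms by (rule generate_subgroup_incl)
  then show ?thesis using level_kernel[OF order_refl] by blast
qed

end

section \<open>Degree four\<close>

text \<open>The three involutions of the four-group, named in the order in which the three-cycle on
  \<open>1, 2, 3\<close> permutes them.\<close>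

definition v4a :: "nat \<Rightarrow> nat" where "v4a = transpose 1 2 \<circ> transpose 3 4"
definition v4b :: "nat \<Rightarrow> nat" where "v4b = transpose 1 4 \<circ> transpose 2 3"
definition v4c :: "nat \<Rightarrow> nat" where "v4c = transpose 1 3 \<circ> transpose 2 4"

lemma v4_values:
  "v4a 1 = 2" "v4a 2 = 1" "v4a 3 = 4" "v4a 4 = 3"
  "v4b 1 = 4" "v4b 4 = 1" "v4b 2 = 3" "v4b 3 = 2"
  "v4c 1 = 3" "v4c 3 = 1" "v4c 2 = 4" "v4c 4 = 2"
  by (simp_all add: v4a_def v4b_def v4c_def transpose_def)

lemma v4_alt:
  assumes "d \<ge> 4"
  shows "v4a \<in> carrier (alt_group d)" "v4b \<in> carrier (alt_group d)" "v4c \<in> carrier (alt_group d)"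
  using assms unfolding v4a_def v4b_def v4c_def alt_group_carrier
  by (auto simp: evenperm_comp permutation_swap_id evenperm_swap intro!: permutes_compose permutes_swap_id)

lemma permutes_four_eqI:
  fixes p q :: "nat \<Rightarrow> nat"
  assumes "p permutes {1..4}" "q permutes {1..4}"
    "p 1 = q 1" "p 2 = q 2" "p 3 = q 3" "p 4 = q 4"
  shows "p = q"
proof
  fix x :: nat
  have "{1..4} = {1, 2, 3, 4::nat}" by auto
  then consider "x = (1::nat)" | "x = 2" | "x = 3" | "x = 4" | "x \<notin> {1..4}" by blast
  then show "p x = q x"
    using assms(3-6) permutes_not_in[OF assms(1), of x] permutes_not_in[OF assms(2), of x] by cases simp_all
qed

lemma alt_four_eqI:
  assumes "p \<in> carrier (alt_group 4)" "q \<in> carrier (alt_group 4)"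
    "p 1 = q 1" "p 2 = q 2" "p 3 = q 3" "p 4 = q 4"
  shows "p = q"
  using assms permutes_four_eqI[of p q] unfolding alt_group_carrier by blast

lemma v4_relations:
  "v4a \<circ> v4b = v4c" "v4b \<circ> v4a = v4c" "v4b \<circ> v4c = v4a" "v4c \<circ> v4b = v4a" "v4c \<circ> v4a = v4b" "v4a \<circ> v4c = v4b"
  "v4a \<circ> v4a = id" "v4b \<circ> v4b = id" "v4c \<circ> v4c = id"
  "three_cycle 1 2 3 \<circ> v4a = v4b \<circ> three_cycle 1 2 3" "three_cycle 1 2 3 \<circ> v4b = v4c \<circ> three_cycle 1 2 3"
proof -
  let ?x = "three_cycle 1 2 (3::nat)"
  have x: "?x 1 = 2" "?x 2 = 3" "?x 3 = 1" "?x 4 = 4" by (auto simp: transpose_def)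
  have xa: "?x \<in> carrier (alt_group 4)" by (rule three_cycle_alt) auto
  note eqI = alt_four_eqI alt_comp v4_alt alt_id xa order_refl
  show "v4a \<circ> v4b = v4c" "v4b \<circ> v4a = v4c" "v4b \<circ> v4c = v4a" "v4c \<circ> v4b = v4a" "v4c \<circ> v4a = v4b" "v4a \<circ> v4c = v4b"
    "v4a \<circ> v4a = id" "v4b \<circ> v4b = id" "v4c \<circ> v4c = id" "?x \<circ> v4a = v4b \<circ> ?x" "?x \<circ> v4b = v4c \<circ> ?x"
    by (intro eqI; simp only: comp_apply v4_values x id_apply)+
qed

text \<open>The four-group acts transitively on the points, so an element of it moves the preimage of \<open>4\<close> back to
  \<open>4\<close>; an even permutation fixing \<open>4\<close> is a power of the three-cycle.\<close>

lemma alt_four_cases: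
  assumes p: "p \<in> carrier (alt_group 4)"
  obtains x v where "p = x \<circ> v"
    "x \<in> {id, three_cycle 1 2 3, three_cycle 1 2 3 \<circ> three_cycle 1 2 3}" "v \<in> {id, v4a, v4b, v4c}"
proof -
  let ?x = "three_cycle 1 2 (3::nat)"
  have x: "?x \<in> carrier (alt_group 4)" by (rule three_cycle_alt) auto
  have "\<exists>v\<in>{id, v4a, v4b, v4c}. p (v 4) = 4"
  proof -
    have "p permutes {1..4}" using p by (simp add: alt_group_carrier)
    then have "4 \<in> p ` {1..4}" by (simp add: permutes_image)
    then obtain y where "y \<in> {1..4}" "p y = 4" by force
    moreover from this have "y = 1 \<or> y = 2 \<or> y = 3 \<or> y = 4" by force
    ultimately show ?thesis using v4_values by auto
  qed
  then obtain v where v: "v \<in> {id, v4a, v4b, v4c}" "p (v 4) = 4" by blast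
  have vv: "v \<circ> v = id" using v v4_relations by auto
  have va: "v \<in> carrier (alt_group 4)" using v v4_alt alt_id by auto
  define q where "q = p \<circ> v"
  have q: "q \<in> carrier (alt_group 4)" "q 4 = 4"
    unfolding q_def using alt_comp[OF p va] v by auto
  have pq: "p = q \<circ> v" unfolding q_def by (metis comp_assoc comp_id vv)
  have fix1: "r = id" if r: "r \<in> carrier (alt_group 4)" "r 4 = 4" "r 1 = 1" for r
  proof -
    have "r permutes {2, 3}"
    proof (rule permutes_superset[of r "{1..4}"])
      fix y assume "y \<in> {1..4} - {2, 3::nat}"
      then have "y = 1 \<or> y = 4" by force
      then show "r y = y" using r by auto
    qed (use r in \<open>simp add: alt_group_carrier\<close>)
    then have "r = id \<or> r = transpose 2 3" by (simp add: permutes_doubleton_iff)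
    then show ?thesis using r(1) by (auto simp: alt_group_carrier evenperm_swap)
  qed
  have x4: "?x 1 = 2" "?x 2 = 3" "?x 3 = 1" "?x 4 = 4" by (auto simp: transpose_def)
  have xxx: "?x \<circ> ?x \<circ> ?x = id"
    by (rule alt_four_eqI[OF alt_comp[OF alt_comp[OF x x] x] alt_id]) (simp_all only: comp_apply x4 id_apply)
  have "q permutes {1..4}" using q by (simp add: alt_group_carrier)
  then have "q 1 \<in> {1..4}" "q 1 \<noteq> q 4"
    using permutes_in_image[of q "{1..4}" 1] permutes_inj[THEN injD, of q "{1..4}" 1 4] by auto
  then consider "q 1 = 1" | "q 1 = 2" | "q 1 = 3" using q(2) by force
  then have "q \<in> {id, ?x, ?x \<circ> ?x}"
  proof cases
    case 1
    then show ?thesis using fix1[OF q] by blast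
  next
    case 2
    have "?x \<circ> ?x \<circ> q = id"
      using 2 q by (intro fix1 alt_comp x) (simp_all only: comp_apply x4)
    then have "?x \<circ> (?x \<circ> ?x \<circ> q) = ?x" by simp
    then have "q = ?x" using xxx by (metis comp_assoc id_comp)
    then show ?thesis by blast
  next
    case 3
    have "?x \<circ> q = id"
      using 3 q by (intro fix1 alt_comp x) (simp_all only: comp_apply x4)
    then have "?x \<circ> ?x \<circ> (?x \<circ> q) = ?x \<circ> ?x" by simp
    then have "q = ?x \<circ> ?x" using xxx by (metis comp_assoc id_comp)
    then show ?thesis by blast
  qed
  then show ?thesis using that pq v(1) by blast
qed

locale alt_four_central_extension = alt_central_extension +
  assumes four: "d = 4"
begin

text \<open>Let \<open>A, B, C\<close> be lifts of the involutions that are permuted cyclically by a lift of the three-cycle.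
  They have a common commutator \<open>e\<close> and a common square \<open>f\<close>. With \<open>u = A B C\<close>, multiplying them by a central \<open>z\<close> gives
  the quaternion relations if \<open>f z\<^sup>2 = e\<close> and \<open>u z\<^sup>3 = e\<close>. The quotient of these two equations determines
  \<open>z\<close>, and it is a solution since \<open>u\<^sup>2 = e f\<^sup>3\<close>.\<close>

lemma exists_quaternion_lifts:
  "\<exists>t e I J K. {t, e, I, J, K} \<subseteq> carrier F \<and> \<pi> t = three_cycle 1 2 3 \<and> \<pi> e = id \<and>
     \<pi> I = v4a \<and> \<pi> J = v4b \<and> \<pi> K = v4c \<and> e \<otimes> e = \<one> \<and> I \<otimes> I = e \<and> J \<otimes> J = e \<and> K \<otimes> K = e \<and>
     I \<otimes> J = K \<and> J \<otimes> K = I \<and> K \<otimes> I = J \<and>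
     conj_by t I = J \<and> conj_by t J = K \<and> conj_by t K = I"
proof -
  have x: "three_cycle 1 2 3 \<in> carrier (alt_group d)" using four by (intro three_cycle_alt) auto
  obtain t where t: "t \<in> carrier F" "\<pi> t = three_cycle 1 2 3" using x by (rule liftE)
  obtain A where A: "A \<in> carrier F" "\<pi> A = v4a" using v4_alt(1)[of d] four by (metis liftE order_refl)
  define B where "B = conj_by t A"
  define C where "C = conj_by t B"
  have conj3: "three_cycle 1 2 3 \<circ> v \<circ> inv' (three_cycle 1 2 3) = w"
    if "three_cycle 1 2 3 \<circ> v = w \<circ> three_cycle 1 2 (3::nat)" for v w
    using that alt_inv_comp(2)[OF x] by (metis comp_assoc comp_id)
  have B: "B \<in> carrier F" "\<pi> B = v4b"
    unfolding B_def using A t conj3[OF v4_relations(10)] by (simp_all add: \<pi>_conj del: cycle_of_list.simps)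
  have C: "C \<in> carrier F" "\<pi> C = v4c"
    unfolding C_def using B t conj3[OF v4_relations(11)] by (simp_all add: \<pi>_conj del: cycle_of_list.simps)
  have x4: "three_cycle 1 2 3 1 = (2::nat)" "three_cycle 1 2 3 2 = (3::nat)"
    "three_cycle 1 2 3 3 = (1::nat)" "three_cycle 1 2 3 4 = (4::nat)"
    by (auto simp: transpose_def)
  have xd: "three_cycle 1 2 3 \<in> carrier (alt_group 4)" using x four by simp
  have xxx: "three_cycle 1 2 3 \<circ> (three_cycle 1 2 3 \<circ> three_cycle 1 2 3) = (id :: nat \<Rightarrow> nat)"
    by (rule alt_four_eqI[OF alt_comp[OF xd alt_comp[OF xd xd]] alt_id]) (simp_all only: comp_apply x4 id_apply)
  have "\<pi> (t \<otimes> (t \<otimes> t)) = id" using t xxx by (simp only: \<pi>_mult m_closed)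
  then have "conj_by (t \<otimes> (t \<otimes> t)) A = A"
    using t A central[of "t \<otimes> (t \<otimes> t)" A] by (intro conj_by_commuting) auto
  then have tC: "conj_by t C = A"
    unfolding C_def B_def using t A by (simp add: conj_by_conj_by)
  note cl = A(1) B(1) C(1) t(1)
  define e where "e = A \<otimes> B \<otimes> (inv A \<otimes> inv B)"
  have e: "e \<in> carrier F" unfolding e_def using cl by simp
  have ABe: "A \<otimes> B = e \<otimes> (B \<otimes> A)" unfolding e_def using cl by (simp add: m_assoc)
  have invv: "inv' v4a = v4a" "inv' v4b = v4b" using v4_relations(7,8) by (auto intro: inv_unique_comp)
  have \<pi>e: "\<pi> e = id" unfolding e_def using cl A B
    by (simp only: \<pi>_mult \<pi>_inv invv v4_relations inv_closed m_closed)
  have "conj_by t e = e" using conj_by_central[OF e \<pi>e t(1)] .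
  then have e_eq: "e = B \<otimes> C \<otimes> (inv B \<otimes> inv C)"
    unfolding e_def using cl by (simp add: conj_by_mult conj_by_inv B_def[symmetric] C_def[symmetric])
  have BCe: "B \<otimes> C = e \<otimes> (C \<otimes> B)" unfolding e_eq using cl by (simp add: m_assoc)
  \<comment> \<open>As \<open>C\<close> is \<open>A B\<close> up to the central factor \<open>k\<close>, the commutator of \<open>B\<close> and \<open>C\<close> is both \<open>e\<close> and its inverse.\<close>
  define k where "k = inv (A \<otimes> B) \<otimes> C"
  have inv_c: "inv' v4c = v4c" using v4_relations(9) by (auto intro: inv_unique_comp)
  have k: "k \<in> carrier F" "\<pi> k = id" unfolding k_def using cl A B C
    by (simp_all only: \<pi>_mult \<pi>_inv v4_relations inv_closed m_closed inv_c)
  have Ck: "C = A \<otimes> B \<otimes> k" unfolding k_def using cl by (simp add: m_assoc)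
  have kB: "k \<otimes> B = B \<otimes> k" using central[OF k] cl by simp
  have "B \<otimes> A \<otimes> (B \<otimes> k) = B \<otimes> C" unfolding Ck using cl k by (simp add: m_assoc)
  also have "\<dots> = e \<otimes> (A \<otimes> B \<otimes> (k \<otimes> B))" unfolding BCe unfolding Ck using cl k by (simp add: m_assoc)
  also have "\<dots> = e \<otimes> (A \<otimes> B) \<otimes> (B \<otimes> k)" unfolding kB using cl k e by (simp add: m_assoc)
  finally have BA: "B \<otimes> A = e \<otimes> (A \<otimes> B)" using cl k e by simp
  have "e \<otimes> e \<otimes> (B \<otimes> A) = \<one> \<otimes> (B \<otimes> A)" using BA ABe cl e by (simp add: m_assoc)
  then have ee: "e \<otimes> e = \<one>" using cl e by simp
  define f where "f = A \<otimes> A"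
  have f: "f \<in> carrier F" "\<pi> f = id" unfolding f_def using A by (simp_all only: \<pi>_mult v4_relations m_closed)
  have fB: "B \<otimes> B = f" using conj_by_central[OF f t(1)] cl unfolding f_def by (simp add: conj_by_mult B_def)
  have fC: "C \<otimes> C = f" using conj_by_central[OF f t(1)] cl unfolding fB[symmetric] by (simp add: conj_by_mult C_def)
  define u where "u = A \<otimes> B \<otimes> C"
  have u: "u \<in> carrier F" "\<pi> u = id" unfolding u_def using A B C by (simp_all only: \<pi>_mult v4_relations m_closed)
  have ce: "y \<otimes> e = e \<otimes> y" if "y \<in> carrier F" for y using central[OF e \<pi>e that] by simp
  have cf: "y \<otimes> f = f \<otimes> y" if "y \<in> carrier F" for y using central[OF f that] by simp
  have cu: "y \<otimes> u = u \<otimes> y" if "y \<in> carrier F" for y using central[OF u that] by simp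
  have "u \<otimes> u = A \<otimes> B \<otimes> (C \<otimes> u)" unfolding u_def using cl by (simp add: m_assoc)
  also have "\<dots> = A \<otimes> B \<otimes> (u \<otimes> C)" using cu[OF C(1)] by simp
  also have "\<dots> = A \<otimes> B \<otimes> (A \<otimes> B \<otimes> (C \<otimes> C))" unfolding u_def using cl by (simp add: m_assoc)
  also have "\<dots> = A \<otimes> (B \<otimes> A) \<otimes> B \<otimes> f" unfolding fC using cl f by (simp add: m_assoc)
  also have "\<dots> = (A \<otimes> e) \<otimes> (A \<otimes> (B \<otimes> B)) \<otimes> f" unfolding BA using cl f e by (simp add: m_assoc)
  also have "\<dots> = e \<otimes> (A \<otimes> A) \<otimes> f \<otimes> f" unfolding ce[OF A(1)] fB using cl f e by (simp add: m_assoc)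
  finally have uu: "u \<otimes> u = e \<otimes> f \<otimes> f \<otimes> f" unfolding f_def[symmetric] .
  define z where "z = inv u \<otimes> f"
  have z: "z \<in> carrier F" unfolding z_def using u f by simp
  have \<pi>z: "\<pi> z = id" unfolding z_def using u f by (simp only: \<pi>_mult \<pi>_inv inv_closed inv_id comp_id)
  have cz: "y \<otimes> z = z \<otimes> y" if "y \<in> carrier F" for y using central[OF z \<pi>z that] by simp
  have uz: "u \<otimes> z = f" unfolding z_def using u f by simp
  have "f \<otimes> z \<otimes> z \<otimes> (u \<otimes> u) = f \<otimes> (z \<otimes> (z \<otimes> u) \<otimes> u)" using f u z by (simp add: m_assoc)
  also have "z \<otimes> u = f" using uz cz[OF u(1)] by simp
  also have "f \<otimes> (z \<otimes> f \<otimes> u) = f \<otimes> (f \<otimes> (z \<otimes> u))" using f u z cz[OF f(1)] by (simp add: m_assoc[symmetric])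
  also have "z \<otimes> u = f" using uz cz[OF u(1)] by simp
  also have "f \<otimes> (f \<otimes> f) = e \<otimes> (u \<otimes> u)" unfolding uu using e f ee by (simp add: m_assoc[symmetric])
  finally have fzz: "f \<otimes> z \<otimes> z = e" using e f u z by simp
  define I where "I = A \<otimes> z"
  define J where "J = B \<otimes> z"
  define K where "K = C \<otimes> z"
  have sqz: "(Y \<otimes> z) \<otimes> (Y \<otimes> z) = e" if "Y \<in> carrier F" "Y \<otimes> Y = f" for Y
  proof -
    have "(Y \<otimes> z) \<otimes> (Y \<otimes> z) = Y \<otimes> (z \<otimes> Y) \<otimes> z" using that z by (simp add: m_assoc)
    also have "\<dots> = (Y \<otimes> Y) \<otimes> z \<otimes> z" using that(1) z cz[OF that(1), symmetric] by (simp add: m_assoc)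
    finally show ?thesis using that fzz by simp
  qed
  have I: "I \<in> carrier F" "\<pi> I = v4a" "I \<otimes> I = e"
    unfolding I_def using A z \<pi>z sqz[OF A(1)] f_def by (simp_all only: \<pi>_mult comp_id m_closed)
  have J: "J \<in> carrier F" "\<pi> J = v4b" "J \<otimes> J = e"
    unfolding J_def using B z \<pi>z sqz[OF B(1) fB] by (simp_all only: \<pi>_mult comp_id m_closed)
  have K: "K \<in> carrier F" "\<pi> K = v4c" "K \<otimes> K = e"
    unfolding K_def using C z \<pi>z sqz[OF C(1) fC] by (simp_all only: \<pi>_mult comp_id m_closed)
  have tz: "conj_by t z = z" using conj_by_central[OF z \<pi>z t(1)] .
  have tI: "conj_by t I = J" "conj_by t J = K" "conj_by t K = I"
    unfolding I_def J_def K_def using cl z tz tC by (simp_all add: conj_by_mult B_def[symmetric] C_def[symmetric])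
  have "I \<otimes> J \<otimes> K = A \<otimes> (z \<otimes> B) \<otimes> z \<otimes> (C \<otimes> z)"
    unfolding I_def J_def K_def using cl z by (simp add: m_assoc)
  also have "\<dots> = A \<otimes> B \<otimes> ((z \<otimes> z) \<otimes> C) \<otimes> z"
    unfolding cz[OF B(1), symmetric] using cl z by (simp add: m_assoc)
  also have "(z \<otimes> z) \<otimes> C = C \<otimes> (z \<otimes> z)"
    using cz[OF C(1)] cl z by (metis m_assoc)
  also have "A \<otimes> B \<otimes> (C \<otimes> (z \<otimes> z)) \<otimes> z = (u \<otimes> z) \<otimes> z \<otimes> z"
    unfolding u_def using cl z by (simp add: m_assoc)
  also have "\<dots> = e" unfolding uz fzz ..
  finally have "I \<otimes> J \<otimes> K = e" .
  then have "I \<otimes> J \<otimes> K = K \<otimes> K" using K by simp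
  then have IJ: "I \<otimes> J = K" using I(1) J(1) K(1) by simp
  have JK: "J \<otimes> K = I" using conj_by_mult[OF t(1) I(1) J(1)] unfolding IJ tI by simp
  have KI: "K \<otimes> I = J" using conj_by_mult[OF t(1) J(1) K(1)] unfolding JK tI by simp
  show ?thesis
    by (rule exI[of _ t], rule exI[of _ e], rule exI[of _ I], rule exI[of _ J], rule exI[of _ K])
      (use t e \<pi>e I J K ee IJ JK KI tI in blast)
qed

text \<open>The quaternion units form a normal subgroup, and modulo it and the centre the extension is generated
  by a lift of one three-cycle. So all commutators are quaternion units, and those above the identity are
  \<open>1\<close> and \<open>e\<close>.\<close>

lemma derived_kernel: "\<exists>z\<in>carrier F. derived F (carrier F) \<inter> {x. \<pi> x = id} \<subseteq> {\<one>, z}"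
proof -
  obtain t e I J K where q: "{t, e, I, J, K} \<subseteq> carrier F" "\<pi> t = three_cycle 1 2 3" "\<pi> e = id"
     "\<pi> I = v4a" "\<pi> J = v4b" "\<pi> K = v4c" "e \<otimes> e = \<one>" "I \<otimes> I = e" "J \<otimes> J = e" "K \<otimes> K = e"
     "I \<otimes> J = K" "J \<otimes> K = I" "K \<otimes> I = J"
     "conj_by t I = J" "conj_by t J = K" "conj_by t K = I"
    using exists_quaternion_lifts by blast
  have cl: "t \<in> carrier F" "e \<in> carrier F" "I \<in> carrier F" "J \<in> carrier F" "K \<in> carrier F" using q(1) by auto
  have ce: "y \<otimes> e = e \<otimes> y" if "y \<in> carrier F" for y using central[OF cl(2) q(3) that] by simp
  define S where "S = {\<one>, I, J, K, e, e \<otimes> I, e \<otimes> J, e \<otimes> K}"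
  have Sc: "S \<subseteq> carrier F" unfolding S_def using cl by auto
  have eS: "e \<otimes> s \<in> S" if "s \<in> S" for s
  proof -
    have "e \<otimes> (e \<otimes> s) = s" if "s \<in> carrier F" for s
      using that cl q(7) by (simp add: m_assoc[symmetric])
    then show ?thesis using that cl q(7) unfolding S_def by auto
  qed
  have swapped: "X \<otimes> Z = e \<otimes> Y" if "X \<in> carrier F" "Y \<in> carrier F" "Z \<in> carrier F" "X \<otimes> Y = Z" "X \<otimes> X = e" for X Y Z
    using that by (metis m_assoc)
  have anti: "I \<otimes> K = e \<otimes> J" "J \<otimes> I = e \<otimes> K" "K \<otimes> J = e \<otimes> I"
    using swapped cl q by blast+
  have base: "w \<otimes> w' \<in> S" if "w \<in> {\<one>, I, J, K}" "w' \<in> {\<one>, I, J, K}" for w w'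
    using that cl q anti unfolding S_def by auto
  have S_alt: "S = {\<one>, I, J, K} \<union> (\<lambda>w. e \<otimes> w) ` {\<one>, I, J, K}" unfolding S_def using cl by auto
  have w_cl: "w \<in> carrier F" if "w \<in> {\<one>, I, J, K}" for w using that cl by auto
  have multS: "s \<otimes> s' \<in> S" if s: "s \<in> S" "s' \<in> S" for s s'
  proof -
    obtain w where w: "w \<in> {\<one>, I, J, K}" "s = w \<or> s = e \<otimes> w" using s(1) unfolding S_alt by blast
    obtain w' where w': "w' \<in> {\<one>, I, J, K}" "s' = w' \<or> s' = e \<otimes> w'" using s(2) unfolding S_alt by blast
    have b: "w \<otimes> w' \<in> S" using base w w' by blast
    have wc: "w \<in> carrier F" "w' \<in> carrier F" "s' \<in> carrier F" using w_cl w w' s Sc by auto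
    have "w \<otimes> (e \<otimes> w') = (w \<otimes> e) \<otimes> w'" using wc cl by (simp add: m_assoc)
    also have "\<dots> = e \<otimes> (w \<otimes> w')" unfolding ce[OF wc(1)] using wc cl by (simp add: m_assoc)
    finally have b': "w \<otimes> s' \<in> S" using w'(2) b eS[OF b] by metis
    have "e \<otimes> w \<otimes> s' = e \<otimes> (w \<otimes> s')" using wc cl by (simp add: m_assoc)
    then show ?thesis using w(2) b' eS[OF b'] by metis
  qed
  have invS: "inv s \<in> S" if s: "s \<in> S" for s
  proof -
    have "s \<otimes> s \<in> {\<one>, e}"
    proof -
      obtain w where w: "w \<in> {\<one>, I, J, K}" "s = w \<or> s = e \<otimes> w" using s unfolding S_alt by blast
      have "w \<otimes> w \<in> {\<one>, e}" using w(1) q(8-10) by auto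
      moreover have "e \<otimes> w \<otimes> (e \<otimes> w) = w \<otimes> w"
      proof -
        have "e \<otimes> w \<otimes> (e \<otimes> w) = e \<otimes> (w \<otimes> e) \<otimes> w" using w_cl[OF w(1)] cl by (simp add: m_assoc)
        also have "\<dots> = (e \<otimes> e) \<otimes> w \<otimes> w" unfolding ce[OF w_cl[OF w(1)]] using w_cl[OF w(1)] cl by (simp add: m_assoc)
        finally show ?thesis using q(7) w_cl[OF w(1)] by simp
      qed
      ultimately show ?thesis using w by auto
    qed
    moreover have sc: "s \<in> carrier F" using that Sc by blast
    ultimately have "s \<otimes> s = \<one> \<or> (e \<otimes> s) \<otimes> s = \<one>"
      using cl(2) q(7) by (auto simp: m_assoc)
    then have "inv s = s \<or> inv s = e \<otimes> s"
      using inv_equality[OF _ sc sc] inv_equality[OF _ sc m_closed[OF cl(2) sc]] by blast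
    then show ?thesis using that eS by metis
  qed
  interpret S: subgroup S F
    using Sc multS invS by (intro subgroupI) (auto simp: S_def)
  define N where "N = {g \<in> carrier F. \<forall>s\<in>S. conj_by g s \<in> S}"
  have Nm: "g \<otimes> h \<in> N" if "g \<in> N" "h \<in> N" for g h
    using that Sc unfolding N_def by (auto simp: conj_by_conj_by[symmetric])
  have NS: "g \<in> N" if "g \<in> S" for g
    using that unfolding N_def by (auto simp: conj_by_def)
  have Nt: "t \<in> N"
  proof -
    have et: "conj_by t e = e" using conj_by_central[OF cl(2) q(3) cl(1)] .
    have "conj_by t s \<in> S" if "s \<in> S" for s
      using that cl q et conj_by_central[of \<one> t] \<pi>_one unfolding S_def by (auto simp: conj_by_mult)
    then show ?thesis unfolding N_def using cl by blast
  qed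
  have dec: "\<exists>x\<in>{\<one>, t, t \<otimes> t}. \<exists>w\<in>S. \<pi> g = \<pi> (x \<otimes> w)" if g: "g \<in> carrier F" for g
  proof -
    have "\<pi> g \<in> carrier (alt_group 4)" using \<pi>_alt[OF g] four by simp
    then obtain x v where xv: "\<pi> g = x \<circ> v" "x \<in> {id, three_cycle 1 2 3, three_cycle 1 2 3 \<circ> three_cycle 1 2 3}" "v \<in> {id, v4a, v4b, v4c}"
      by (rule alt_four_cases)
    have "\<exists>x'\<in>{\<one>, t, t \<otimes> t}. x = \<pi> x'"
      using xv(2) \<pi>_one q(2) \<pi>_mult[OF cl(1) cl(1)] by (metis insert_iff singletonD)
    then obtain x' where x': "x' \<in> {\<one>, t, t \<otimes> t}" "x = \<pi> x'" by blast
    have "\<exists>w\<in>S. v = \<pi> w"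
      using xv(3) \<pi>_one q(4-6) unfolding S_def by (metis insert_iff singletonD)
    then obtain w where w: "w \<in> S" "v = \<pi> w" by blast
    have "w \<in> carrier F" "x' \<in> carrier F" using w(1) Sc x'(1) cl(1) by auto
    then have "\<pi> g = \<pi> (x' \<otimes> w)" by (simp only: \<pi>_mult xv(1) x'(2) w(2))
    then show ?thesis using x' w by blast
  qed
  have xN: "x \<in> N" if "x \<in> {\<one>, t, t \<otimes> t}" for x using that Nt Nm[OF Nt Nt] NS by auto
  have Nc: "conj_by g s \<in> S" if "g \<in> N" "s \<in> S" for g s using that unfolding N_def by blast
  have N_carrier: "g \<in> carrier F" if "g \<in> N" for g using that unfolding N_def by blast
  have slide: "\<exists>s\<in>S. x \<otimes> w \<otimes> (x' \<otimes> w') = s \<otimes> (x \<otimes> x')"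
    if x: "x \<in> N" "x' \<in> N" and w: "w \<in> S" "w' \<in> S" for x x' w w'
  proof -
    have c: "x \<in> carrier F" "x' \<in> carrier F" "w \<in> carrier F" "w' \<in> carrier F" using x w N_carrier by auto
    have "x \<otimes> w \<otimes> (x' \<otimes> w') = conj_by x w \<otimes> conj_by x (conj_by x' w') \<otimes> (x \<otimes> x')"
      using c by (simp add: conj_by_def m_assoc)
    moreover have "conj_by x w \<otimes> conj_by x (conj_by x' w') \<in> S" by (intro multS Nc x w)
    ultimately show ?thesis by blast
  qed
  have "derived_set F (carrier F) \<subseteq> S"
  proof
    fix y assume "y \<in> derived_set F (carrier F)"
    then obtain g h where gh: "g \<in> carrier F" "h \<in> carrier F" "y = g \<otimes> h \<otimes> inv g \<otimes> inv h" by blast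
    obtain x w where xw: "x \<in> {\<one>, t, t \<otimes> t}" "w \<in> S" "\<pi> g = \<pi> (x \<otimes> w)" using dec[OF gh(1)] by blast
    obtain x' w' where xw': "x' \<in> {\<one>, t, t \<otimes> t}" "w' \<in> S" "\<pi> h = \<pi> (x' \<otimes> w')" using dec[OF gh(2)] by blast
    have c: "x \<in> carrier F" "x' \<in> carrier F" "w \<in> carrier F" "w' \<in> carrier F" using xw xw' xN N_carrier by auto
    have xx: "x \<otimes> x' = x' \<otimes> x" using xw(1) xw'(1) cl(1) by (auto simp: m_assoc)
    have "y = (x \<otimes> w) \<otimes> (x' \<otimes> w') \<otimes> inv (x \<otimes> w) \<otimes> inv (x' \<otimes> w')"
      unfolding gh(3) by (intro commutator_cong gh xw(3)[symmetric] xw'(3)[symmetric] m_closed c)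
    also have "\<dots> = (x \<otimes> w \<otimes> (x' \<otimes> w')) \<otimes> inv (x' \<otimes> w' \<otimes> (x \<otimes> w))"
      using c by (simp add: inv_mult_group m_assoc)
    finally have y: "y = (x \<otimes> w \<otimes> (x' \<otimes> w')) \<otimes> inv (x' \<otimes> w' \<otimes> (x \<otimes> w))" .
    obtain s where s: "s \<in> S" "x \<otimes> w \<otimes> (x' \<otimes> w') = s \<otimes> (x \<otimes> x')"
      using slide[OF xN[OF xw(1)] xN[OF xw'(1)] xw(2) xw'(2)] by blast
    obtain s' where s': "s' \<in> S" "x' \<otimes> w' \<otimes> (x \<otimes> w) = s' \<otimes> (x \<otimes> x')"
      using slide[OF xN[OF xw'(1)] xN[OF xw(1)] xw'(2) xw(2)] unfolding xx by blast
    have "y = s \<otimes> inv s'"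
      unfolding y s(2) s'(2) using subsetD[OF Sc s(1)] subsetD[OF Sc s'(1)] c
      by (simp add: inv_mult_group m_assoc)
    then show "y \<in> S" by (simp only: multS[OF s(1) invS[OF s'(1)]])
  qed
  then have "derived F (carrier F) \<subseteq> S"
    unfolding derived_def using S.subgroup_axioms by (rule generate_subgroup_incl)
  moreover have "s \<in> {\<one>, e}" if "s \<in> S" "\<pi> s = id" for s
  proof -
    have "v4a \<noteq> id" "v4b \<noteq> id" "v4c \<noteq> id" using v4_values by (metis id_apply one_eq_numeral_iff numeral_eq_iff semiring_norm)+
    moreover have "\<pi> (e \<otimes> w) = \<pi> w" if "w \<in> carrier F" for w
      using that cl(2) q(3) by (simp only: \<pi>_mult id_comp)
    ultimately show ?thesis using that cl q(4-6) unfolding S_def by auto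
  qed
  ultimately show ?thesis using cl(2) by blast
qed

end

section \<open>The bound on the derived kernel\<close>

lemma (in alt_central_extension) derived_kernel_le_two:
  assumes "d \<ge> 4" "d \<noteq> 6" "d \<noteq> 7"
  shows "\<exists>z\<in>carrier F. derived F (carrier F) \<inter> {x. \<pi> x = id} \<subseteq> {\<one>, z}"
proof (cases "d = 4")
  case True
  interpret four: alt_four_central_extension F d \<pi>
    by (intro alt_four_central_extension.intro alt_central_extension_axioms alt_four_central_extension_axioms.intro True)
  show ?thesis by (rule four.derived_kernel)
next
  case False
  interpret large: large_alt_central_extension F d \<pi>
    by (intro large_alt_central_extension.intro alt_central_extension_axioms large_alt_central_extension_axioms.intro)
      (use False assms in simp_all)
  show ?thesis using large.derived_kernel large.\<kappa>(1) by blast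
qed

section \<open>The spin cover of the symmetric group\<close>

type_synonym spinor = "(nat \<Rightarrow> bool) \<Rightarrow> real"

text \<open>Spinors are functions on bit strings. The Clifford generator \<open>k\<close> flips bit \<open>k\<close>, with the
  Jordan-Wigner sign of the preceding bits; this sign makes different generators anticommute.\<close>

definition jw_sign :: "nat \<Rightarrow> (nat \<Rightarrow> bool) \<Rightarrow> real" where
  "jw_sign k s = (\<Prod>i<k. if s i then -1 else 1)"

definition clifford :: "nat \<Rightarrow> spinor \<Rightarrow> spinor" where
  "clifford k w = (\<lambda>s. jw_sign k s * w (s(k := \<not> s k)))"

text \<open>The normalized Clifford element \<open>(e\<^sub>i - e\<^sub>j) / \<surd>2\<close>. It is an involution, and conjugation by it is,
  up to sign, the transposition of the generators \<open>i\<close> and \<open>j\<close>.\<close>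

definition reflection :: "nat \<Rightarrow> nat \<Rightarrow> spinor \<Rightarrow> spinor" where
  "reflection i j w = (\<lambda>s. (clifford i w s - clifford j w s) / sqrt 2)"

lemma jw_sign_flip: "jw_sign k (s(l := \<not> s l)) = (if l < k then - jw_sign k s else jw_sign k s)"
proof (cases "l < k")
  case True
  have "jw_sign k s' = (if s' l then -1 else 1) * (\<Prod>i\<in>{..<k} - {l}. if s' i then -1 else 1)" for s'
    unfolding jw_sign_def using True by (subst prod.remove[of _ l]) auto
  moreover have "(\<Prod>i\<in>{..<k} - {l}. if (s(l := \<not> s l)) i then -1 else (1::real)) = (\<Prod>i\<in>{..<k} - {l}. if s i then -1 else 1)"
    by (rule prod.cong) auto
  ultimately show ?thesis using True by simp
next
  case False
  then show ?thesis unfolding jw_sign_def by (auto intro!: prod.cong)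
qed

lemma jw_sign_square: "jw_sign k s * jw_sign k s = 1"
  unfolding jw_sign_def prod.distrib[symmetric] by (rule prod.neutral) auto

lemma clifford_square: "clifford k (clifford k w) = w"
  by (simp add: clifford_def jw_sign_flip fun_eq_iff mult.assoc[symmetric] jw_sign_square)

lemma clifford_anticommute: "k \<noteq> l \<Longrightarrow> clifford k (clifford l w) s = - clifford l (clifford k w) s"
  using linorder_neq_iff[of k l] by (auto simp: clifford_def jw_sign_flip fun_upd_twist)

lemma clifford_scale: "clifford k (\<lambda>s. c * w s) = (\<lambda>s. c * clifford k w s)"
  by (simp add: clifford_def fun_eq_iff)

lemma clifford_diff: "clifford k (\<lambda>s. w s - w' s) = (\<lambda>s. clifford k w s - clifford k w' s)"
  by (simp add: clifford_def fun_eq_iff algebra_simps)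

lemma reflection_scale: "reflection i j (\<lambda>s. c * w s) = (\<lambda>s. c * reflection i j w s)"
  by (simp add: reflection_def clifford_scale fun_eq_iff algebra_simps)

lemma reflection_diff: "reflection i j (\<lambda>s. w s - w' s) = (\<lambda>s. reflection i j w s - reflection i j w' s)"
  by (simp add: reflection_def clifford_diff fun_eq_iff diff_divide_distrib)

lemma clifford_reflection:
  "clifford k (reflection i j w) = (\<lambda>s. (clifford k (clifford i w) s - clifford k (clifford j w) s) / sqrt 2)"
  using clifford_scale[of k "1 / sqrt 2" "\<lambda>s. clifford i w s - clifford j w s"]
  by (simp add: reflection_def clifford_diff)

lemma reflection_square:
  assumes "i \<noteq> j"
  shows "reflection i j (reflection i j w) = w"
proof
  fix s
  have "reflection i j (reflection i j w) s =
      ((w s - clifford i (clifford j w) s) / sqrt 2 - (clifford j (clifford i w) s - w s) / sqrt 2) / sqrt 2"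
    by (subst reflection_def) (simp add: clifford_reflection clifford_square)
  also have "\<dots> = w s"
    using clifford_anticommute[OF assms, of w s] by (simp add: field_simps)
  finally show "reflection i j (reflection i j w) s = w s" .
qed

lemma reflection_clifford:
  assumes "i \<noteq> j"
  shows "reflection i j (clifford k w) = (\<lambda>s. - clifford (transpose i j k) (reflection i j w) s)"
proof -
  consider "k = i" | "k = j" | "k \<noteq> i" "k \<noteq> j" by blast
  then show ?thesis
  proof cases
    case 1
    then show ?thesis
      by (simp add: clifford_reflection clifford_square) (simp add: reflection_def clifford_square fun_eq_iff field_simps)
  next
    case 2
    then show ?thesis
      by (simp add: clifford_reflection clifford_square) (simp add: reflection_def clifford_square fun_eq_iff field_simps)
  next
    case 3
    then show ?thesis
      using clifford_anticommute[of k i w] clifford_anticommute[of k j w]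
      by (simp add: clifford_reflection) (simp add: reflection_def fun_eq_iff field_simps)
  qed
qed

text \<open>The group generated by the reflections, recorded together with the permutations that they cover.\<close>

inductive spin_lift :: "(nat \<Rightarrow> nat) \<Rightarrow> (spinor \<Rightarrow> spinor) \<Rightarrow> bool" where
  spin_lift_id: "spin_lift id id"
| spin_lift_reflection: "spin_lift p u \<Longrightarrow> i \<noteq> j \<Longrightarrow> spin_lift (transpose i j \<circ> p) (reflection i j \<circ> u)"

lemma spin_lift_permutation: "spin_lift p u \<Longrightarrow> permutation p"
  by (induction rule: spin_lift.induct) (rule permutation_id, intro permutation_compose permutation_swap_id)

lemma spin_lift_mult:
  assumes "spin_lift p u" "spin_lift q v"
  shows "spin_lift (p \<circ> q) (u \<circ> v)"
  using assms(1)
proof (induction rule: spin_lift.induct)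
  case spin_lift_id
  then show ?case using assms(2) by simp
next
  case (spin_lift_reflection p u i j)
  from spin_lift.spin_lift_reflection[OF spin_lift_reflection.IH spin_lift_reflection.hyps(2)]
  show ?case by (simp only: comp_assoc)
qed

lemma spin_lift_scale: "spin_lift p u \<Longrightarrow> u (\<lambda>s. c * w s) = (\<lambda>s. c * u w s)"
  by (induction arbitrary: w rule: spin_lift.induct) (simp_all add: reflection_scale)

lemma spin_lift_diff: "spin_lift p u \<Longrightarrow> u (\<lambda>s. w s - w' s) = (\<lambda>s. u w s - u w' s)"
  by (induction arbitrary: w w' rule: spin_lift.induct) (simp_all add: reflection_diff)

lemma spin_lift_clifford:
  "spin_lift p u \<Longrightarrow> u (clifford k w) = (\<lambda>s. of_int (sign p) * clifford (p k) (u w) s)"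
proof (induction arbitrary: w rule: spin_lift.induct)
  case (spin_lift_reflection p u i j)
  have sgn: "sign (transpose i j \<circ> p) = - sign p"
    using spin_lift_permutation[OF spin_lift_reflection.hyps(1)] spin_lift_reflection.hyps(2)
    by (simp only: sign_compose permutation_swap_id sign_swap_id if_False mult_minus1)
  show ?case
    unfolding sgn using spin_lift_reflection by (simp add: reflection_scale reflection_clifford)
qed simp

lemma spin_lift_reflection_comm:
  assumes u: "spin_lift p u" and p: "p i = i" "p j = j"
  shows "u (reflection i j w) = (\<lambda>s. of_int (sign p) * reflection i j (u w) s)"
proof -
  have "u (reflection i j w) = u (\<lambda>s. (1 / sqrt 2) * (clifford i w s - clifford j w s))"
    by (simp add: reflection_def)
  also have "\<dots> = (\<lambda>s. (1 / sqrt 2) * (u (clifford i w) s - u (clifford j w) s))"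
    by (simp only: spin_lift_scale[OF u] spin_lift_diff[OF u])
  finally show ?thesis
    unfolding spin_lift_clifford[OF u] p by (simp add: reflection_def right_diff_distrib diff_divide_distrib)
qed

lemma spin_lift_exists:
  assumes "permutation p"
  shows "\<exists>u. spin_lift p u"
proof -
  obtain S where "p permutes S" "finite S" using assms permutation_permutes by blast
  then show ?thesis
    by (induction rule: permutes_induct) (use spin_lift.intros in blast)+
qed

lemma spin_lift_inverse:
  assumes "spin_lift p u"
  shows "\<exists>v. spin_lift (inv' p) v \<and> u \<circ> v = id \<and> v \<circ> u = id"
  using assms
proof (induction rule: spin_lift.induct)
  case spin_lift_id
  show ?case by (rule exI[of _ id]) (simp only: inv_id id_comp spin_lift.spin_lift_id simp_thms)
next
  case (spin_lift_reflection p u i j)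
  then obtain v where v: "spin_lift (inv' p) v" "u \<circ> v = id" "v \<circ> u = id" by blast
  have r: "spin_lift (transpose i j) (reflection i j)"
    using spin_lift.spin_lift_reflection[OF spin_lift.spin_lift_id spin_lift_reflection.hyps(2)] by simp
  have rr: "reflection i j \<circ> reflection i j = id"
    using reflection_square[OF spin_lift_reflection.hyps(2)] by (simp add: fun_eq_iff)
  have "inv' (transpose i j \<circ> p) = inv' p \<circ> transpose i j"
    using spin_lift_permutation[OF spin_lift_reflection.hyps(1)] permutation_bijective bij_transpose
    by (subst o_inv_distrib) auto
  then have "spin_lift (inv' (transpose i j \<circ> p)) (v \<circ> reflection i j)"
    using spin_lift_mult[OF v(1) r] by simp
  moreover have "(reflection i j \<circ> u) \<circ> (v \<circ> reflection i j) = id"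
    using v rr by (metis comp_assoc comp_id)
  moreover have "(v \<circ> reflection i j) \<circ> (reflection i j \<circ> u) = id"
    using v rr by (metis comp_assoc id_comp)
  ultimately show ?case by blast
qed

text \<open>An operator above the identity commutes with the Clifford generators, hence with all
  reflections. This is why the cover is a central extension.\<close>

lemma spin_lift_id_central:
  assumes "spin_lift id k" "spin_lift q v"
  shows "k \<circ> v = v \<circ> k"
  using assms(2)
proof (induction rule: spin_lift.induct)
  case (spin_lift_reflection p u i j)
  have "k \<circ> reflection i j = reflection i j \<circ> k"
    using spin_lift_reflection_comm[OF assms(1)] by (simp add: fun_eq_iff)
  then show ?case using spin_lift_reflection.IH by (metis comp_assoc)
qed simp

lemma spin_lift_unique:
  assumes "spin_lift p u" "spin_lift p u'"
  shows "\<exists>k. spin_lift id k \<and> u' = k \<circ> u"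
proof -
  obtain v where v: "spin_lift (inv' p) v" "v \<circ> u = id" using spin_lift_inverse[OF assms(1)] by blast
  have "bij p" using spin_lift_permutation[OF assms(1)] permutation_bijective by blast
  then have "p \<circ> inv' p = id" by (metis bij_is_surj surj_iff)
  then have "spin_lift id (u' \<circ> v)" using spin_lift_mult[OF assms(2) v(1)] by simp
  moreover have "u' = (u' \<circ> v) \<circ> u" using v(2) by (metis comp_assoc comp_id)
  ultimately show ?thesis by blast
qed

text \<open>The lifts of \<open>p\<close> and \<open>q\<close> commute up to the scalar \<open>\<epsilon>\<close>. As lifts differ by central operators, the
  choice of the lifts does not matter, and one pair is enough to establish the relation.\<close>

definition spin_comm :: "(nat \<Rightarrow> nat) \<Rightarrow> (nat \<Rightarrow> nat) \<Rightarrow> real \<Rightarrow> bool" where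
  "spin_comm p q \<epsilon> \<longleftrightarrow>
    (\<forall>u v. spin_lift p u \<longrightarrow> spin_lift q v \<longrightarrow> (\<forall>w. u (v w) = (\<lambda>s. \<epsilon> * v (u w) s)))"

lemma spin_commI:
  assumes uv: "spin_lift p u" "spin_lift q v" and comm: "\<And>w. u (v w) = (\<lambda>s. \<epsilon> * v (u w) s)"
  shows "spin_comm p q \<epsilon>"
  unfolding spin_comm_def
proof (intro allI impI)
  fix u' v' w assume "spin_lift p u'" "spin_lift q v'"
  then obtain k l where k: "spin_lift id k" "u' = k \<circ> u" and l: "spin_lift id l" "v' = l \<circ> v"
    using spin_lift_unique uv by blast
  have lu: "l (u x) = u (l x)" for x using spin_lift_id_central[OF l(1) uv(1)] by (metis comp_apply)
  have kl: "k (l x) = l (k x)" for x using spin_lift_id_central[OF k(1) l(1)] by (metis comp_apply)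
  have kv: "k (v x) = v (k x)" for x using spin_lift_id_central[OF k(1) uv(2)] by (metis comp_apply)
  have "u' (v' w) = k (l (u (v w)))" using k l by (simp add: lu)
  also have "\<dots> = l (k (u (v w)))" by (rule kl)
  also have "\<dots> = (\<lambda>s. \<epsilon> * l (k (v (u w))) s)"
    by (simp only: comm spin_lift_scale[OF k(1)] spin_lift_scale[OF l(1)])
  also have "\<dots> = (\<lambda>s. \<epsilon> * v' (u' w) s)" using k l kv by simp
  finally show "u' (v' w) = (\<lambda>s. \<epsilon> * v' (u' w) s)" .
qed

lemma spin_commD:
  "spin_comm p q \<epsilon> \<Longrightarrow> spin_lift p u \<Longrightarrow> spin_lift q v \<Longrightarrow> u (v w) = (\<lambda>s. \<epsilon> * v (u w) s)"
  unfolding spin_comm_def by blast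

lemma spin_comm_unique:
  assumes "spin_comm p q \<epsilon>" "spin_comm p q \<epsilon>'" "permutation p" "permutation q"
  shows "\<epsilon> = \<epsilon>'"
proof -
  obtain u where u: "spin_lift p u" using spin_lift_exists[OF assms(3)] by blast
  obtain v where v: "spin_lift q v" using spin_lift_exists[OF assms(4)] by blast
  obtain u' v' where "u \<circ> u' = id" "v \<circ> v' = id" using spin_lift_inverse u v by blast
  then have "v (u (u' (v' (\<lambda>s. 1)))) = (\<lambda>s. 1)" by (metis comp_apply id_apply)
  then have "(\<lambda>s::nat \<Rightarrow> bool. \<epsilon> * 1) = (\<lambda>s. \<epsilon>' * 1)"
    using spin_commD[OF assms(1) u v, of "u' (v' (\<lambda>s. 1))"] spin_commD[OF assms(2) u v, of "u' (v' (\<lambda>s. 1))"]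
    by simp
  then show ?thesis by (simp add: fun_eq_iff)
qed

lemma spin_comm_sym:
  assumes "spin_comm p q \<epsilon>" "\<epsilon> = 1 \<or> \<epsilon> = -1"
  shows "spin_comm q p \<epsilon>"
  unfolding spin_comm_def
proof (intro allI impI)
  fix v u w assume vu: "spin_lift q v" "spin_lift p u"
  show "v (u w) = (\<lambda>s. \<epsilon> * u (v w) s)"
    unfolding spin_commD[OF assms(1) vu(2,1)] using assms(2) by auto
qed

lemma spin_comm_mult_left:
  assumes "spin_comm p r \<epsilon>" "spin_comm q r \<epsilon>'" "permutation p" "permutation q" "permutation r"
  shows "spin_comm (p \<circ> q) r (\<epsilon> * \<epsilon>')"
proof -
  obtain u where u: "spin_lift p u" using spin_lift_exists[OF assms(3)] by blast
  obtain v where v: "spin_lift q v" using spin_lift_exists[OF assms(4)] by blast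
  obtain x where x: "spin_lift r x" using spin_lift_exists[OF assms(5)] by blast
  show ?thesis
  proof (rule spin_commI[OF spin_lift_mult[OF u v] x])
    fix w
    show "(u \<circ> v) (x w) = (\<lambda>s. \<epsilon> * \<epsilon>' * x ((u \<circ> v) w) s)"
      by (simp add: spin_commD[OF assms(2) v x] spin_lift_scale[OF u] spin_commD[OF assms(1) u x] ac_simps)
  qed
qed

lemma spin_comm_mult_right:
  assumes "spin_comm r p \<epsilon>" "spin_comm r q \<epsilon>'" "permutation p" "permutation q" "permutation r"
  shows "spin_comm r (p \<circ> q) (\<epsilon> * \<epsilon>')"
proof -
  obtain u where u: "spin_lift p u" using spin_lift_exists[OF assms(3)] by blast
  obtain v where v: "spin_lift q v" using spin_lift_exists[OF assms(4)] by blast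
  obtain x where x: "spin_lift r x" using spin_lift_exists[OF assms(5)] by blast
  show ?thesis
  proof (rule spin_commI[OF x spin_lift_mult[OF u v]])
    fix w
    show "x ((u \<circ> v) w) = (\<lambda>s. \<epsilon> * \<epsilon>' * (u \<circ> v) (x w) s)"
      by (simp add: spin_commD[OF assms(2) x v] spin_lift_scale[OF u] spin_commD[OF assms(1) x u] ac_simps)
  qed
qed

lemma spin_comm_self: "permutation p \<Longrightarrow> spin_comm p p 1"
  using spin_lift_exists[of p] spin_commI[of p _ p _ 1] by auto

lemma spin_comm_id_left: "spin_comm id p 1"
  unfolding spin_comm_def using spin_lift_id_central by (metis comp_apply mult_1)

text \<open>A lift of \<open>p\<close> passes a reflection in two fixed points of \<open>p\<close> at the cost of the sign of \<open>p\<close>. So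
  odd permutations with disjoint supports have anticommuting lifts.\<close>

lemma spin_comm_disjoint:
  assumes p: "permutation p" and q: "q permutes T" "finite T" and fixes_T: "\<And>k. k \<in> T \<Longrightarrow> p k = k"
  shows "spin_comm p q (if evenperm q then 1 else of_int (sign p))"
proof -
  obtain u where u: "spin_lift p u" using spin_lift_exists[OF p] by blast
  have "\<exists>v. spin_lift q v \<and> (\<forall>w. u (v w) = (\<lambda>s. (if evenperm q then 1 else of_int (sign p)) * v (u w) s))"
    using q
  proof (induction rule: permutes_induct)
    case id
    show ?case by (intro exI[of _ id] conjI spin_lift_id) simp
  next
    case (swap a b q)
    then obtain v where v: "spin_lift q v"
      "\<And>w. u (v w) = (\<lambda>s. (if evenperm q then 1 else of_int (sign p)) * v (u w) s)" by blast
    have ev: "evenperm (transpose a b \<circ> q) \<longleftrightarrow> \<not> evenperm q"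
      using swap.hyps spin_lift_permutation[OF v(1)] by (simp add: evenperm_comp permutation_swap_id evenperm_swap)
    have step: "u (reflection a b (v w)) =
        (\<lambda>s. (if evenperm (transpose a b \<circ> q) then 1 else of_int (sign p)) * reflection a b (v (u w)) s)" for w
      unfolding spin_lift_reflection_comm[OF u fixes_T[OF swap.hyps(1)] fixes_T[OF swap.hyps(2)]] v(2) reflection_scale
      using ev by (auto simp: fun_eq_iff mult.assoc[symmetric] of_int_mult[symmetric] simp del: of_int_mult)
    show ?case
    proof (intro exI conjI allI)
      show "spin_lift (transpose a b \<circ> q) (reflection a b \<circ> v)"
        using v(1) swap.hyps(3) by (rule spin_lift_reflection)
    qed (unfold comp_apply[of "reflection a b" v], rule step)
  qed
  then show ?thesis using spin_commI[OF u] by blast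
qed

text \<open>Conjugation by an involution that interchanges two disjoint permutations interchanges their
  lifts, and reordering these costs a sign exactly when they are odd.\<close>

lemma spin_comm_swapped_pair:
  assumes s: "permutation s" "s \<circ> s = id" and \<sigma>: "permutation \<sigma>" and \<sigma>': "\<sigma>' = s \<circ> \<sigma> \<circ> s"
    and perm: "spin_comm \<sigma>' \<sigma> \<epsilon>"
  shows "spin_comm s (\<sigma> \<circ> \<sigma>') \<epsilon>"
proof -
  obtain x where x: "spin_lift s x" using spin_lift_exists[OF s(1)] by blast
  obtain u where u: "spin_lift \<sigma> u" using spin_lift_exists[OF \<sigma>] by blast
  have "inv' s = s" using s(2) by (simp add: inv_unique_comp)
  then obtain y where y: "spin_lift s y" "x \<circ> y = id" "y \<circ> x = id" using spin_lift_inverse[OF x] by auto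
  define u' where "u' = x \<circ> u \<circ> y"
  have u': "spin_lift \<sigma>' u'"
    unfolding u'_def \<sigma>' by (intro spin_lift_mult x u y)
  have xx: "spin_lift id (x \<circ> x)" using spin_lift_mult[OF x x] s(2) by simp
  have yx: "y (x w) = w" for w using y(3) by (metis comp_apply id_apply)
  have xy: "x (y w) = w" for w using y(2) by (metis comp_apply id_apply)
  have xxu: "x (x (u w)) = u (x (x w))" for w using spin_lift_id_central[OF xx u] by (metis comp_apply)
  have "x (u w) = u' (x w)" for w by (simp add: u'_def yx)
  moreover have "x (u' w) = u (x w)" for w by (simp add: u'_def xxu xy)
  ultimately have "x ((u \<circ> u') w) = u' (u (x w))" for w by simp
  then show ?thesis
    using spin_commD[OF perm u' u] by (intro spin_commI[OF x spin_lift_mult[OF u u']]) simp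
qed

section \<open>Commutators of lifts of commuting permutations\<close>

definition prod_cycles :: "'a list list \<Rightarrow> 'a \<Rightarrow> 'a" where
  "prod_cycles css = foldr (\<circ>) (map cycle_of_list css) id"

lemma prod_cycles_Nil: "prod_cycles [] = id"
  by (simp add: prod_cycles_def)

lemma prod_cycles_Cons: "prod_cycles (cs # css) = cycle_of_list cs \<circ> prod_cycles css"
  by (simp add: prod_cycles_def)

lemma prod_cycles_outside: "x \<notin> set (concat css) \<Longrightarrow> prod_cycles css x = x"
  by (induction css) (auto simp: id_outside_supp prod_cycles_Nil prod_cycles_Cons)

lemma prod_cycles_on_cycle:
  assumes "distinct (concat css)" "cs \<in> set css" "x \<in> set cs"
  shows "prod_cycles css x = cycle_of_list cs x"
  using assms
proof (induction css)
  case (Cons c css)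
  show ?case
  proof (cases "x \<in> set c")
    case True
    then have "x \<notin> set (concat css)" using Cons.prems by auto
    moreover have "cs = c"
      using Cons.prems True by (auto simp: disjoint_iff)
    ultimately show ?thesis using prod_cycles_outside[of x css] by (simp add: prod_cycles_Cons)
  next
    case False
    then have "cs \<in> set css" using Cons.prems by auto
    moreover from this have "cycle_of_list cs x \<notin> set c"
      using Cons.prems permutes_in_image[OF cycle_permutes, of cs x] by auto
    ultimately show ?thesis using Cons by (simp add: id_outside_supp prod_cycles_Cons)
  qed
qed simp

lemma evenperm_cycle_of_list:
  assumes "distinct cs" "cs \<noteq> []"
  shows "evenperm (cycle_of_list cs) \<longleftrightarrow> odd (length cs)"
proof -
  have "evenperm (cycle_of_list cs) \<longleftrightarrow> even (length cs - 1)"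
    using swapidseq_ext_imp_swapidseq[OF swapidseq_ext_of_cycles[OF assms(1)]] by (simp add: evenperm_unique)
  then show ?thesis using assms(2) by (cases cs) auto
qed

lemma cycle_decomp_prod_cycles:
  "cycle_decomp S p \<Longrightarrow>
    \<exists>css. [] \<notin> set css \<and> distinct (concat css) \<and> set (concat css) = S \<and> p = prod_cycles css"
proof (induction rule: cycle_decomp.induct)
  case empty
  show ?case by (intro exI[of _ "[]"]) (simp add: prod_cycles_Nil)
next
  case (comp I p cs)
  then obtain css where css: "[] \<notin> set css" "distinct (concat css)" "set (concat css) = I" "p = prod_cycles css"
    by blast
  show ?case
  proof (cases "cs = []")
    case True
    then have "cycle_of_list cs \<circ> p = p" by (simp add: fun_eq_iff)
    moreover have "set cs \<union> I = I" using True by simp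
    ultimately show ?thesis using css by metis
  next
    case False
    then show ?thesis using css comp.hyps by (intro exI[of _ "cs # css"]) (auto simp: prod_cycles_Cons)
  qed
qed

lemma cycle_factorization_exists:
  assumes "p permutes {1..n}"
  shows "\<exists>css. cycle_factorization n p css"
  using cycle_decomp_prod_cycles[OF cycle_decomposition[OF assms]] by (simp add: cycle_factorization_def prod_cycles_def)

lemma disjoint_permutations_commute:
  assumes p: "inj p" "\<And>x. x \<in> T \<Longrightarrow> p x = x" and q: "q permutes T"
  shows "p \<circ> q = q \<circ> p"
proof
  fix x
  show "(p \<circ> q) x = (q \<circ> p) x"
  proof (cases "x \<in> T")
    case True
    then show ?thesis using p(2) permutes_in_image[OF q] by simp
  next
    case False
    have "p x \<notin> T"
    proof
      assume "p x \<in> T"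
      then have "p (p x) = p x" by (rule p(2))
      then have "p x = x" using p(1) by (simp add: injD)
      then show False using False \<open>p x \<in> T\<close> by simp
    qed
    then show ?thesis using False permutes_not_in[OF q] by simp
  qed
qed

text \<open>The lift of \<open>c\<close> commutes with itself. The rest of the even permutation \<open>g\<close> has the same sign as
  \<open>c\<close> and a disjoint support.\<close>

lemma spin_comm_own_cycle:
  assumes g: "permutation g" "evenperm g" and c: "c permutes T" "finite T" and gc: "\<And>x. x \<in> T \<Longrightarrow> g x = c x"
  shows "spin_comm c g (of_int (sign c))"
proof -
  have pc: "permutation c" using c permutation_permutes by blast
  define k where "k = inv' c \<circ> g"
  have k: "permutation k" unfolding k_def using g(1) pc by (intro permutation_compose permutation_inverse)
  have gck: "g = c \<circ> k" unfolding k_def using permutes_inv_o(1)[OF c(1)] by (simp add: comp_assoc[symmetric])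
  have fix_T: "k x = x" if "x \<in> T" for x
    unfolding k_def using gc[OF that] permutes_inverses(2)[OF c(1)] by simp
  have "sign c * sign k = 1"
    using g(2) sign_compose[OF pc k] by (simp add: gck[symmetric] sign_def)
  then have "sign k = sign c" by (simp add: sign_def split: if_splits)
  then have eps: "(if evenperm c then 1 else of_int (sign k)) = (of_int (sign c) :: real)"
    by (simp add: sign_def)
  have "spin_comm k c (of_int (sign c))"
    using spin_comm_disjoint[OF k c fix_T] unfolding eps by blast
  then have "spin_comm c k (of_int (sign c))" by (rule spin_comm_sym) (simp add: sign_def)
  from spin_comm_mult_right[OF spin_comm_self[OF pc] this pc k pc] show ?thesis
    unfolding gck by simp
qed

lemma spin_comm_sign_compose:
  assumes "permutation h" "permutation h'" "permutation g"
    "spin_comm h g (of_int (sign h))" "spin_comm h' g (of_int (sign h'))"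
  shows "spin_comm (h \<circ> h') g (of_int (sign (h \<circ> h')))"
  using spin_comm_mult_left[OF assms(4,5,1-3)] sign_compose[OF assms(1,2)] by simp

lemma spin_comm_sign_funpow:
  assumes "permutation h" "permutation g" "spin_comm h g (of_int (sign h))"
  shows "spin_comm (h ^^ k) g (of_int (sign (h ^^ k)))"
proof (induction k)
  case 0
  show ?case unfolding funpow.simps(1) sign_id of_int_1 by (rule spin_comm_id_left)
next
  case (Suc k)
  then show ?case
    unfolding funpow.simps(2) using assms permutation_funpow by (intro spin_comm_sign_compose) auto
qed

context
  fixes n :: nat and g :: "nat \<Rightarrow> nat" and css :: "nat list list"
  assumes fac: "cycle_factorization n g css"
begin

lemma fac_distinct: "distinct (concat css)" and fac_set: "set (concat css) = {1..n}"
  and fac_nonempty: "cs \<in> set css \<Longrightarrow> cs \<noteq> []" and fac_prod: "g = prod_cycles css"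
  using fac by (auto simp: cycle_factorization_def prod_cycles_def)

lemma fac_cycle: "cs \<in> set css \<Longrightarrow> distinct cs"
  using fac_distinct by (auto simp: distinct_concat_iff)

lemma fac_on_cycle: "cs \<in> set css \<Longrightarrow> x \<in> set cs \<Longrightarrow> g x = cycle_of_list cs x"
  unfolding fac_prod using fac_distinct by (rule prod_cycles_on_cycle)

lemma fac_obtain_cycle:
  assumes "x \<in> {1..n}"
  obtains cs where "cs \<in> set css" "x \<in> set cs"
  using assms unfolding fac_set[symmetric] by auto

lemma fac_disjoint:
  assumes "cs \<in> set css" "cs' \<in> set css" "x \<in> set cs" "x \<in> set cs'"
  shows "cs = cs'"
  using fac_distinct assms by (auto simp: distinct_concat_iff)

lemma fac_subset: "cs \<in> set css \<Longrightarrow> set cs \<subseteq> {1..n}"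
  using fac_set by auto

lemma fac_image: "cs \<in> set css \<Longrightarrow> x \<in> set cs \<Longrightarrow> g x \<in> set cs"
  using fac_on_cycle permutes_in_image[OF cycle_permutes] by metis

lemma fac_funpow:
  assumes "cs \<in> set css" "x \<in> set cs"
  shows "(g ^^ k) x = (cycle_of_list cs ^^ k) x \<and> (g ^^ k) x \<in> set cs"
proof (induction k)
  case (Suc k)
  then have "g ((g ^^ k) x) = cycle_of_list cs ((g ^^ k) x)" "g ((g ^^ k) x) \<in> set cs"
    using fac_on_cycle[OF assms(1)] fac_image[OF assms(1)] by blast+
  then show ?case using Suc by simp
qed (use assms in simp)

lemma fac_funpow_nth:
  assumes "cs \<in> set css" "j < length cs"
  shows "(g ^^ k) (cs ! j) = cs ! ((j + k) mod length cs)"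
proof -
  have "(g ^^ k) (cs ! j) = map (cycle_of_list cs ^^ k) cs ! j"
    using fac_funpow[OF assms(1)] assms(2) by simp
  also have "\<dots> = cs ! ((j + k) mod length cs)"
    unfolding cyclic_rotation[OF fac_cycle[OF assms(1)]] using assms(2) by (simp add: nth_rotate add.commute)
  finally show ?thesis .
qed

lemma fac_period:
  assumes "cs \<in> set css" "x \<in> set cs"
  shows "(g ^^ k) x = x \<longleftrightarrow> length cs dvd k"
proof -
  obtain j where j: "j < length cs" "x = cs ! j" using assms(2) by (metis in_set_conv_nth)
  have "(j + k) mod length cs < length cs" using j(1) by (intro mod_less_divisor) auto
  then have "(g ^^ k) x = x \<longleftrightarrow> (j + k) mod length cs = j"
    unfolding j(2) fac_funpow_nth[OF assms(1) j(1)]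
    using fac_cycle[OF assms(1)] j(1) by (subst nth_eq_iff_index_eq) auto
  also have "\<dots> \<longleftrightarrow> (j + k) mod length cs = (j + 0) mod length cs" using j(1) by simp
  also have "\<dots> \<longleftrightarrow> length cs dvd k"
    using mod_eq_dvd_iff_nat[of j "j + k" "length cs"] by (auto simp: eq_commute)
  finally show ?thesis .
qed

lemma fac_permutes: "g permutes {1..n}"
proof -
  have "permutation (prod_cycles ds)" for ds :: "nat list list"
    by (induction ds) (simp_all only: prod_cycles_Nil prod_cycles_Cons permutation_id
        permutation_compose permutation_of_cycle)
  then have "bij g" unfolding fac_prod using permutation_bijective by blast
  then show ?thesis
    using prod_cycles_outside[of _ css] unfolding fac_prod[symmetric] fac_set permutes_def by (metis bij_iff)
qed

lemma fac_permutation: "permutation g"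
  using fac_permutes permutation_permutes by blast

lemma fac_spin_comm_cycle:
  assumes "evenperm g" "cs \<in> set css"
  shows "spin_comm (cycle_of_list cs) g (of_int (sign (cycle_of_list cs)))"
  using fac_permutation assms(1) cycle_permutes by (rule spin_comm_own_cycle) (use assms(2) fac_on_cycle in auto)

lemma fac_cycle_commutes:
  assumes "cs \<in> set css"
  shows "cycle_of_list cs \<circ> g = g \<circ> cycle_of_list cs"
proof
  fix x
  show "(cycle_of_list cs \<circ> g) x = (g \<circ> cycle_of_list cs) x"
  proof (cases "x \<in> set cs")
    case True
    then show ?thesis
      using fac_on_cycle[OF assms] permutes_in_image[OF cycle_permutes, of cs] by simp
  next
    case False
    have "g x \<notin> set cs"
    proof
      assume gx: "g x \<in> set cs"
      have "x \<in> {1..n}"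
        using fac_subset[OF assms] gx permutes_in_image[OF fac_permutes, of x] by auto
      then obtain ds where ds: "ds \<in> set css" "x \<in> set ds" by (rule fac_obtain_cycle)
      then have "g x \<in> set ds" by (rule fac_image)
      then have "ds = cs" using fac_disjoint[OF ds(1) assms] gx by blast
      then show False using False ds by simp
    qed
    then show ?thesis using False by (simp add: id_outside_supp)
  qed
qed

lemma commuting_funpow: "h \<circ> g = g \<circ> h \<Longrightarrow> h ((g ^^ k) x) = (g ^^ k) (h x)"
  by (induction k) (auto simp: fun_eq_iff)

text \<open>A commuting permutation preserves the period of every point, and the periods are the lengths of
  the cycles.\<close>

lemma fac_commuting_preserves_cycle:
  assumes lens: "distinct (map length css)" and h: "h permutes {1..n}" "h \<circ> g = g \<circ> h"
    and cs: "cs \<in> set css" "x \<in> set cs"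
  shows "h x \<in> set cs"
proof -
  have "h x \<in> {1..n}" using permutes_in_image[OF h(1)] cs fac_subset by blast
  then obtain ds where ds: "ds \<in> set css" "h x \<in> set ds" by (rule fac_obtain_cycle)
  have "length ds dvd k \<longleftrightarrow> length cs dvd k" for k
    using fac_period[OF ds, of k] fac_period[OF cs, of k] commuting_funpow[OF h(2), of k x]
      permutes_inj[OF h(1)] by (metis injD)
  then have "length ds = length cs" by (meson dvd_antisym dvd_refl)
  then have "ds = cs" using lens ds cs by (metis distinct_map inj_onD)
  then show ?thesis using ds by simp
qed

text \<open>Dividing \<open>h\<close> by a suitable power of a cycle makes it fix one point of that cycle, hence, as it
  commutes with \<open>g\<close>, the whole cycle. The list \<open>xs\<close> contains the cycles that remain to be treated.\<close>

lemma fac_spin_comm_distinct_lengths_aux: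
  assumes lens: "distinct (map length css)" and ev: "evenperm g"
  shows "set xs \<subseteq> set css \<Longrightarrow> h permutes {1..n} \<Longrightarrow> h \<circ> g = g \<circ> h \<Longrightarrow>
    (\<And>x. x \<notin> set (concat xs) \<Longrightarrow> h x = x) \<Longrightarrow> spin_comm h g (of_int (sign h))"
proof (induction xs arbitrary: h)
  case Nil
  then have "h = id" by (simp add: fun_eq_iff)
  then show ?case using spin_comm_id_left sign_id by (metis of_int_1)
next
  case (Cons c xs)
  have c: "c \<in> set css" using Cons.prems(1) by simp
  have c0: "0 < length c" using fac_nonempty[OF c] by simp
  let ?c = "cycle_of_list c"
  have "h (c ! 0) \<in> set c"
    using fac_commuting_preserves_cycle[OF lens Cons.prems(2,3) c nth_mem[OF c0]] .
  then obtain k where k: "k < length c" "h (c ! 0) = c ! k" by (metis in_set_conv_nth)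
  have pc: "permutation (?c ^^ k)" by (intro permutation_funpow permutation_of_cycle)
  have ck: "?c ^^ k permutes set c" by (intro permutes_funpow cycle_permutes)
  have ckn: "?c ^^ k permutes {1..n}" using ck fac_subset[OF c] by (rule permutes_subset)
  have comm: "?c ^^ k \<circ> g = g \<circ> ?c ^^ k"
  proof (induction k)
    case (Suc k)
    then show ?case using fac_cycle_commutes[OF c] by (metis comp_assoc funpow.simps(2))
  qed simp
  define h' where "h' = inv' (?c ^^ k) \<circ> h"
  have hh': "h = ?c ^^ k \<circ> h'"
    unfolding h'_def using permutes_inv_o(1)[OF ck] by (metis comp_assoc id_comp)
  have h'n: "h' permutes {1..n}"
    unfolding h'_def using Cons.prems(2) ckn by (intro permutes_compose permutes_inv)
  have "?c ^^ k \<circ> (h' \<circ> g) = ?c ^^ k \<circ> (g \<circ> h')"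
    using Cons.prems(3) comm unfolding hh' by (metis comp_assoc)
  then have h'g: "h' \<circ> g = g \<circ> h'"
    using permutes_inv_o(2)[OF ck] by (metis comp_assoc id_comp)
  have "(?c ^^ k) (c ! 0) = h (c ! 0)"
    using fac_funpow[OF c, of "c ! 0" k] fac_funpow_nth[OF c c0, of k] k c0 by simp
  then have h'0: "h' (c ! 0) = c ! 0"
    unfolding h'_def using permutes_inverses(2)[OF ck] by (metis comp_apply)
  have "h' y = y" if y: "y \<in> set c" for y
  proof -
    obtain m where m: "m < length c" "y = c ! m" using y by (metis in_set_conv_nth)
    then have "y = (g ^^ m) (c ! 0)" using fac_funpow_nth[OF c c0, of m] by simp
    then show ?thesis using commuting_funpow[OF h'g, of m "c ! 0"] h'0 by simp
  qed
  moreover have "h' y = y" if "y \<notin> set c" "y \<notin> set (concat xs)" for y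
  proof -
    have "h y = y" using that Cons.prems(4) by simp
    then show ?thesis unfolding h'_def using permutes_not_in[OF permutes_inv[OF ck] that(1)] by simp
  qed
  ultimately have "h' y = y" if "y \<notin> set (concat xs)" for y using that by blast
  then have "spin_comm h' g (of_int (sign h'))"
    using Cons.prems(1) h'n h'g by (intro Cons.IH) auto
  moreover have "spin_comm (?c ^^ k) g (of_int (sign (?c ^^ k)))"
    using fac_spin_comm_cycle[OF ev c] by (intro spin_comm_sign_funpow permutation_of_cycle fac_permutation)
  moreover have "permutation h'" using h'n permutation_permutes by blast
  ultimately show ?case unfolding hh' using pc fac_permutation by (intro spin_comm_sign_compose)
qed

lemma fac_spin_comm_distinct_lengths:
  assumes "distinct (map length css)" "evenperm g" "h permutes {1..n}" "h \<circ> g = g \<circ> h"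
  shows "spin_comm h g (of_int (sign h))"
proof (rule fac_spin_comm_distinct_lengths_aux[OF assms(1,2) order_refl assms(3,4)])
  fix x assume "x \<notin> set (concat css)"
  then show "h x = x" using assms(3) fac_set permutes_not_in by metis
qed

text \<open>The product of the lengths is an odd exponent that annihilates \<open>g\<close>, and the sign is multiplicative
  in \<open>g\<close>.\<close>

lemma fac_spin_comm_odd_order:
  assumes odd_cycles: "\<forall>cs\<in>set css. odd (length cs)" and h: "permutation h"
    and comm: "spin_comm g h \<epsilon>" "\<epsilon> = 1 \<or> \<epsilon> = -1"
  shows "\<epsilon> = 1"
proof -
  let ?N = "prod_list (map length css)"
  have oddN: "odd (prod_list (map length ds))" if "\<forall>cs\<in>set ds. odd (length cs)" for ds :: "nat list list"
    using that by (induction ds) auto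
  have dvdN: "length cs dvd prod_list (map length ds)" if "cs \<in> set ds" for cs :: "nat list" and ds
    using that by (induction ds) (auto intro: dvd_mult2 dvd_mult)
  have "g ^^ ?N = id"
  proof
    fix x
    show "(g ^^ ?N) x = id x"
    proof (cases "x \<in> {1..n}")
      case True
      then obtain cs where "cs \<in> set css" "x \<in> set cs" by (rule fac_obtain_cycle)
      then show ?thesis using fac_period dvdN by simp
    next
      case False
      then show ?thesis using permutes_not_in[OF permutes_funpow[OF fac_permutes]] by simp
    qed
  qed
  moreover have "spin_comm (g ^^ k) h (\<epsilon> ^ k)" for k
  proof (induction k)
    case 0
    show ?case unfolding funpow.simps(1) power_0 by (rule spin_comm_id_left)
  next
    case (Suc k)
    then show ?case
      unfolding funpow.simps(2) power_Suc
      by (intro spin_comm_mult_left comm(1) permutation_funpow fac_permutation h)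
  qed
  ultimately have "spin_comm id h (\<epsilon> ^ ?N)" by metis
  then have "\<epsilon> ^ ?N = 1" using spin_comm_id_left[of h] permutation_id h by (rule spin_comm_unique)
  then show ?thesis using comm(2) oddN[OF odd_cycles] by auto
qed

text \<open>Exchanging two cycles of equal length yields the sign of one of them as commutator, while the
  exchange itself has the opposite sign. So if the exchange is even, the lifts anticommute. If it is odd, they
  commute, and a cycle of even length corrects the parity and supplies the sign.\<close>

lemma fac_spin_anticommuting:
  assumes ev: "evenperm g" and even_cycle: "ds \<in> set css" "even (length ds)"
    and same: "\<not> distinct (map length css)"
  shows "\<exists>h. h permutes {1..n} \<and> evenperm h \<and> h \<circ> g = g \<circ> h \<and> spin_comm h g (-1)"
proof -
  have "\<exists>A B. A \<in> set css \<and> B \<in> set css \<and> set A \<inter> set B = {} \<and> length A = length B"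
  proof -
    obtain i j where ij: "i < length css" "j < length css" "i \<noteq> j" "length (css ! i) = length (css ! j)"
      using same by (auto simp: distinct_conv_nth)
    have "set (css ! i) \<inter> set (css ! j) = {}"
    proof (rule ccontr)
      assume "set (css ! i) \<inter> set (css ! j) \<noteq> {}"
      then have "css ! i = css ! j" using ij fac_disjoint[of "css ! i" "css ! j"] by auto
      moreover have "distinct css"
        using fac_distinct fac_nonempty by (simp add: distinct_concat_iff) (metis removeAll_id)
      ultimately show False using ij by (simp add: nth_eq_iff_index_eq)
    qed
    then show ?thesis using ij nth_mem by blast
  qed
  then obtain A B where AB: "A \<in> set css" "B \<in> set css" "set A \<inter> set B = {}" "length A = length B" by blast
  let ?cA = "cycle_of_list A" and ?cB = "cycle_of_list B"
  have dA: "distinct A" "A \<noteq> []" and dB: "distinct B" "B \<noteq> []" using AB fac_cycle fac_nonempty by auto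
  \<comment> \<open>The involution that exchanges the two cycles entry by entry.\<close>
  define s where "s = apply_transps (zip A B)"
  have swap_gen: "distinct A \<Longrightarrow> distinct B \<Longrightarrow> length A = length B \<Longrightarrow> set A \<inter> set B = {} \<Longrightarrow>
     map (apply_transps (zip A B)) A = B \<and> map (apply_transps (zip A B)) B = A \<and>
     (\<forall>x. x \<notin> set A \<union> set B \<longrightarrow> apply_transps (zip A B) x = x)" for A B :: "nat list"
  proof (induction A arbitrary: B)
    case (Cons a A)
    then obtain b B' where B: "B = b # B'" by (cases B) auto
    let ?t = "apply_transps (zip A B')"
    have IH: "map ?t A = B'" "map ?t B' = A" "\<And>x. x \<notin> set A \<union> set B' \<Longrightarrow> ?t x = x"
      using Cons.IH[of B'] Cons.prems by (auto simp: B)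
    have "?t a = a" "?t b = b" using Cons.prems by (intro IH(3); auto simp: B)+
    moreover have "map (transpose a b \<circ> ?t) A = map (transpose a b) B'"
      using IH(1) by (metis map_map)
    moreover have "map (transpose a b \<circ> ?t) B' = map (transpose a b) A"
      using IH(2) by (metis map_map)
    moreover have "map (transpose a b) A = A" "map (transpose a b) B' = B'"
      using Cons.prems by (auto intro!: map_idI simp: B transpose_eq_iff)
    moreover have "(transpose a b \<circ> ?t) x = x" if "x \<notin> set (a # A) \<union> set B" for x
      using that IH(3)[of x] by (auto simp: B)
    ultimately show ?case by (simp add: B comp_def)
  qed auto
  have s_map: "map s A = B" "map s B = A" and s_out: "\<And>x. x \<notin> set A \<union> set B \<Longrightarrow> s x = x"
    unfolding s_def using swap_gen[OF dA(1) dB(1) AB(4,3)] by blast+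
  have s_perm: "s permutes set A \<union> set B"
    unfolding s_def by (rule permutes_apply_transps) (auto dest: set_zip_leftD set_zip_rightD)
  have ps: "permutation s" unfolding s_def by simp
  have ss: "s \<circ> s = id"
  proof
    fix x
    have "map (s \<circ> s) A = A" "map (s \<circ> s) B = B" using s_map by (metis map_map)+
    then have "x \<in> set A \<union> set B \<Longrightarrow> (s \<circ> s) x = x" by (metis Un_iff map_idI map_eq_conv list.map_ident)
    moreover have "x \<notin> set A \<union> set B \<Longrightarrow> (s \<circ> s) x = x" using s_out by simp
    ultimately show "(s \<circ> s) x = id x" by fastforce
  qed
  have inv_s: "inv' s = s" using ss by (simp add: inv_unique_comp)
  have ev_s: "evenperm s \<longleftrightarrow> even (length A)"
  proof -
    have "\<forall>(a, b)\<in>set (zip A B). a \<noteq> b" using AB(3) by (auto dest: set_zip_leftD set_zip_rightD)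
    then show ?thesis unfolding s_def using AB(4) by (simp add: evenperm_apply_transps_iff)
  qed
  have cB: "?cB = s \<circ> ?cA \<circ> s"
    using conjugation_of_cycle[OF dA(1), of s] permutation_bijective[OF ps] s_map inv_s by simp
  have sA: "sign ?cA = (if odd (length A) then 1 else -1)" and sB: "sign ?cB = sign ?cA"
    using evenperm_cycle_of_list[OF dA] evenperm_cycle_of_list[OF dB] AB(4) by (simp_all add: sign_def)
  have "?cB x = x" if "x \<in> set A" for x using that AB(3) by (intro id_outside_supp) auto
  then have "spin_comm ?cB ?cA (if evenperm ?cA then 1 else of_int (sign ?cB))"
    by (intro spin_comm_disjoint[OF permutation_of_cycle cycle_permutes finite_set])
  also have "(if evenperm ?cA then 1 else of_int (sign ?cB)) = (of_int (sign ?cA) :: real)"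
    using sB by (simp add: sign_def)
  finally have "spin_comm ?cB ?cA (of_int (sign ?cA))" .
  then have sAB: "spin_comm s (?cA \<circ> ?cB) (of_int (sign ?cA))"
    by (intro spin_comm_swapped_pair[OF ps ss permutation_of_cycle cB])
  have AB_perm: "?cA \<circ> ?cB permutes set A \<union> set B"
    by (intro permutes_compose) (auto intro: permutes_subset cycle_permutes)
  have pAB: "permutation (?cA \<circ> ?cB)" by (intro permutation_compose permutation_of_cycle)
  define k where "k = inv' (?cA \<circ> ?cB) \<circ> g"
  have gk: "g = (?cA \<circ> ?cB) \<circ> k"
    unfolding k_def using permutes_inv_o(1)[OF AB_perm] by (metis comp_assoc id_comp)
  have pk: "permutation k"
    unfolding k_def by (rule permutation_compose[OF permutation_inverse[OF pAB] fac_permutation])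
  have k_fix: "k x = x" if x: "x \<in> set A \<union> set B" for x
  proof -
    have "g x = (?cA \<circ> ?cB) x"
    proof (cases "x \<in> set A")
      case True
      then show ?thesis using AB fac_on_cycle by (auto simp: id_outside_supp disjoint_iff)
    next
      case False
      then have xB: "x \<in> set B" using x by simp
      then have "?cB x \<in> set B" using permutes_in_image[OF cycle_permutes] by metis
      then have "?cB x \<notin> set A" using AB(3) by blast
      then show ?thesis using fac_on_cycle[OF AB(2) xB] by (simp add: id_outside_supp)
    qed
    then show ?thesis unfolding k_def using permutes_inverses(2)[OF AB_perm] by simp
  qed
  have "sign g = sign (?cA \<circ> ?cB) * sign k" using sign_compose[OF pAB pk] gk by metis
  also have "sign (?cA \<circ> ?cB) = sign ?cA * sign ?cA"
    using sign_compose[OF permutation_of_cycle permutation_of_cycle, of A B] sB by simp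
  also have "\<dots> = 1" by (rule sign_idempotent)
  finally have sk: "sign k = 1" using ev by (simp add: sign_def[of g])
  have "spin_comm k s (if evenperm s then 1 else of_int (sign k))"
    using k_fix by (intro spin_comm_disjoint[OF pk s_perm]) auto
  then have "spin_comm k s 1" by (simp only: sk of_int_1 if_cancel)
  then have "spin_comm s k 1" by (rule spin_comm_sym) simp
  then have sg: "spin_comm s g (of_int (sign ?cA))"
    using spin_comm_mult_right[OF sAB _ pAB pk ps, of 1] unfolding gk[symmetric] by (simp only: mult_1_right)
  have sn: "s permutes {1..n}"
    using s_perm AB fac_subset by (intro permutes_subset[OF s_perm]) auto
  have scomm: "s \<circ> g = g \<circ> s"
  proof -
    have ks: "k \<circ> s = s \<circ> k"
      by (rule disjoint_permutations_commute[OF bij_is_inj[OF permutation_bijective[OF pk]] k_fix s_perm])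
    have BA: "?cA \<circ> ?cB = ?cB \<circ> ?cA" using dA dB AB(3) by (intro cycles_commute) auto
    have "s \<circ> ?cA = ?cB \<circ> s" unfolding cB using ss by (metis comp_assoc comp_id)
    moreover have "s \<circ> ?cB = ?cA \<circ> s" unfolding cB using ss by (metis comp_assoc id_comp)
    ultimately have "s \<circ> (?cA \<circ> ?cB) = (?cA \<circ> ?cB) \<circ> s" using BA by (metis comp_assoc)
    then show ?thesis using ks unfolding gk by (metis comp_assoc)
  qed
  show ?thesis
  proof (cases "even (length A)")
    case True
    then show ?thesis using sn ev_s scomm sg sA by (intro exI[of _ s]) auto
  next
    case False
    let ?c = "cycle_of_list ds"
    have c_odd: "\<not> evenperm ?c"
      using evenperm_cycle_of_list[OF fac_cycle fac_nonempty] even_cycle by blast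
    have cg: "spin_comm ?c g (-1)"
      using fac_spin_comm_cycle[OF ev even_cycle(1)] c_odd by (simp add: sign_def)
    have "spin_comm (?c \<circ> s) g (-1 * of_int (sign ?cA))"
      using cg sg permutation_of_cycle ps fac_permutation by (rule spin_comm_mult_left)
    then have "spin_comm (?c \<circ> s) g (-1)" using sA False by simp
    moreover have "evenperm (?c \<circ> s)"
      using c_odd ev_s False evenperm_comp[OF permutation_of_cycle ps] by simp
    moreover have "?c \<circ> s permutes {1..n}"
      using sn permutes_subset[OF cycle_permutes fac_subset[OF even_cycle(1)]] by (rule permutes_compose)
    moreover have "(?c \<circ> s) \<circ> g = g \<circ> (?c \<circ> s)"
      using scomm fac_cycle_commutes[OF even_cycle(1)] by (metis comp_assoc)
    ultimately show ?thesis by blast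
  qed
qed

end

section \<open>Splitting in the spin cover\<close>

abbreviation commutator :: "('a, 'b) monoid_scheme \<Rightarrow> 'a \<Rightarrow> 'a \<Rightarrow> 'a" where
  "commutator H x y \<equiv> x \<otimes>\<^bsub>H\<^esub> y \<otimes>\<^bsub>H\<^esub> inv\<^bsub>H\<^esub> x \<otimes>\<^bsub>H\<^esub> inv\<^bsub>H\<^esub> y"

lemma (in alt_central_extension) \<pi>_commutator:
  assumes x: "x \<in> carrier F" and y: "y \<in> carrier F" and comm: "\<pi> x \<circ> \<pi> y = \<pi> y \<circ> \<pi> x"
  shows "\<pi> (commutator F x y) = id"
proof -
  have "\<pi> (commutator F x y) = (\<pi> x \<circ> \<pi> y) \<circ> inv' (\<pi> x) \<circ> inv' (\<pi> y)"
    using x y by (simp add: \<pi>_mult \<pi>_inv)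
  also have "\<dots> = \<pi> y \<circ> (\<pi> x \<circ> inv' (\<pi> x)) \<circ> inv' (\<pi> y)" unfolding comm by (simp only: comp_assoc)
  also have "\<dots> = id" unfolding alt_inv_comp(2)[OF \<pi>_alt[OF x]] comp_id by (rule alt_inv_comp(2)[OF \<pi>_alt[OF y]])
  finally show ?thesis .
qed

text \<open>The spin cover restricted to the alternating group of degree \<open>d\<close>.\<close>

definition spin_group :: "nat \<Rightarrow> ((nat \<Rightarrow> nat) \<times> (spinor \<Rightarrow> spinor)) monoid" where
  "spin_group d = \<lparr>carrier = {(p, u). p \<in> carrier (alt_group d) \<and> spin_lift p u},
     mult = (\<lambda>(p, u) (q, v). (p \<circ> q, u \<circ> v)), one = (id, id)\<rparr>"

lemma spin_group_simps:
  "(p, u) \<in> carrier (spin_group d) \<longleftrightarrow> p \<in> carrier (alt_group d) \<and> spin_lift p u"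
  "(p, u) \<otimes>\<^bsub>spin_group d\<^esub> (q, v) = (p \<circ> q, u \<circ> v)"
  "\<one>\<^bsub>spin_group d\<^esub> = (id, id)"
  by (simp_all add: spin_group_def)

lemma spin_group_is_group: "group (spin_group d)"
proof (rule groupI)
  show "\<one>\<^bsub>spin_group d\<^esub> \<in> carrier (spin_group d)"
    unfolding spin_group_simps by (intro conjI alt_id spin_lift_id)
  fix x y z assume x: "x \<in> carrier (spin_group d)" and y: "y \<in> carrier (spin_group d)" and z: "z \<in> carrier (spin_group d)"
  obtain p u where pu: "x = (p, u)" by (cases x)
  obtain q v where qv: "y = (q, v)" by (cases y)
  obtain r w where rw: "z = (r, w)" by (cases z)
  show "x \<otimes>\<^bsub>spin_group d\<^esub> y \<in> carrier (spin_group d)"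
    using x y unfolding pu qv spin_group_simps by (intro conjI alt_comp spin_lift_mult) auto
  show "x \<otimes>\<^bsub>spin_group d\<^esub> y \<otimes>\<^bsub>spin_group d\<^esub> z = x \<otimes>\<^bsub>spin_group d\<^esub> (y \<otimes>\<^bsub>spin_group d\<^esub> z)"
    unfolding pu qv rw spin_group_simps by (simp only: comp_assoc)
next
  fix x assume x: "x \<in> carrier (spin_group d)"
  obtain p u where pu: "x = (p, u)" by (cases x)
  show "\<one>\<^bsub>spin_group d\<^esub> \<otimes>\<^bsub>spin_group d\<^esub> x = x"
    unfolding pu spin_group_simps by (simp only: id_comp)
  have p: "p \<in> carrier (alt_group d)" and u: "spin_lift p u" using x unfolding pu spin_group_simps by auto
  obtain v where v: "spin_lift (inv' p) v" "v \<circ> u = id" using spin_lift_inverse[OF u] by blast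
  have "(inv' p, v) \<in> carrier (spin_group d)"
    unfolding spin_group_simps using v(1) alt_group_inv_closed[OF p] by blast
  moreover have "(inv' p, v) \<otimes>\<^bsub>spin_group d\<^esub> x = \<one>\<^bsub>spin_group d\<^esub>"
    unfolding pu spin_group_simps using v(2) alt_inv_comp(1)[OF p] by simp
  ultimately show "\<exists>y\<in>carrier (spin_group d). y \<otimes>\<^bsub>spin_group d\<^esub> x = \<one>\<^bsub>spin_group d\<^esub>" by blast
qed

lemma spin_group_extension: "alt_central_extension (spin_group d) d fst"
proof (intro alt_central_extension.intro spin_group_is_group alt_central_extension_axioms.intro)
  fix x y assume x: "x \<in> carrier (spin_group d)" and y: "y \<in> carrier (spin_group d)"
  obtain p u where pu: "x = (p, u)" by (cases x)
  obtain q v where qv: "y = (q, v)" by (cases y)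
  show "fst (x \<otimes>\<^bsub>spin_group d\<^esub> y) = fst x \<circ> fst y" unfolding pu qv spin_group_simps by simp
next
  fix x assume x: "x \<in> carrier (spin_group d)"
  then show "fst x \<in> carrier (alt_group d)" by (cases x) (simp only: spin_group_simps fst_conv)
next
  fix p assume p: "p \<in> carrier (alt_group d)"
  obtain u where "spin_lift p u" using spin_lift_exists[OF alt_group_carrier'[OF p]] by blast
  then have "(p, u) \<in> carrier (spin_group d)" unfolding spin_group_simps using p by blast
  then show "\<exists>x\<in>carrier (spin_group d). fst x = p" by force
next
  fix k x assume k: "k \<in> carrier (spin_group d)" "fst k = id" and x: "x \<in> carrier (spin_group d)"
  obtain l where l: "k = (id, l)" using k(2) by (cases k) simp
  obtain q v where qv: "x = (q, v)" by (cases x)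
  have "spin_lift id l" "spin_lift q v" using k(1) x unfolding l qv spin_group_simps by auto
  then have "l \<circ> v = v \<circ> l" by (rule spin_lift_id_central)
  then show "k \<otimes>\<^bsub>spin_group d\<^esub> x = x \<otimes>\<^bsub>spin_group d\<^esub> k"
    unfolding l qv spin_group_simps by (simp only: id_comp comp_id)
qed

lemma (in group) commutator_eq:
  assumes "x \<in> carrier G" "y \<in> carrier G"
  shows "x \<otimes> y \<otimes> inv x \<otimes> inv y \<otimes> (y \<otimes> x) = x \<otimes> y"
  using assms by (simp add: m_assoc)

lemma commutator_derived:
  "x \<in> carrier H \<Longrightarrow> y \<in> carrier H \<Longrightarrow> commutator H x y \<in> derived H (carrier H)"
  unfolding derived_def by (rule generate.incl) blast

lemma spin_group_commutator:
  assumes x: "(p, u) \<in> carrier (spin_group d)" and y: "(q, v) \<in> carrier (spin_group d)"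
  shows "spin_comm p q \<epsilon> \<longleftrightarrow> snd (commutator (spin_group d) (p, u) (q, v)) = (\<lambda>w s. \<epsilon> * w s)"
proof -
  interpret S: group "spin_group d" by (rule spin_group_is_group)
  obtain r c where rc: "commutator (spin_group d) (p, u) (q, v) = (r, c)" by fastforce
  have lifts: "spin_lift p u" "spin_lift q v" using x y unfolding spin_group_simps by auto
  have "(r, c) \<otimes>\<^bsub>spin_group d\<^esub> ((q, v) \<otimes>\<^bsub>spin_group d\<^esub> (p, u)) = (p, u) \<otimes>\<^bsub>spin_group d\<^esub> (q, v)"
    using S.commutator_eq[OF x y] rc by simp
  then have cvu: "c (v (u w)) = u (v w)" for w unfolding spin_group_simps by (auto simp: fun_eq_iff)
  obtain u' where u': "u \<circ> u' = id" using spin_lift_inverse[OF lifts(1)] by blast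
  obtain v' where v': "v \<circ> v' = id" using spin_lift_inverse[OF lifts(2)] by blast
  have surj: "v (u (u' (v' w))) = w" for w using u' v' by (metis comp_apply id_apply)
  show ?thesis
  proof
    assume "spin_comm p q \<epsilon>"
    then have "c (v (u w)) = (\<lambda>s. \<epsilon> * v (u w) s)" for w
      using spin_commD[OF _ lifts] cvu by metis
    then have "c w = (\<lambda>s. \<epsilon> * w s)" for w using surj by metis
    then show "snd (commutator (spin_group d) (p, u) (q, v)) = (\<lambda>w s. \<epsilon> * w s)"
      unfolding rc by (simp add: fun_eq_iff)
  next
    assume "snd (commutator (spin_group d) (p, u) (q, v)) = (\<lambda>w s. \<epsilon> * w s)"
    then have "c = (\<lambda>w s. \<epsilon> * w s)" unfolding rc by simp
    then show "spin_comm p q \<epsilon>" using cvu by (intro spin_commI[OF lifts]) metis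
  qed
qed

lemma spin_scale_minus_one: "(\<lambda>w s. -1 * w s) \<noteq> (id :: spinor \<Rightarrow> spinor)"
proof
  assume "(\<lambda>w s. -1 * w s) = (id :: spinor \<Rightarrow> spinor)"
  from fun_cong[OF fun_cong[OF this, of "\<lambda>s. 1"], of undefined] show False by simp
qed

text \<open>The involution \<open>v4c\<close> exchanges the two transpositions whose product is \<open>v4a\<close>.\<close>

lemma spin_comm_four_group: "spin_comm v4c v4a (-1)"
proof -
  have "(if evenperm (transpose 1 (2::nat)) then 1 else of_int (sign (transpose 3 (4::nat)))) = (-1 :: real)"
    by (simp add: evenperm_swap sign_swap_id)
  moreover have "spin_comm (transpose 3 4) (transpose 1 2)
      (if evenperm (transpose 1 (2::nat)) then 1 else of_int (sign (transpose 3 (4::nat))))"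
    by (rule spin_comm_disjoint[of _ _ "{1, 2}"])
      (auto intro: permutation_swap_id permutes_swap_id)
  ultimately have perm: "spin_comm (transpose 3 4) (transpose 1 2) (-1)" by simp
  have c: "v4c \<in> carrier (alt_group 4)" using v4_alt(3)[of 4] by simp
  have "v4c \<circ> transpose 1 2 \<circ> inv' v4c = transpose (v4c 1) (v4c 2)"
    using conjugation_of_cycle[of "[1, 2]" v4c] alt_bij[OF c] by simp
  moreover have "inv' v4c = v4c" using v4_relations(9) by (simp add: inv_unique_comp)
  ultimately have conj: "transpose 3 4 = v4c \<circ> transpose 1 2 \<circ> v4c" by (simp only: v4_values)
  show ?thesis
    unfolding v4a_def
    by (rule spin_comm_swapped_pair[OF alt_group_carrier'[OF c] v4_relations(9) permutation_swap_id conj perm])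
qed

text \<open>The derived kernel of the spin cover contains \<open>-1\<close>, by the four-group, and at most one nontrivial
  element. So the commutator above any commuting pair is \<open>1\<close> or \<open>-1\<close>.\<close>

lemma spin_comm_dichotomy:
  assumes d: "d \<ge> 4" "d \<noteq> 6" "d \<noteq> 7"
    and g: "g \<in> carrier (alt_group d)" and h: "h \<in> carrier (alt_group d)" and comm: "g \<circ> h = h \<circ> g"
  shows "spin_comm g h 1 \<or> spin_comm g h (-1)"
proof -
  let ?S = "spin_group d"
  interpret S: alt_central_extension ?S d fst by (rule spin_group_extension)
  obtain z where z: "derived ?S (carrier ?S) \<inter> {x. fst x = id} \<subseteq> {\<one>\<^bsub>?S\<^esub>, z}"
    using S.derived_kernel_le_two[OF d] by blast
  have ker: "commutator ?S x y \<in> {\<one>\<^bsub>?S\<^esub>, z}"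
    if "x \<in> carrier ?S" "y \<in> carrier ?S" "fst x \<circ> fst y = fst y \<circ> fst x" for x y
  proof -
    have "fst (commutator ?S x y) = id" using that by (rule S.\<pi>_commutator)
    then show ?thesis using z commutator_derived[OF that(1,2)] by blast
  qed
  obtain a where a: "(v4c, a) \<in> carrier ?S"
    using S.\<pi>_surj[OF v4_alt(3)[OF d(1)]] by (metis prod.collapse)
  obtain b where b: "(v4a, b) \<in> carrier ?S"
    using S.\<pi>_surj[OF v4_alt(1)[OF d(1)]] by (metis prod.collapse)
  have "commutator ?S (v4c, a) (v4a, b) \<in> {\<one>\<^bsub>?S\<^esub>, z}"
    using a b v4_relations(5,6) by (intro ker) simp_all
  moreover have m: "snd (commutator ?S (v4c, a) (v4a, b)) = (\<lambda>w s. -1 * w s)"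
    using spin_group_commutator[OF a b] spin_comm_four_group by blast
  ultimately have z_minus: "snd z = (\<lambda>w s. -1 * w s)"
    using spin_scale_minus_one unfolding spin_group_simps by (metis insertE singletonD snd_conv)
  obtain u where u: "(g, u) \<in> carrier ?S" using S.\<pi>_surj[OF g] by (metis prod.collapse)
  obtain v where v: "(h, v) \<in> carrier ?S" using S.\<pi>_surj[OF h] by (metis prod.collapse)
  have "commutator ?S (g, u) (h, v) \<in> {\<one>\<^bsub>?S\<^esub>, z}" using u v comm by (intro ker) simp_all
  then consider "commutator ?S (g, u) (h, v) = \<one>\<^bsub>?S\<^esub>" | "commutator ?S (g, u) (h, v) = z" by blast
  then show ?thesis
  proof cases
    case 1
    have "snd \<one>\<^bsub>?S\<^esub> = (\<lambda>w s. 1 * w s)" unfolding spin_group_simps by (simp add: fun_eq_iff)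
    then have "snd (commutator ?S (g, u) (h, v)) = (\<lambda>w s. 1 * w s)" unfolding 1 .
    then show ?thesis by (intro disjI1) (simp only: spin_group_commutator[OF u v])
  next
    case 2
    have "snd (commutator ?S (g, u) (h, v)) = (\<lambda>w s. -1 * w s)" unfolding 2 by (rule z_minus)
    then show ?thesis by (intro disjI2) (simp only: spin_group_commutator[OF u v])
  qed
qed

text \<open>A lift chosen for one representative of each class can be transported to the whole class
  consistently if the centralizer of the representative fixes it.\<close>

lemma (in alt_central_extension) exists_equivariant_lift:
  assumes E: "E \<subseteq> carrier (alt_group d)"
    and closed: "\<And>g a. g \<in> E \<Longrightarrow> a \<in> carrier (alt_group d) \<Longrightarrow> a \<circ> g \<circ> inv' a \<in> E"
    and fixed: "\<And>x h. x \<in> carrier F \<Longrightarrow> \<pi> x \<in> E \<Longrightarrow> h \<in> carrier (alt_group d) \<Longrightarrow>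
      h \<circ> \<pi> x = \<pi> x \<circ> h \<Longrightarrow> act h x = x"
  shows "\<exists>f. \<forall>g\<in>E. f g \<in> carrier F \<and> \<pi> (f g) = g \<and>
    (\<forall>a\<in>carrier (alt_group d). f (a \<circ> g \<circ> inv' a) = act a (f g))"
proof -
  let ?A = "carrier (alt_group d)"
  define C where "C g = {h \<circ> g \<circ> inv' h | h. h \<in> ?A}" for g
  define r where "r K = (SOME x. x \<in> carrier F \<and> \<pi> x \<in> K)" for K
  define f where "f g = act (SOME h. h \<in> ?A \<and> h \<circ> \<pi> (r (C g)) \<circ> inv' h = g) (r (C g))" for g
  have inv_comp: "inv' (p \<circ> q) = inv' q \<circ> inv' p" if "p \<in> ?A" "q \<in> ?A" for p q
    using that alt_bij by (intro o_inv_distrib) auto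
  have same: "act k x = act k' x"
    if x: "x \<in> carrier F" "\<pi> x \<in> E" and k: "k \<in> ?A" "k' \<in> ?A"
      and eq: "k \<circ> \<pi> x \<circ> inv' k = k' \<circ> \<pi> x \<circ> inv' k'" for x k k'
  proof -
    define m where "m = inv' k \<circ> k'"
    have m: "m \<in> ?A" unfolding m_def using k by (intro alt_comp alt_group_inv_closed)
    have km: "k \<circ> m = k'" unfolding m_def by (metis alt_inv_comp(2)[OF k(1)] comp_assoc id_comp)
    have "m \<circ> \<pi> x = inv' k \<circ> (k' \<circ> \<pi> x \<circ> inv' k') \<circ> k'"
      unfolding m_def using alt_inv_comp(1)[OF k(2)] by (simp only: comp_assoc comp_id)
    also have "\<dots> = (inv' k \<circ> k) \<circ> \<pi> x \<circ> m" unfolding eq[symmetric] m_def by (simp only: comp_assoc)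
    also have "\<dots> = \<pi> x \<circ> m" unfolding alt_inv_comp(1)[OF k(1)] by (simp only: id_comp)
    finally have "act m x = x" using x m by (intro fixed)
    then show ?thesis using act_comp[OF k(1) m x(1)] unfolding km by simp
  qed
  have rep: "r (C g) \<in> carrier F \<and> \<pi> (r (C g)) \<in> C g" if g: "g \<in> E" for g
  proof -
    obtain x where x: "x \<in> carrier F" "\<pi> x = g" using \<pi>_surj[OF subsetD[OF E g]] by blast
    have "g = id \<circ> g \<circ> inv' id" by simp
    then have "g \<in> C g" unfolding C_def using alt_id by blast
    then have "\<exists>x. x \<in> carrier F \<and> \<pi> x \<in> C g" using x by blast
    then show ?thesis unfolding r_def by (rule someI_ex)
  qed
  have witness: "\<exists>h. h \<in> ?A \<and> h \<circ> \<pi> (r (C g)) \<circ> inv' h = g" if g: "g \<in> E" for g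
  proof -
    obtain h where h: "h \<in> ?A" "\<pi> (r (C g)) = h \<circ> g \<circ> inv' h" using rep[OF g] unfolding C_def by blast
    have "inv' h \<circ> \<pi> (r (C g)) \<circ> inv' (inv' h) = (inv' h \<circ> h) \<circ> g \<circ> (inv' h \<circ> h)"
      unfolding h(2) inv_inv_eq[OF alt_bij[OF h(1)]] by (simp only: comp_assoc)
    also have "\<dots> = g" unfolding alt_inv_comp(1)[OF h(1)] by simp
    finally show ?thesis using alt_group_inv_closed[OF h(1)] by blast
  qed
  have f_act: "\<exists>h\<in>?A. h \<circ> \<pi> (r (C g)) \<circ> inv' h = g \<and> f g = act h (r (C g))" if "g \<in> E" for g
    using someI_ex[OF witness[OF that]] unfolding f_def by blast
  have rE: "\<pi> (r (C g)) \<in> E" if g: "g \<in> E" for g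
  proof -
    obtain h where h: "h \<in> ?A" "\<pi> (r (C g)) = h \<circ> g \<circ> inv' h" using rep[OF g] unfolding C_def by blast
    show ?thesis unfolding h(2) by (rule closed[OF g h(1)])
  qed
  have C_conj: "C (a \<circ> g \<circ> inv' a) = C g" if a: "a \<in> ?A" for a g
  proof -
    have sub: "C (b \<circ> g' \<circ> inv' b) \<subseteq> C g'" if b: "b \<in> ?A" for b g'
    proof
      fix y assume "y \<in> C (b \<circ> g' \<circ> inv' b)"
      then obtain h where h: "h \<in> ?A" "y = h \<circ> (b \<circ> g' \<circ> inv' b) \<circ> inv' h" unfolding C_def by blast
      have "y = (h \<circ> b) \<circ> g' \<circ> inv' (h \<circ> b)" unfolding inv_comp[OF h(1) b] h(2) by (simp only: comp_assoc)
      then show "y \<in> C g'" unfolding C_def using alt_comp[OF h(1) b] by blast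
    qed
    have "inv' a \<circ> (a \<circ> g \<circ> inv' a) \<circ> inv' (inv' a) = (inv' a \<circ> a) \<circ> g \<circ> (inv' a \<circ> a)"
      unfolding inv_inv_eq[OF alt_bij[OF a]] by (simp only: comp_assoc)
    also have "\<dots> = g" unfolding alt_inv_comp(1)[OF a] by simp
    finally show ?thesis
      using sub[OF a, of g] sub[OF alt_group_inv_closed[OF a], of "a \<circ> g \<circ> inv' a"] by simp
  qed
  show ?thesis
  proof (intro exI[of _ f] ballI conjI)
    fix g assume g: "g \<in> E"
    obtain h where h: "h \<in> ?A" "h \<circ> \<pi> (r (C g)) \<circ> inv' h = g" "f g = act h (r (C g))" using f_act[OF g] by blast
    have rc: "r (C g) \<in> carrier F" using rep[OF g] ..
    show "f g \<in> carrier F" unfolding h(3) using h(1) rc by (rule act_closed)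
    show "\<pi> (f g) = g" unfolding h(3) using h(1,2) rc by (simp only: \<pi>_act)
    fix a assume a: "a \<in> ?A"
    obtain h' where h': "h' \<in> ?A" "h' \<circ> \<pi> (r (C g)) \<circ> inv' h' = a \<circ> g \<circ> inv' a"
      "f (a \<circ> g \<circ> inv' a) = act h' (r (C g))" using f_act[OF closed[OF g a]] unfolding C_conj[OF a] by blast
    have "h' \<circ> \<pi> (r (C g)) \<circ> inv' h' = (a \<circ> h) \<circ> \<pi> (r (C g)) \<circ> inv' (a \<circ> h)"
      unfolding h'(2) inv_comp[OF a h(1)] by (subst h(2)[symmetric]) (simp only: comp_assoc)
    then have "act h' (r (C g)) = act (a \<circ> h) (r (C g))"
      by (intro same rc rE g h'(1) alt_comp a h(1))
    then show "f (a \<circ> g \<circ> inv' a) = act a (f g)"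
      unfolding h'(3) h(3) act_comp[OF a h(1) rc] .
  qed
qed

section \<open>The group of an equipment\<close>

context group
begin

lemma equipment_conj_closed:
  assumes "equipment G E" "x \<in> E" "g \<in> carrier G"
  shows "g \<otimes> x \<otimes> inv g \<in> E"
proof -
  obtain \<C> where \<C>: "\<C> \<subseteq> conj_class G ` carrier G" "E = \<Union>\<C>" using assms(1) unfolding equipment_def by blast
  then obtain y where y: "y \<in> carrier G" "conj_class G y \<in> \<C>" "x \<in> conj_class G y" using assms(2) by blast
  then obtain h where h: "h \<in> carrier G" "x = h \<otimes> y \<otimes> inv h" unfolding conj_class_def by blast
  have "g \<otimes> x \<otimes> inv g = (g \<otimes> h) \<otimes> y \<otimes> inv (g \<otimes> h)"
    using y h assms(3) by (simp add: inv_mult_group m_assoc)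
  then have "g \<otimes> x \<otimes> inv g \<in> conj_class G y" unfolding conj_class_def using h assms(3) by blast
  then show ?thesis using \<C> y by blast
qed

context
  fixes E assumes eq: "equipment G E"
begin

abbreviation "TG \<equiv> tilde_group G E"
abbreviation "tg \<equiv> tilde_gen G E"

lemma tilde_is_group: "group TG"
  unfolding tilde_group_def by (rule group_presented_group)

lemma tilde_gen_closed: "a \<in> E \<Longrightarrow> tg a \<in> carrier TG"
  unfolding tilde_gen_def tilde_group_def by (rule presented_group_carrierI) (simp add: words_def)

lemma tilde_gen_inv:
  assumes "a \<in> E"
  shows "inv\<^bsub>TG\<^esub> (tg a) = pres_rel E (equipment_relations G E) `` {[(False, a)]}"
proof -
  interpret T: group TG by (rule tilde_is_group)
  let ?R = "equipment_relations G E"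
  have w: "[(False, a)] \<in> words E" "[(True, a)] \<in> words E" "[] \<in> words E" using assms by (auto simp: words_def)
  have "pres_eq E ?R [(False, a), (\<not> False, a)] []" using assms by (rule pres_eq.cancel)
  then have "pres_rel E ?R `` {[(False, a)] @ [(True, a)]} = pres_rel E ?R `` {[]}"
    using pres_class_eq_iff[of "[(False, a)] @ [(True, a)]" E "[]" ?R] w by (simp add: words_append[of "[_]" "[_]", simplified])
  then have "pres_rel E ?R `` {[(False, a)]} \<otimes>\<^bsub>TG\<^esub> tg a = \<one>\<^bsub>TG\<^esub>"
    unfolding tilde_gen_def tilde_group_def presented_group_mult[OF w(1,2)] by (simp add: presented_group_def)
  then show ?thesis
    using T.inv_equality tilde_gen_closed[OF assms] presented_group_carrierI[OF w(1)] unfolding tilde_group_def by metis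
qed

text \<open>Every element is represented by a word, that is, by a product of letters and their inverses.\<close>

lemma tilde_induct [consumes 1, case_names one gen inv]:
  assumes X: "X \<in> carrier TG" and one: "P \<one>\<^bsub>TG\<^esub>"
    and gen: "\<And>a Y. a \<in> E \<Longrightarrow> Y \<in> carrier TG \<Longrightarrow> P Y \<Longrightarrow> P (tg a \<otimes>\<^bsub>TG\<^esub> Y)"
    and inv: "\<And>a Y. a \<in> E \<Longrightarrow> Y \<in> carrier TG \<Longrightarrow> P Y \<Longrightarrow> P (inv\<^bsub>TG\<^esub> (tg a) \<otimes>\<^bsub>TG\<^esub> Y)"
  shows "P X"
proof -
  let ?R = "equipment_relations G E"
  obtain u where u: "u \<in> words E" "X = pres_rel E ?R `` {u}"
    using X unfolding tilde_group_def by (rule presented_group_carrierE)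
  from u(1) have "P (pres_rel E ?R `` {u})"
  proof (induction u)
    case Nil
    then show ?case using one unfolding tilde_group_def by (simp add: presented_group_def)
  next
    case (Cons x u)
    obtain b a where x: "x = (b, a)" by force
    have w: "[(b, a)] \<in> words E" "u \<in> words E" and a: "a \<in> E" using Cons.prems by (auto simp: words_def x)
    have split: "pres_rel E ?R `` {x # u} = pres_rel E ?R `` {[(b, a)]} \<otimes>\<^bsub>TG\<^esub> pres_rel E ?R `` {u}"
      unfolding tilde_group_def presented_group_mult[OF w] x by simp
    have c: "pres_rel E ?R `` {u} \<in> carrier TG"
      unfolding tilde_group_def using w(2) by (rule presented_group_carrierI)
    show ?case
    proof (cases b)
      case True
      then show ?thesis unfolding split using gen[OF a c Cons.IH[OF w(2)]] unfolding tilde_gen_def by simp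
    next
      case False
      then show ?thesis unfolding split using inv[OF a c Cons.IH[OF w(2)]] unfolding tilde_gen_inv[OF a] by simp
    qed
  qed
  then show ?thesis using u(2) by simp
qed

lemma tilde_gen_relation:
  assumes "a \<in> E" "g \<in> E"
  shows "tg a \<otimes>\<^bsub>TG\<^esub> tg g = tg (a \<otimes> g \<otimes> inv a) \<otimes>\<^bsub>TG\<^esub> tg a"
proof -
  let ?R = "equipment_relations G E"
  have ag: "a \<otimes> g \<otimes> inv a \<in> E"
    using equipment_conj_closed[OF eq assms(2)] equipment_subset[OF eq] assms(1) by blast
  have w: "[(True, x)] \<in> words E" if "x \<in> E" for x using that by (simp add: words_def)
  have w2: "[(True, x)] @ [(True, y)] \<in> words E" if "x \<in> E" "y \<in> E" for x y using that by (simp add: words_def)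
  have "pres_eq E ?R ([(True, a)] @ [(True, g)]) ([(True, a \<otimes> g \<otimes> inv a)] @ [(True, a)])"
    using assms w2 ag by (intro pres_eq.rel) (auto simp: equipment_relations_def words_def)
  then have "pres_rel E ?R `` {[(True, a)] @ [(True, g)]} = pres_rel E ?R `` {[(True, a \<otimes> g \<otimes> inv a)] @ [(True, a)]}"
    using pres_class_eq_iff w2 assms ag by metis
  then show ?thesis
    unfolding tilde_gen_def tilde_group_def using presented_group_mult[OF w w] assms ag by metis
qed

lemma tilde_map_mult: "X \<in> carrier TG \<Longrightarrow> Y \<in> carrier TG \<Longrightarrow> tilde_map G (X \<otimes>\<^bsub>TG\<^esub> Y) = tilde_map G X \<otimes> tilde_map G Y"
  using tilde_map_hom[OF eq] by (simp add: hom_def)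

lemma tilde_map_closed: "X \<in> carrier TG \<Longrightarrow> tilde_map G X \<in> carrier G"
  using tilde_map_hom[OF eq] by (auto simp: hom_def)

lemma tilde_map_group_hom: "group_hom TG G (tilde_map G)"
  by (intro group_hom.intro group_hom_axioms.intro tilde_is_group is_group tilde_map_hom eq)

text \<open>The defining relations say this for a letter in place of \<open>X\<close>. It is the reason why the kernel of
  the projection is central.\<close>

lemma tilde_conj_gen:
  assumes "X \<in> carrier TG" "g \<in> E"
  shows "X \<otimes>\<^bsub>TG\<^esub> tg g = tg (tilde_map G X \<otimes> g \<otimes> inv (tilde_map G X)) \<otimes>\<^bsub>TG\<^esub> X"
proof -
  interpret T: group TG by (rule tilde_is_group)
  interpret h: group_hom TG G "tilde_map G" by (rule tilde_map_group_hom)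
  have "\<forall>g\<in>E. X \<otimes>\<^bsub>TG\<^esub> tg g = tg (tilde_map G X \<otimes> g \<otimes> inv (tilde_map G X)) \<otimes>\<^bsub>TG\<^esub> X"
    using assms(1)
  proof (induction rule: tilde_induct)
    case one
    then show ?case using equipment_subset[OF eq] by (auto simp: tilde_gen_closed)
  next
    case (gen a Y)
    show ?case
    proof
      fix g assume g: "g \<in> E"
      let ?y = "tilde_map G Y"
      have y: "?y \<in> carrier G" "a \<in> carrier G" "g \<in> carrier G"
        using gen g equipment_subset[OF eq] tilde_map_closed by auto
      have g': "?y \<otimes> g \<otimes> inv ?y \<in> E" using equipment_conj_closed[OF eq g y(1)] .
      have "tg a \<otimes>\<^bsub>TG\<^esub> Y \<otimes>\<^bsub>TG\<^esub> tg g = (tg a \<otimes>\<^bsub>TG\<^esub> tg (?y \<otimes> g \<otimes> inv ?y)) \<otimes>\<^bsub>TG\<^esub> Y"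
        using gen g g' by (simp add: T.m_assoc tilde_gen_closed)
      also have "\<dots> = tg (a \<otimes> (?y \<otimes> g \<otimes> inv ?y) \<otimes> inv a) \<otimes>\<^bsub>TG\<^esub> (tg a \<otimes>\<^bsub>TG\<^esub> Y)"
        unfolding tilde_gen_relation[OF gen(1) g']
        using gen g' y equipment_conj_closed[OF eq g' y(2)] by (simp add: T.m_assoc tilde_gen_closed)
      also have "a \<otimes> (?y \<otimes> g \<otimes> inv ?y) \<otimes> inv a = tilde_map G (tg a \<otimes>\<^bsub>TG\<^esub> Y) \<otimes> g \<otimes> inv (tilde_map G (tg a \<otimes>\<^bsub>TG\<^esub> Y))"
        using gen y by (simp add: tilde_map_mult tilde_gen_closed tilde_map_gen[OF eq] inv_mult_group m_assoc)
      finally show "tg a \<otimes>\<^bsub>TG\<^esub> Y \<otimes>\<^bsub>TG\<^esub> tg g = tg (tilde_map G (tg a \<otimes>\<^bsub>TG\<^esub> Y) \<otimes> g \<otimes> inv (tilde_map G (tg a \<otimes>\<^bsub>TG\<^esub> Y))) \<otimes>\<^bsub>TG\<^esub> (tg a \<otimes>\<^bsub>TG\<^esub> Y)" .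
    qed
  next
    case (inv a Y)
    show ?case
    proof
      fix g assume g: "g \<in> E"
      let ?y = "tilde_map G Y" and ?i = "inv\<^bsub>TG\<^esub> (tg a)"
      have y: "?y \<in> carrier G" "a \<in> carrier G" "g \<in> carrier G"
        using inv g equipment_subset[OF eq] tilde_map_closed by auto
      have g': "?y \<otimes> g \<otimes> inv ?y \<in> E" using equipment_conj_closed[OF eq g y(1)] .
      let ?g' = "?y \<otimes> g \<otimes> inv ?y"
      have g'': "inv a \<otimes> ?g' \<otimes> a \<in> E" using equipment_conj_closed[OF eq g', of "inv a"] y by simp
      have c: "tg a \<in> carrier TG" "tg ?g' \<in> carrier TG" "tg (inv a \<otimes> ?g' \<otimes> a) \<in> carrier TG"
        using inv(1) g' g'' by (auto intro: tilde_gen_closed)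
      have "a \<otimes> (inv a \<otimes> ?g' \<otimes> a) \<otimes> inv a = ?g'" using y by (simp add: m_assoc)
      then have rel: "tg a \<otimes>\<^bsub>TG\<^esub> tg (inv a \<otimes> ?g' \<otimes> a) = tg ?g' \<otimes>\<^bsub>TG\<^esub> tg a"
        using tilde_gen_relation[OF inv(1) g''] by simp
      have "?i \<otimes>\<^bsub>TG\<^esub> tg ?g' = ?i \<otimes>\<^bsub>TG\<^esub> (tg ?g' \<otimes>\<^bsub>TG\<^esub> tg a) \<otimes>\<^bsub>TG\<^esub> ?i" using c by (simp add: T.m_assoc)
      also have "\<dots> = tg (inv a \<otimes> ?g' \<otimes> a) \<otimes>\<^bsub>TG\<^esub> ?i" unfolding rel[symmetric] using c by (simp add: T.m_assoc)
      finally have rel': "?i \<otimes>\<^bsub>TG\<^esub> tg ?g' = tg (inv a \<otimes> ?g' \<otimes> a) \<otimes>\<^bsub>TG\<^esub> ?i" .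
      have "?i \<otimes>\<^bsub>TG\<^esub> Y \<otimes>\<^bsub>TG\<^esub> tg g = (?i \<otimes>\<^bsub>TG\<^esub> tg ?g') \<otimes>\<^bsub>TG\<^esub> Y"
        using inv g c by (simp add: T.m_assoc tilde_gen_closed)
      also have "\<dots> = tg (inv a \<otimes> ?g' \<otimes> a) \<otimes>\<^bsub>TG\<^esub> (?i \<otimes>\<^bsub>TG\<^esub> Y)"
        unfolding rel' using c inv by (simp add: T.m_assoc)
      also have "inv a \<otimes> ?g' \<otimes> a = tilde_map G (?i \<otimes>\<^bsub>TG\<^esub> Y) \<otimes> g \<otimes> inv (tilde_map G (?i \<otimes>\<^bsub>TG\<^esub> Y))"
        using inv y c by (simp add: tilde_map_mult tilde_map_gen[OF eq] inv_mult_group m_assoc)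
      finally show "?i \<otimes>\<^bsub>TG\<^esub> Y \<otimes>\<^bsub>TG\<^esub> tg g = tg (tilde_map G (?i \<otimes>\<^bsub>TG\<^esub> Y) \<otimes> g \<otimes> inv (tilde_map G (?i \<otimes>\<^bsub>TG\<^esub> Y))) \<otimes>\<^bsub>TG\<^esub> (?i \<otimes>\<^bsub>TG\<^esub> Y)" .
    qed
  qed
  then show ?thesis using assms(2) by blast
qed

lemma tilde_kernel_central:
  assumes X: "X \<in> carrier TG" "tilde_map G X = \<one>" and Y: "Y \<in> carrier TG"
  shows "X \<otimes>\<^bsub>TG\<^esub> Y = Y \<otimes>\<^bsub>TG\<^esub> X"
proof -
  interpret T: group TG by (rule tilde_is_group)
  have with_gen: "X \<otimes>\<^bsub>TG\<^esub> tg a = tg a \<otimes>\<^bsub>TG\<^esub> X" if "a \<in> E" for a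
    using tilde_conj_gen[OF X(1) that] X(2) equipment_subset[OF eq] that by (simp add: subset_iff)
  have with_inv: "X \<otimes>\<^bsub>TG\<^esub> inv\<^bsub>TG\<^esub> (tg a) = inv\<^bsub>TG\<^esub> (tg a) \<otimes>\<^bsub>TG\<^esub> X" if a: "a \<in> E" for a
  proof -
    let ?i = "inv\<^bsub>TG\<^esub> (tg a)"
    have c: "tg a \<in> carrier TG" using a by (rule tilde_gen_closed)
    have "X \<otimes>\<^bsub>TG\<^esub> ?i = ?i \<otimes>\<^bsub>TG\<^esub> (tg a \<otimes>\<^bsub>TG\<^esub> X) \<otimes>\<^bsub>TG\<^esub> ?i" using c X by (simp add: T.m_assoc)
    also have "\<dots> = ?i \<otimes>\<^bsub>TG\<^esub> X" unfolding with_gen[OF a, symmetric] using c X by (simp add: T.m_assoc)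
    finally show ?thesis .
  qed
  have step: "X \<otimes>\<^bsub>TG\<^esub> (Z \<otimes>\<^bsub>TG\<^esub> Y) = Z \<otimes>\<^bsub>TG\<^esub> Y \<otimes>\<^bsub>TG\<^esub> X"
    if c: "Z \<in> carrier TG" "Y \<in> carrier TG" and comm: "X \<otimes>\<^bsub>TG\<^esub> Z = Z \<otimes>\<^bsub>TG\<^esub> X" "X \<otimes>\<^bsub>TG\<^esub> Y = Y \<otimes>\<^bsub>TG\<^esub> X" for Y Z
  proof -
    have "X \<otimes>\<^bsub>TG\<^esub> (Z \<otimes>\<^bsub>TG\<^esub> Y) = (X \<otimes>\<^bsub>TG\<^esub> Z) \<otimes>\<^bsub>TG\<^esub> Y" using c X by (simp only: T.m_assoc)
    also have "\<dots> = Z \<otimes>\<^bsub>TG\<^esub> (X \<otimes>\<^bsub>TG\<^esub> Y)" unfolding comm(1) using c X by (simp only: T.m_assoc)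
    also have "\<dots> = Z \<otimes>\<^bsub>TG\<^esub> Y \<otimes>\<^bsub>TG\<^esub> X" unfolding comm(2) using c X by (simp only: T.m_assoc)
    finally show ?thesis .
  qed
  show ?thesis using Y
  proof (induction rule: tilde_induct)
    case one
    then show ?case using X by simp
  next
    case (gen a Y)
    then show ?case by (intro step with_gen tilde_gen_closed)
  next
    case (inv a Y)
    then show ?case by (intro step with_inv tilde_gen_closed T.inv_closed)
  qed
qed

lemma tilde_map_surj:
  assumes "p \<in> carrier G"
  shows "\<exists>X\<in>carrier TG. tilde_map G X = p"
proof -
  interpret T: group TG by (rule tilde_is_group)
  interpret h: group_hom TG G "tilde_map G" by (rule tilde_map_group_hom)
  have "p \<in> generate G E" using assms eq unfolding equipment_def by simp
  then show ?thesis
  proof (induction rule: generate.induct)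
    case one
    show ?case using h.hom_one T.one_closed by blast
  next
    case (incl a)
    then show ?case using tilde_gen_closed tilde_map_gen[OF eq] by blast
  next
    case (inv a)
    then show ?case using tilde_gen_closed[OF inv] tilde_map_gen[OF eq inv] h.hom_inv T.inv_closed by metis
  next
    case (eng p q)
    then show ?case using h.hom_mult T.m_closed by metis
  qed
qed

text \<open>The first family of relations is the second one for another pair of letters, so a single equation
  has to be assumed.\<close>

lemma tilde_universal:
  assumes H: "group H" and f: "\<And>a. a \<in> E \<Longrightarrow> f a \<in> carrier H"
    and rel: "\<And>a g. a \<in> E \<Longrightarrow> g \<in> E \<Longrightarrow> f a \<otimes>\<^bsub>H\<^esub> f g = f (a \<otimes> g \<otimes> inv a) \<otimes>\<^bsub>H\<^esub> f a"
  shows "\<exists>\<psi>\<in>hom TG H. \<forall>a\<in>E. \<psi> (tg a) = f a"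
proof -
  interpret H: group H by (rule H)
  let ?R = "equipment_relations G E"
  define ev where "ev u = word_value H (map (\<lambda>(b, a). (b, f a)) u)" for u
  have fE: "f ` E \<subseteq> carrier H" using f by blast
  have mapw: "map (\<lambda>(b, a). (b, f a)) u \<in> words (f ` E)" if "u \<in> words E" for u
    using that by (induction u) (auto simp: words_def)
  have ev_closed: "ev u \<in> carrier H" if "u \<in> words E" for u
    unfolding ev_def using H.word_value_closed[OF fE mapw[OF that]] .
  have ev_append: "ev (u @ v) = ev u \<otimes>\<^bsub>H\<^esub> ev v" if "u \<in> words E" "v \<in> words E" for u v
    unfolding ev_def map_append using H.word_value_append[OF fE mapw mapw] that by blast
  have ev_letters: "ev [(True, a)] = f a" "ev [(True, a), (True, g)] = f a \<otimes>\<^bsub>H\<^esub> f g" if "a \<in> E" "g \<in> E" for a g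
    using f that unfolding ev_def word_value_def by simp_all
  have ev_eq: "ev u = ev v" if "pres_eq E ?R u v" for u v
    using that
  proof (induction rule: pres_eq.induct)
    case (append u u' v v')
    then show ?case using ev_append pres_eq_words by metis
  next
    case (cancel a b)
    then show ?case using f[OF cancel] unfolding ev_def word_value_def by (cases b) simp_all
  next
    case (rel u v)
    from rel(1) consider g1 g2 where "g1 \<in> E" "g2 \<in> E" "u = [(True, g1), (True, g2)]" "v = [(True, g2), (True, inv g2 \<otimes> g1 \<otimes> g2)]"
      | g1 g2 where "g1 \<in> E" "g2 \<in> E" "u = [(True, g1), (True, g2)]" "v = [(True, g1 \<otimes> g2 \<otimes> inv g1), (True, g1)]"
      unfolding equipment_relations_def by blast
    then show ?case
    proof cases
      case 1
      have c: "g1 \<in> carrier G" "g2 \<in> carrier G" using 1 equipment_subset[OF eq] by auto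
      have g: "inv g2 \<otimes> g1 \<otimes> g2 \<in> E" using equipment_conj_closed[OF eq 1(1), of "inv g2"] c by simp
      have "g2 \<otimes> (inv g2 \<otimes> g1 \<otimes> g2) \<otimes> inv g2 = g1" using c by (simp add: m_assoc)
      then show ?thesis using assms(3)[OF 1(2) g] ev_letters 1 g by simp
    next
      case 2
      have g: "g1 \<otimes> g2 \<otimes> inv g1 \<in> E" using equipment_conj_closed[OF eq 2(2)] equipment_subset[OF eq] 2(1) by blast
      then show ?thesis using assms(3)[OF 2(1,2)] ev_letters 2 by simp
    qed
  qed auto
  define \<psi> where "\<psi> X = the_elem (ev ` X)" for X
  have \<psi>_class: "\<psi> (pres_rel E ?R `` {u}) = ev u" if "u \<in> words E" for u
  proof -
    have "ev ` (pres_rel E ?R `` {u}) = {ev u}"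
      using ev_eq pres_eq.refl[OF that] unfolding pres_rel_def by force
    then show ?thesis unfolding \<psi>_def by simp
  qed
  have "\<psi> \<in> hom TG H"
  proof (rule homI)
    fix X assume "X \<in> carrier TG"
    then obtain u where u: "u \<in> words E" "X = pres_rel E ?R `` {u}"
      unfolding tilde_group_def by (rule presented_group_carrierE)
    then show "\<psi> X \<in> carrier H" using \<psi>_class ev_closed by simp
    fix Y assume "Y \<in> carrier TG"
    then obtain v where v: "v \<in> words E" "Y = pres_rel E ?R `` {v}"
      unfolding tilde_group_def by (rule presented_group_carrierE)
    show "\<psi> (X \<otimes>\<^bsub>TG\<^esub> Y) = \<psi> X \<otimes>\<^bsub>H\<^esub> \<psi> Y"
      unfolding u(2) v(2) tilde_group_def presented_group_mult[OF u(1) v(1)]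
      using u v by (simp add: \<psi>_class words_append ev_append)
  qed
  moreover have "\<psi> (tg a) = f a" if "a \<in> E" for a
    unfolding tilde_gen_def using \<psi>_class[of "[(True, a)]"] ev_letters(1)[OF that that] that by (simp add: words_def)
  ultimately show ?thesis by blast
qed

lemma tilde_hom_eqI:
  assumes hom: "\<phi> \<in> hom TG H" "\<psi> \<in> hom TG H" and H: "group H"
    and gens: "\<And>a. a \<in> E \<Longrightarrow> \<phi> (tg a) = \<psi> (tg a)" and X: "X \<in> carrier TG"
  shows "\<phi> X = \<psi> X"
proof -
  interpret T: group TG by (rule tilde_is_group)
  interpret \<phi>: group_hom TG H \<phi> by (intro group_hom.intro group_hom_axioms.intro tilde_is_group H hom)
  interpret \<psi>: group_hom TG H \<psi> by (intro group_hom.intro group_hom_axioms.intro tilde_is_group H hom)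
  show ?thesis using X
    by (induction rule: tilde_induct) (simp_all add: gens tilde_gen_closed)
qed

end
end

section \<open>The ambiguity index\<close>

lemma alt_conj: "x \<in> carrier (alt_group d) \<Longrightarrow> x \<otimes>\<^bsub>alt_group d\<^esub> g \<otimes>\<^bsub>alt_group d\<^esub> inv\<^bsub>alt_group d\<^esub> x = x \<circ> g \<circ> inv' x"
  by (simp add: alt_group_mult alt_group_inv_equality)

lemma tilde_group_extension:
  assumes eq: "equipment (alt_group d) E"
  shows "alt_central_extension (tilde_group (alt_group d) E) d (tilde_map (alt_group d))"
proof -
  interpret A: group "alt_group d" by (rule alt_group_is_group)
  show ?thesis
  proof (intro alt_central_extension.intro alt_central_extension_axioms.intro A.tilde_is_group[OF eq])
    fix x y assume "x \<in> carrier (tilde_group (alt_group d) E)" "y \<in> carrier (tilde_group (alt_group d) E)"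
    then show "tilde_map (alt_group d) (x \<otimes>\<^bsub>tilde_group (alt_group d) E\<^esub> y) = tilde_map (alt_group d) x \<circ> tilde_map (alt_group d) y"
      using A.tilde_map_mult[OF eq] by (simp only: alt_group_mult)
  next
    fix x assume "x \<in> carrier (tilde_group (alt_group d) E)"
    then show "tilde_map (alt_group d) x \<in> carrier (alt_group d)" by (rule A.tilde_map_closed[OF eq])
  next
    fix p assume "p \<in> carrier (alt_group d)"
    then show "\<exists>x\<in>carrier (tilde_group (alt_group d) E). tilde_map (alt_group d) x = p" by (rule A.tilde_map_surj[OF eq])
  next
    fix k x assume "k \<in> carrier (tilde_group (alt_group d) E)" "tilde_map (alt_group d) k = id" "x \<in> carrier (tilde_group (alt_group d) E)"
    then show "k \<otimes>\<^bsub>tilde_group (alt_group d) E\<^esub> x = x \<otimes>\<^bsub>tilde_group (alt_group d) E\<^esub> k"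
      using A.tilde_kernel_central[OF eq] by (simp only: alt_group_one)
  qed
qed

text \<open>The conjugacy class of \<open>g\<close> in the alternating group splits into two classes of the double cover.\<close>

definition splits :: "nat \<Rightarrow> (nat \<Rightarrow> nat) \<Rightarrow> bool" where
  "splits d g \<longleftrightarrow> (\<forall>h\<in>carrier (alt_group d). h \<circ> g = g \<circ> h \<longrightarrow> spin_comm h g 1)"

lemma splits_if:
  assumes d: "d \<ge> 4" "d \<noteq> 6" "d \<noteq> 7" and g: "g \<in> carrier (alt_group d)"
    and good: "no_even_cycles d g \<or> even_cycle_distinct_lengths d g"
  shows "splits d g"
  unfolding splits_def
proof (intro ballI impI)
  fix h assume h: "h \<in> carrier (alt_group d)" and comm: "h \<circ> g = g \<circ> h"
  show "spin_comm h g 1"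
    using good
  proof
    assume "no_even_cycles d g"
    then obtain css where css: "cycle_factorization d g css" "\<forall>cs\<in>set css. odd (length cs)"
      unfolding no_even_cycles_def by blast
    obtain \<epsilon> :: real where \<epsilon>: "spin_comm g h \<epsilon>" "\<epsilon> = 1 \<or> \<epsilon> = -1"
      using spin_comm_dichotomy[OF d g h comm[symmetric]] by blast
    have "\<epsilon> = 1"
      using css alt_group_carrier'[OF h] \<epsilon> by (rule fac_spin_comm_odd_order)
    then show ?thesis using spin_comm_sym[OF \<epsilon>] by simp
  next
    assume "even_cycle_distinct_lengths d g"
    then obtain css where css: "cycle_factorization d g css" "distinct (map length css)"
      unfolding even_cycle_distinct_lengths_def by blast
    have "spin_comm h g (of_int (sign h))"
      using css _ _ comm by (rule fac_spin_comm_distinct_lengths) (use g h in \<open>simp_all add: alt_group_carrier\<close>)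
    moreover have "sign h = 1" using h by (simp add: alt_group_carrier sign_def)
    ultimately show ?thesis by simp
  qed
qed

lemma not_splits_if:
  assumes g: "g \<in> carrier (alt_group d)"
    and bad: "\<not> (no_even_cycles d g \<or> even_cycle_distinct_lengths d g)"
  shows "\<exists>h\<in>carrier (alt_group d). h \<circ> g = g \<circ> h \<and> spin_comm h g (-1)"
proof -
  have g': "g permutes {1..d}" "evenperm g" using g by (auto simp: alt_group_carrier)
  obtain css where css: "cycle_factorization d g css" using cycle_factorization_exists[OF g'(1)] by blast
  then obtain ds where ds: "ds \<in> set css" "even (length ds)"
    using bad unfolding no_even_cycles_def by blast
  then have "\<not> distinct (map length css)" using bad css unfolding even_cycle_distinct_lengths_def by blast
  then show ?thesis
    using fac_spin_anticommuting[OF css g'(2) ds] by (auto simp: alt_group_carrier)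
qed

lemma ambiguity_index_eq_card:
  assumes eq: "equipment (alt_group d) E"
  shows "ambiguity_index (alt_group d) E =
    card (derived (tilde_group (alt_group d) E) (carrier (tilde_group (alt_group d) E)) \<inter> {X. tilde_map (alt_group d) X = id})"
proof -
  interpret T: group "tilde_group (alt_group d) E"
    using group.tilde_is_group[OF alt_group_is_group eq] .
  have "kernel (tilde_group (alt_group d) E) (alt_group d) (tilde_map (alt_group d)) \<inter>
      derived (tilde_group (alt_group d) E) (carrier (tilde_group (alt_group d) E)) =
    derived (tilde_group (alt_group d) E) (carrier (tilde_group (alt_group d) E)) \<inter> {X. tilde_map (alt_group d) X = id}"
    using T.derived_in_carrier[OF order_refl] unfolding kernel_def alt_group_one by blast
  then show ?thesis unfolding ambiguity_index_def by simp
qed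

text \<open>An equivariant lift of \<open>E\<close> respects the defining relations, so the group of the equipment maps to
  the spin cover. There the commutator above the four-group is nontrivial.\<close>

lemma ambiguity_index_split:
  assumes d: "d \<ge> 4" "d \<noteq> 6" "d \<noteq> 7" and eq: "equipment (alt_group d) E"
    and split: "\<And>g. g \<in> E \<Longrightarrow> splits d g"
  shows "ambiguity_index (alt_group d) E = 2"
proof -
  let ?T = "tilde_group (alt_group d) E" and ?\<beta> = "tilde_map (alt_group d)" and ?S = "spin_group d"
  interpret A: group "alt_group d" by (rule alt_group_is_group)
  interpret T: alt_central_extension ?T d ?\<beta> by (rule tilde_group_extension[OF eq])
  interpret S: alt_central_extension ?S d fst by (rule spin_group_extension)
  have E: "E \<subseteq> carrier (alt_group d)" by (rule A.equipment_subset[OF eq])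
  have closed: "a \<circ> g \<circ> inv' a \<in> E" if "g \<in> E" "a \<in> carrier (alt_group d)" for g a
    using A.equipment_conj_closed[OF eq that] unfolding alt_conj[OF that(2)] .
  have fixed: "S.act h x = x"
    if x: "x \<in> carrier ?S" "fst x \<in> E" and h: "h \<in> carrier (alt_group d)" "h \<circ> fst x = fst x \<circ> h" for x h
  proof -
    obtain g u where gu: "x = (g, u)" by fastforce
    obtain v where v: "(h, v) \<in> carrier ?S" using S.\<pi>_surj[OF h(1)] by (metis prod.collapse)
    have "spin_comm h g 1" using split[of g] x h unfolding splits_def gu by simp
    moreover have "spin_lift h v" "spin_lift g u" using v x(1) unfolding gu spin_group_simps by auto
    ultimately have "v \<circ> u = u \<circ> v" using spin_commD[of h g 1 v u] by (simp add: fun_eq_iff)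
    then have "(h, v) \<otimes>\<^bsub>?S\<^esub> x = x \<otimes>\<^bsub>?S\<^esub> (h, v)" using h(2) unfolding gu spin_group_simps by simp
    then have "S.conj_by (h, v) x = x" using v x(1) by (intro S.conj_by_commuting)
    then show ?thesis using S.act_\<pi>[OF v x(1)] by simp
  qed
  obtain f where f: "\<And>g. g \<in> E \<Longrightarrow> f g \<in> carrier ?S" "\<And>g. g \<in> E \<Longrightarrow> fst (f g) = g"
    "\<And>g a. g \<in> E \<Longrightarrow> a \<in> carrier (alt_group d) \<Longrightarrow> f (a \<circ> g \<circ> inv' a) = S.act a (f g)"
    using S.exists_equivariant_lift[OF E closed fixed] by blast
  have rel: "f a \<otimes>\<^bsub>?S\<^esub> f g = f (a \<otimes>\<^bsub>alt_group d\<^esub> g \<otimes>\<^bsub>alt_group d\<^esub> inv\<^bsub>alt_group d\<^esub> a) \<otimes>\<^bsub>?S\<^esub> f a"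
    if ag: "a \<in> E" "g \<in> E" for a g
  proof -
    have a: "a \<in> carrier (alt_group d)" using E ag by blast
    show ?thesis
      unfolding alt_conj[OF a] f(3)[OF ag(2) a]
      using S.act_\<pi>_eq[OF f(1)[OF ag(1)] f(1)[OF ag(2)]] unfolding f(2)[OF ag(1)] by simp
  qed
  obtain \<psi> where \<psi>: "\<psi> \<in> hom ?T ?S" "\<And>a. a \<in> E \<Longrightarrow> \<psi> (tilde_gen (alt_group d) E a) = f a"
    using A.tilde_universal[OF eq spin_group_is_group f(1) rel] by blast
  interpret \<psi>: group_hom ?T ?S \<psi>
    by (intro group_hom.intro group_hom_axioms.intro T.is_group S.is_group \<psi>)
  have fst_hom: "fst \<circ> \<psi> \<in> hom ?T (alt_group d)"
  proof (rule homI)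
    fix X Y assume X: "X \<in> carrier ?T"
    then show "(fst \<circ> \<psi>) X \<in> carrier (alt_group d)" by (simp add: S.\<pi>_alt)
    assume Y: "Y \<in> carrier ?T"
    then show "(fst \<circ> \<psi>) (X \<otimes>\<^bsub>?T\<^esub> Y) = (fst \<circ> \<psi>) X \<otimes>\<^bsub>alt_group d\<^esub> (fst \<circ> \<psi>) Y"
      using X by (simp add: S.\<pi>_mult alt_group_mult)
  qed
  have fst_\<psi>: "fst (\<psi> X) = ?\<beta> X" if "X \<in> carrier ?T" for X
    using A.tilde_hom_eqI[OF eq fst_hom A.tilde_map_hom[OF eq] A.is_group _ that] \<psi>(2) f(2) A.tilde_map_gen[OF eq]
    by simp
  obtain X where X: "X \<in> carrier ?T" "?\<beta> X = v4c" using T.\<pi>_surj[OF v4_alt(3)[OF d(1)]] by blast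
  obtain Y where Y: "Y \<in> carrier ?T" "?\<beta> Y = v4a" using T.\<pi>_surj[OF v4_alt(1)[OF d(1)]] by blast
  define c where "c = commutator ?T X Y"
  have "?\<beta> c = id" unfolding c_def using X Y v4_relations(5,6) by (intro T.\<pi>_commutator) simp_all
  moreover have "c \<in> derived ?T (carrier ?T)"
    unfolding c_def by (rule commutator_derived[OF X(1) Y(1)])
  ultimately have c_in: "c \<in> derived ?T (carrier ?T) \<inter> {X. ?\<beta> X = id}" by blast
  have "c \<noteq> \<one>\<^bsub>?T\<^esub>"
  proof
    assume "c = \<one>\<^bsub>?T\<^esub>"
    then have "commutator ?S (\<psi> X) (\<psi> Y) = \<one>\<^bsub>?S\<^esub>"
      using X(1) Y(1) \<psi>.hom_one by (simp add: c_def \<psi>.hom_inv[symmetric] \<psi>.hom_mult[symmetric] del: \<psi>.hom_inv \<psi>.hom_mult)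
    moreover obtain a where a: "\<psi> X = (v4c, a)" using fst_\<psi>[OF X(1)] X(2) by (metis prod.collapse)
    moreover obtain b where b: "\<psi> Y = (v4a, b)" using fst_\<psi>[OF Y(1)] Y(2) by (metis prod.collapse)
    ultimately have one: "commutator ?S (v4c, a) (v4a, b) = \<one>\<^bsub>?S\<^esub>" by simp
    have ab: "(v4c, a) \<in> carrier ?S" "(v4a, b) \<in> carrier ?S"
      using \<psi>.hom_closed[OF X(1)] \<psi>.hom_closed[OF Y(1)] a b by auto
    have "snd (commutator ?S (v4c, a) (v4a, b)) = (\<lambda>w s. -1 * w s)"
      using spin_comm_four_group by (simp only: spin_group_commutator[OF ab])
    then have "snd \<one>\<^bsub>?S\<^esub> = (\<lambda>w s. -1 * w s)" unfolding one .
    moreover have "snd \<one>\<^bsub>?S\<^esub> = id" unfolding spin_group_simps by simp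
    ultimately show False using spin_scale_minus_one by metis
  qed
  moreover have one_in: "\<one>\<^bsub>?T\<^esub> \<in> derived ?T (carrier ?T) \<inter> {X. ?\<beta> X = id}"
    using T.\<pi>_one generate.one unfolding derived_def by blast
  moreover obtain z where "derived ?T (carrier ?T) \<inter> {X. ?\<beta> X = id} \<subseteq> {\<one>\<^bsub>?T\<^esub>, z}"
    using T.derived_kernel_le_two[OF d] by blast
  ultimately have "derived ?T (carrier ?T) \<inter> {X. ?\<beta> X = id} = {\<one>\<^bsub>?T\<^esub>, c}" using c_in by blast
  then show ?thesis
    unfolding ambiguity_index_eq_card[OF eq] using \<open>c \<noteq> \<one>\<^bsub>?T\<^esub>\<close> by simp
qed

text \<open>In the fibre product with the spin cover, the commutator above the pair \<open>h\<close>, \<open>g\<close> is \<open>(1, -1)\<close>. By the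
  bound it is the only nontrivial element of the derived kernel, and the projection to the group of the equipment maps
  this derived kernel onto the one there.\<close>

lemma ambiguity_index_nonsplit:
  assumes d: "d \<ge> 4" "d \<noteq> 6" "d \<noteq> 7" and eq: "equipment (alt_group d) E"
    and g: "g \<in> E" and h: "h \<in> carrier (alt_group d)" "h \<circ> g = g \<circ> h" "spin_comm h g (-1)"
  shows "ambiguity_index (alt_group d) E = 1"
proof -
  let ?T = "tilde_group (alt_group d) E" and ?\<beta> = "tilde_map (alt_group d)" and ?S = "spin_group d"
  interpret A: group "alt_group d" by (rule alt_group_is_group)
  interpret T: alt_central_extension ?T d ?\<beta> by (rule tilde_group_extension[OF eq])
  interpret S: alt_central_extension ?S d fst by (rule spin_group_extension)
  let ?P = "{(X, x). X \<in> carrier ?T \<and> x \<in> carrier ?S \<and> ?\<beta> X = fst x}"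
  interpret D: group "?T \<times>\<times> ?S" by (rule DirProd_group[OF T.is_group S.is_group])
  have P: "subgroup ?P (?T \<times>\<times> ?S)"
  proof (rule D.subgroupI)
    show "?P \<subseteq> carrier (?T \<times>\<times> ?S)" by auto
    have "(\<one>\<^bsub>?T\<^esub>, \<one>\<^bsub>?S\<^esub>) \<in> ?P" by (simp add: T.\<pi>_one S.\<pi>_one)
    then show "?P \<noteq> {}" by blast
  next
    fix a assume "a \<in> ?P"
    then obtain X x where a: "a = (X, x)" "X \<in> carrier ?T" "x \<in> carrier ?S" "?\<beta> X = fst x" by blast
    then show "inv\<^bsub>?T \<times>\<times> ?S\<^esub> a \<in> ?P"
      by (simp add: inv_DirProd[OF T.is_group S.is_group] T.\<pi>_inv S.\<pi>_inv)
  next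
    fix a b assume "a \<in> ?P" "b \<in> ?P"
    then obtain X x Y y where "a = (X, x)" "X \<in> carrier ?T" "x \<in> carrier ?S" "?\<beta> X = fst x"
      "b = (Y, y)" "Y \<in> carrier ?T" "y \<in> carrier ?S" "?\<beta> Y = fst y" by blast
    then show "a \<otimes>\<^bsub>?T \<times>\<times> ?S\<^esub> b \<in> ?P" by (simp add: T.\<pi>_mult S.\<pi>_mult)
  qed
  define F where "F = (?T \<times>\<times> ?S)\<lparr>carrier := ?P\<rparr>"
  have F_simps: "carrier F = ?P" "(X, x) \<otimes>\<^bsub>F\<^esub> (Y, y) = (X \<otimes>\<^bsub>?T\<^esub> Y, x \<otimes>\<^bsub>?S\<^esub> y)" "\<one>\<^bsub>F\<^esub> = (\<one>\<^bsub>?T\<^esub>, \<one>\<^bsub>?S\<^esub>)" for X Y x y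
    unfolding F_def by simp_all
  have F_group: "group F" unfolding F_def by (rule D.subgroup_imp_group[OF P])
  interpret F: alt_central_extension F d "?\<beta> \<circ> fst"
  proof (intro alt_central_extension.intro F_group alt_central_extension_axioms.intro)
    fix x y assume "x \<in> carrier F" "y \<in> carrier F"
    then show "(?\<beta> \<circ> fst) (x \<otimes>\<^bsub>F\<^esub> y) = (?\<beta> \<circ> fst) x \<circ> (?\<beta> \<circ> fst) y"
      by (cases x; cases y) (simp add: F_simps T.\<pi>_mult)
  next
    fix x assume "x \<in> carrier F"
    then show "(?\<beta> \<circ> fst) x \<in> carrier (alt_group d)" by (cases x) (simp add: F_simps T.\<pi>_alt)
  next
    fix p assume p: "p \<in> carrier (alt_group d)"
    obtain X where X: "X \<in> carrier ?T" "?\<beta> X = p" using T.\<pi>_surj[OF p] by blast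
    obtain x where x: "x \<in> carrier ?S" "fst x = p" using S.\<pi>_surj[OF p] by blast
    have "(X, x) \<in> carrier F" using X x by (simp add: F_simps)
    then show "\<exists>y\<in>carrier F. (?\<beta> \<circ> fst) y = p" using X by (intro bexI[of _ "(X, x)"]) simp_all
  next
    fix k y assume "k \<in> carrier F" "(?\<beta> \<circ> fst) k = id" "y \<in> carrier F"
    then show "k \<otimes>\<^bsub>F\<^esub> y = y \<otimes>\<^bsub>F\<^esub> k"
      using T.central[of "fst k" "fst y"] S.central[of "snd k" "snd y"]
      by (cases k; cases y) (simp add: F_simps)
  qed
  interpret p1: group_hom F ?T fst
  proof (intro group_hom.intro group_hom_axioms.intro F_group T.is_group homI)
    fix x y assume xy: "x \<in> carrier F" "y \<in> carrier F"
    then show "fst x \<in> carrier ?T" by (cases x) (simp add: F_simps)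
    show "fst (x \<otimes>\<^bsub>F\<^esub> y) = fst x \<otimes>\<^bsub>?T\<^esub> fst y" by (cases x; cases y) (simp add: F_simps)
  qed
  interpret p2: group_hom F ?S snd
  proof (intro group_hom.intro group_hom_axioms.intro F_group S.is_group homI)
    fix x y assume xy: "x \<in> carrier F" "y \<in> carrier F"
    then show "snd x \<in> carrier ?S" by (cases x) (simp add: F_simps)
    show "snd (x \<otimes>\<^bsub>F\<^esub> y) = snd x \<otimes>\<^bsub>?S\<^esub> snd y" by (cases x; cases y) (simp add: F_simps)
  qed
  obtain z where z: "derived F (carrier F) \<inter> {x. (?\<beta> \<circ> fst) x = id} \<subseteq> {\<one>\<^bsub>F\<^esub>, z}"
    using F.derived_kernel_le_two[OF d] by blast
  have gA: "g \<in> carrier (alt_group d)" using A.equipment_subset[OF eq] g by blast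
  obtain X where X: "X \<in> carrier ?T" "?\<beta> X = h" using T.\<pi>_surj[OF h(1)] by blast
  let ?Y = "tilde_gen (alt_group d) E g"
  have Y: "?Y \<in> carrier ?T" "?\<beta> ?Y = g" using A.tilde_gen_closed[OF eq g] A.tilde_map_gen[OF eq g] by auto
  obtain u where u: "(h, u) \<in> carrier ?S" using S.\<pi>_surj[OF h(1)] by (metis prod.collapse)
  obtain v where v: "(g, v) \<in> carrier ?S" using S.\<pi>_surj[OF gA] by (metis prod.collapse)
  have XF: "(X, (h, u)) \<in> carrier F" "(?Y, (g, v)) \<in> carrier F" using X Y u v by (simp_all add: F_simps)
  define c where "c = commutator F (X, (h, u)) (?Y, (g, v))"
  have "(?\<beta> \<circ> fst) c = id"
    unfolding c_def using X Y h(2) by (intro F.\<pi>_commutator[OF XF]) simp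
  moreover have "c \<in> derived F (carrier F)" unfolding c_def by (rule commutator_derived[OF XF])
  ultimately have c_in: "c \<in> derived F (carrier F) \<inter> {x. (?\<beta> \<circ> fst) x = id}" by blast
  have XY: "X \<otimes>\<^bsub>?T\<^esub> ?Y = ?Y \<otimes>\<^bsub>?T\<^esub> X"
  proof -
    have "h \<circ> g \<circ> inv' h = g" unfolding h(2) using alt_inv_comp(2)[OF h(1)] by (simp only: comp_assoc comp_id)
    then show ?thesis using A.tilde_conj_gen[OF eq X(1) g] unfolding X(2) alt_conj[OF h(1)] by simp
  qed
  have "fst c = commutator ?T X ?Y"
    unfolding c_def using XF by (simp add: p1.hom_inv)
  also have "\<dots> = \<one>\<^bsub>?T\<^esub>"
    unfolding XY using X Y by (simp add: T.m_assoc)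
  finally have fst_c: "fst c = \<one>\<^bsub>?T\<^esub>" .
  have "snd c = commutator ?S (h, u) (g, v)"
    unfolding c_def using XF by (simp add: p2.hom_inv)
  then have "snd (snd c) = (\<lambda>w s. -1 * w s)"
    using h(3) by (simp only: spin_group_commutator[OF u v])
  then have "c \<noteq> \<one>\<^bsub>F\<^esub>" using spin_scale_minus_one unfolding F_simps spin_group_simps by auto
  then have zc: "z = c" using z c_in by blast
  have trivial: "k = \<one>\<^bsub>?T\<^esub>" if k: "k \<in> derived ?T (carrier ?T)" "?\<beta> k = id" for k
  proof -
    have "fst ` carrier F = carrier ?T"
    proof
      show "fst ` carrier F \<subseteq> carrier ?T" by (auto simp: F_simps)
      show "carrier ?T \<subseteq> fst ` carrier F"
      proof
        fix X assume X: "X \<in> carrier ?T"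
        obtain x where "x \<in> carrier ?S" "fst x = ?\<beta> X" using S.\<pi>_surj[OF T.\<pi>_alt[OF X]] by blast
        then have "(X, x) \<in> carrier F" using X by (simp add: F_simps)
        then show "X \<in> fst ` carrier F" by force
      qed
    qed
    then have "k \<in> fst ` derived F (carrier F)"
      using p1.derived_img[OF order_refl] k(1) by simp
    then obtain y where y: "y \<in> derived F (carrier F)" "k = fst y" by blast
    then have "y \<in> {\<one>\<^bsub>F\<^esub>, c}" using z k(2) unfolding zc by auto
    moreover have "fst \<one>\<^bsub>F\<^esub> = \<one>\<^bsub>?T\<^esub>" unfolding F_simps by (rule fst_conv)
    ultimately show ?thesis unfolding y(2) using fst_c by blast
  qed
  have "\<one>\<^bsub>?T\<^esub> \<in> derived ?T (carrier ?T)" unfolding derived_def by (rule generate.one)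
  then have "derived ?T (carrier ?T) \<inter> {X. ?\<beta> X = id} = {\<one>\<^bsub>?T\<^esub>}"
    using trivial T.\<pi>_one by blast
  then show ?thesis unfolding ambiguity_index_eq_card[OF eq] by simp
qed

theorem theorem9:
  fixes d :: nat and E :: "(nat \<Rightarrow> nat) set"
  assumes "d \<ge> 4" and "d \<noteq> 6" and "d \<noteq> 7"
    and "equipment (alt_group d) E"
  shows "(ambiguity_index (alt_group d) E = 2 \<longleftrightarrow>
            (\<forall>p\<in>E. no_even_cycles d p \<or> even_cycle_distinct_lengths d p)) \<and>
         (\<not> (\<forall>p\<in>E. no_even_cycles d p \<or> even_cycle_distinct_lengths d p) \<longrightarrow>
            ambiguity_index (alt_group d) E = 1)"
proof -
  have E: "E \<subseteq> carrier (alt_group d)"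
    using group.equipment_subset[OF alt_group_is_group assms(4)] .
  show ?thesis
  proof (cases "\<forall>p\<in>E. no_even_cycles d p \<or> even_cycle_distinct_lengths d p")
    case True
    have "ambiguity_index (alt_group d) E = 2"
    proof (rule ambiguity_index_split[OF assms])
      fix g assume "g \<in> E"
      then show "splits d g" using E True by (intro splits_if[OF assms(1-3)]) auto
    qed
    then show ?thesis using True by simp
  next
    case False
    then obtain g where g: "g \<in> E" "\<not> (no_even_cycles d g \<or> even_cycle_distinct_lengths d g)" by blast
    obtain h where "h \<in> carrier (alt_group d)" "h \<circ> g = g \<circ> h" "spin_comm h g (-1)"
      using not_splits_if[OF subsetD[OF E g(1)] g(2)] by blast
    then have "ambiguity_index (alt_group d) E = 1"
      by (rule ambiguity_index_nonsplit[OF assms g(1)])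
    then show ?thesis using False by simp
  qed
qed

end
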